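(* There is a function $f:\mathbb{N}\to\mathbb{R}_{>0}$ with $f(n) = n^{5/4+o(1)}$ as $n\to\infty$ such that, for every sufficiently large $n$, every nontrivial monotone property of graphs on $n$ vertices all of whose members have at most $f(n)$ edges is evasive.
   Context: A graph property $\mathcal{P}_n$ of $n$-vertex graphs is a collection of (simple, undirected) graphs on the vertex set $\{1,\ldots,n\}$ that is invariant under relabelling of the vertices. It is monotone if it is preserved under deletion of edges, and nontrivial if it is neither empty nor the set of all graphs on $\{1,\ldots,n\}$. A Boolean function of $m$ variables is evasive if its deterministic query (decision-tree) complexity equals $m$. The property $\mathcal{P}_n$ is evasive if the Boolean function on $m=n(n-1)/2$ variables (the entries of the adjacency matrix, one per unordered pair of vertices) that decides whether the given graph belongs to $\mathcal{P}_n$ is evasive. "A property of graphs with at most $f(n)$ edges" means a property every member graph of which has at most $f(n)$ edges. *)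

theory Defs
  imports
    Complex_Main
    "HOL-Library.Landau_Symbols"
    "HOL-Library.Ramsey"
    "HOL-Combinatorics.Permutations"
begin

text \<open>
  A Boolean function whose variables are indexed by a finite set \<open>V\<close> is represented by
  \<open>f :: 'v set \<Rightarrow> bool\<close>; an input in \<open>{0,1}\<^sup>V\<close> is encoded as the subset of \<open>V\<close> of
  those variables having value 1. Only the values of \<open>f\<close> on \<open>Pow V\<close> matter.
\<close>

datatype 'v decision_tree =
    Answer bool
  | Query 'v "'v decision_tree" "'v decision_tree"

fun tree_vars :: "'v decision_tree \<Rightarrow> 'v set" where
  "tree_vars (Answer b) = {}"
| "tree_vars (Query v t0 t1) = insert v (tree_vars t0 \<union> tree_vars t1)"

fun tree_depth :: "'v decision_tree \<Rightarrow> nat" where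
  "tree_depth (Answer b) = 0"
| "tree_depth (Query v t0 t1) = Suc (max (tree_depth t0) (tree_depth t1))"

fun tree_eval :: "'v decision_tree \<Rightarrow> 'v set \<Rightarrow> bool" where
  "tree_eval (Answer b) X = b"
| "tree_eval (Query v t0 t1) X = (if v \<in> X then tree_eval t1 X else tree_eval t0 X)"

definition computes :: "'v set \<Rightarrow> 'v decision_tree \<Rightarrow> ('v set \<Rightarrow> bool) \<Rightarrow> bool" where
  "computes V t f \<longleftrightarrow> tree_vars t \<subseteq> V \<and> (\<forall>X. X \<subseteq> V \<longrightarrow> tree_eval t X = f X)"

definition query_complexity :: "'v set \<Rightarrow> ('v set \<Rightarrow> bool) \<Rightarrow> nat" where
  "query_complexity V f = (LEAST d. \<exists>t. computes V t f \<and> tree_depth t = d)"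

definition evasive :: "'v set \<Rightarrow> ('v set \<Rightarrow> bool) \<Rightarrow> bool" where
  "evasive V f \<longleftrightarrow> query_complexity V f = card V"

text \<open>
  A simple graph on the vertex set \<open>{1..n}\<close> is identified with its edge set, a set of
  two-element subsets of \<open>{1..n}\<close>.
\<close>

definition vertex_pairs :: "nat \<Rightarrow> nat set set" where
  "vertex_pairs n = nsets {1..n} 2"

definition graphs_on :: "nat \<Rightarrow> nat set set set" where
  "graphs_on n = Pow (vertex_pairs n)"

definition relabel :: "(nat \<Rightarrow> nat) \<Rightarrow> nat set set \<Rightarrow> nat set set" where
  "relabel \<pi> E = (\<lambda>e. \<pi> ` e) ` E"

definition graph_property :: "nat \<Rightarrow> nat set set set \<Rightarrow> bool" where
  "graph_property n P \<longleftrightarrow>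
     P \<subseteq> graphs_on n \<and> (\<forall>\<pi>. \<pi> permutes {1..n} \<longrightarrow> (\<forall>E\<in>P. relabel \<pi> E \<in> P))"

definition monotone_property :: "nat set set set \<Rightarrow> bool" where
  "monotone_property P \<longleftrightarrow> (\<forall>E\<in>P. \<forall>E'. E' \<subseteq> E \<longrightarrow> E' \<in> P)"

definition nontrivial_property :: "nat \<Rightarrow> nat set set set \<Rightarrow> bool" where
  "nontrivial_property n P \<longleftrightarrow> P \<noteq> {} \<and> P \<noteq> graphs_on n"

definition evasive_property :: "nat \<Rightarrow> nat set set set \<Rightarrow> bool" where
  "evasive_property n P \<longleftrightarrow> evasive (vertex_pairs n) (\<lambda>E. E \<in> P)"

end

theory Submission
  imports
    Defs
    "HOL-Number_Theory.Number_Theory"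
    "HOL-Analysis.Analysis"
    "HOL-Real_Asymp.Real_Asymp"
begin

text \<open>
  Write \<open>n = k p + r\<close> with \<open>p\<close>, \<open>r\<close> prime, and let \<open>q\<close> be a prime factor of \<open>r - 1\<close>. The vertex set splits into
  \<open>k\<close> copies of \<open>\<int>/p\<close> and one copy of \<open>\<int>/r\<close>. Let \<open>\<Gamma>\<close> be generated by the translations of the single blocks
  (a \<open>p\<close>-group), by one permutation that cycles through the blocks with a twist by a primitive root modulo
  \<open>p\<close> and translates \<open>\<int>/r\<close> (cyclic modulo the translations), and by the multiplication of \<open>\<int>/r\<close> by an element
  of order \<open>q\<close>. If a monotone property is not evasive, the order complex of the poset of its nonempty
  members is acyclic, so by Oliver's fixed point theorem some nonempty member is \<open>\<Gamma>\<close>-invariant; but every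
  \<open>\<Gamma>\<close>-orbit of vertex pairs has size about \<open>n min(p, q)\<close> when \<open>r\<close> and \<open>n - r\<close> are of size about \<open>n\<close>.

  It remains to find a prime \<open>r \<le> n\<close> such that \<open>r - 1\<close> and \<open>n - r\<close> both have a prime factor of size about
  \<open>n\<^sup>1\<^sup>/\<^sup>4\<close>. Selberg's sieve shows that at most \<open>(1/3 + o(1)) n / ln n\<close> primes violate either condition, whereas
  there are at least \<open>(ln 2 - o(1)) n / ln n\<close> primes up to \<open>n\<close>, and \<open>2/3 < ln 2\<close>.
\<close>

section \<open>The order complex of a finite poset\<close>

text \<open>The exponent 1/4 and the constant 1/3 belong together. Let \<open>Y\<close> be near the
  fourth root of \<open>n\<close>. Counted by pairs of distinct prime factors, a shifted prime all
  of whose prime factors are at most \<open>Y\<close> has weight about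
  \<open>ln n * (ln n - ln Y)\<close>, which is 3/4 of the squared logarithm. Sieving up to
  \<open>Y\<close> bounds the total weight by \<open>n / ln Y * (ln Y)^2\<close>, which is
  \<open>n * ln n / 4\<close>, plus errors of size \<open>Y^4\<close> up to logarithms. The errors
  fix the fourth root, and the quotient is 1/3 for each shift. Oliver's theorem wants a p-group at
  the bottom and a cyclic group above it, so rotating the blocks and translating the prime block
  must come from one permutation. This is arranged by making \<open>k * (p - 1)\<close> and
  \<open>r\<close> coprime, an extra demand on \<open>r\<close> that is met by discarding a few more
  primes. The order complex is used because an order automorphism mapping a chain to itself fixes it
  pointwise, so invariant chains consist of invariant graphs. Homology is written with integer
  functions and divisibility, so that traces stay integers.\<close>

definition chains_of :: "'a::order set \<Rightarrow> 'a set set" where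
  "chains_of X = {c. c \<subseteq> X \<and> (\<forall>x\<in>c. \<forall>y\<in>c. x \<le> y \<or> y \<le> x)}"

definition ext_points :: "'a::order set \<Rightarrow> 'a set \<Rightarrow> 'a set" where
  "ext_points X c = {x \<in> X - c. \<forall>y\<in>c. x < y \<or> y < x}"

definition bd_sign :: "'a::order \<Rightarrow> 'a set \<Rightarrow> int" where
  "bd_sign x c = (-1) ^ card {y\<in>c. y < x}"

text \<open>The simplicial boundary on coefficient functions: \<open>f\<close> gives the coefficient
  of each chain, and the coefficient of the boundary at \<open>c\<close> comes from the chains with
  one more element. The empty chain belongs to \<open>chains_of X\<close>, so this is the augmented
  complex.\<close>

definition bd :: "'a::order set \<Rightarrow> ('a set \<Rightarrow> int) \<Rightarrow> 'a set \<Rightarrow> int" where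
  "bd X f c = (\<Sum>x\<in>ext_points X c. bd_sign x c * f (insert x c))"

text \<open>Vanishing of reduced homology with coefficients modulo \<open>p\<close>, in all degrees
  at once: the boundary shifts the size of chains by exactly one, so a total cycle is a cycle in
  each degree.\<close>

definition acyclic_mod :: "int \<Rightarrow> 'a::order set \<Rightarrow> bool" where
  "acyclic_mod p X \<longleftrightarrow>
     (\<forall>f. (\<forall>c\<in>chains_of X. p dvd bd X f c) \<longrightarrow>
        (\<exists>h. \<forall>c\<in>chains_of X. p dvd bd X h c - f c))"

lemma chains_of_subset: "c \<in> chains_of X \<Longrightarrow> c \<subseteq> X"
  by (auto simp: chains_of_def)

lemma finite_chain: "finite X \<Longrightarrow> c \<in> chains_of X \<Longrightarrow> finite c"
  using chains_of_subset finite_subset by blast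

lemma finite_chains_of: "finite X \<Longrightarrow> finite (chains_of X)"
  by (rule finite_subset[of _ "Pow X"]) (auto simp: chains_of_def)

lemma finite_ext_points: "finite X \<Longrightarrow> finite (ext_points X c)"
  by (simp add: ext_points_def)

lemma ext_points_notin: "x \<in> ext_points X c \<Longrightarrow> x \<notin> c"
  by (simp add: ext_points_def)

lemma insert_chain: "c \<in> chains_of X \<Longrightarrow> x \<in> ext_points X c \<Longrightarrow> insert x c \<in> chains_of X"
  unfolding chains_of_def ext_points_def by (auto simp: less_le)

lemma bd_cong:
  assumes "c \<in> chains_of X" "\<And>d. d \<in> chains_of X \<Longrightarrow> f d = h d"
  shows "bd X f c = bd X h c"
  unfolding bd_def by (rule sum.cong) (use assms insert_chain in auto)

lemma bd_diff: "bd X (\<lambda>c. f c - h c) c = bd X f c - bd X h c"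
  by (simp add: bd_def sum_subtractf algebra_simps)

text \<open>The boundary at \<open>c\<close> reads \<open>f\<close> only on strictly larger chains.
  Restricting the hypothesis to these lets the Smith argument truncate chains below a given
  size.\<close>

lemma bd_cong_mod:
  assumes "c \<in> chains_of X" "\<And>d. d \<in> chains_of X \<Longrightarrow> card d > card c \<Longrightarrow> p dvd f d - h d" "finite X"
  shows "p dvd bd X f c - bd X h c"
  unfolding bd_diff[symmetric] unfolding bd_def
proof (rule dvd_sum)
  fix x assume x: "x \<in> ext_points X c"
  have "card (insert x c) > card c"
    using x finite_chain[OF assms(3,1)] ext_points_notin by fastforce
  then show "p dvd bd_sign x c * (f (insert x c) - h (insert x c))"
    using assms(2)[OF insert_chain[OF assms(1) x]] by simp
qed

lemma bd_sum: "bd X (\<lambda>c. \<Sum>i\<in>I. a i * f i c) c = (\<Sum>i\<in>I. a i * bd X (f i) c)"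
  unfolding bd_def sum_distrib_left
  by (subst sum.swap) (simp add: algebra_simps)

lemma ext_points_swap:
  assumes "c \<in> chains_of X"
  shows "x \<in> ext_points X c \<and> y \<in> ext_points X (insert x c) \<longleftrightarrow>
    y \<in> ext_points X c \<and> x \<in> ext_points X (insert y c)"
  by (auto simp: ext_points_def)

lemma bd_sign_insert:
  assumes "finite c" "y \<notin> c" 
  shows "bd_sign x (insert y c) = (if y < x then - bd_sign x c else bd_sign x c)"
proof -
  have "{z \<in> insert y c. z < x} = (if y < x then insert y {z\<in>c. z < x} else {z\<in>c. z < x})"
    by auto
  then show ?thesis using assms by (auto simp: bd_sign_def)
qed

lemma bd_sign_square: "bd_sign x c * bd_sign x c = 1"
  by (simp add: bd_sign_def flip: power_add mult_2)

text \<open>Inserting \<open>x\<close> and then \<open>y\<close> reaches the same chain as inserting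
  \<open>y\<close> and then \<open>x\<close>, but with the opposite sign, because the smaller point
  shifts the position of the larger one. So the double sum equals its own negative.\<close>

lemma bd_bd:
  assumes X: "finite X" and c: "c \<in> chains_of X"
  shows "bd X (bd X f) c = 0"
proof -
  let ?T = "Sigma (ext_points X c) (\<lambda>x. ext_points X (insert x c))"
  let ?F = "\<lambda>(x,y). bd_sign x c * bd_sign y (insert x c) * f (insert y (insert x c))"
  have fc: "finite c" by (rule finite_chain[OF X c])
  have "bd X (bd X f) c = (\<Sum>x\<in>ext_points X c. \<Sum>y\<in>ext_points X (insert x c).
      bd_sign x c * bd_sign y (insert x c) * f (insert y (insert x c)))"
    unfolding bd_def by (simp add: sum_distrib_left mult.assoc)
  also have "\<dots> = sum ?F ?T"
    by (subst sum.Sigma) (auto simp: X finite_ext_points)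
  finally have 1: "bd X (bd X f) c = sum ?F ?T" .
  have sw: "prod.swap z \<in> ?T" if "z \<in> ?T" for z
    using that ext_points_swap[OF c] by auto
  have "sum ?F ?T = (\<Sum>z\<in>?T. - ?F z)"
  proof (rule sum.reindex_bij_witness[of _ prod.swap prod.swap])
    fix z assume z: "z \<in> ?T"
    then obtain x y where xy: "z = (x,y)" "x \<in> ext_points X c" "y \<in> ext_points X (insert x c)" by auto
    have yx: "y \<in> ext_points X c" "x \<in> ext_points X (insert y c)"
      using xy ext_points_swap[OF c] by blast+
    have n: "x \<notin> c" "y \<notin> c" using xy yx by (auto dest: ext_points_notin)
    have cmp: "x < y \<or> y < x" using xy by (auto simp: ext_points_def)
    show "- ?F (prod.swap z) = ?F z"
      using cmp by (auto simp: xy bd_sign_insert[OF fc n(1)] bd_sign_insert[OF fc n(2)] insert_commute)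
  qed (simp_all only: sw swap_swap)
  then have "sum ?F ?T = 0" by (simp add: sum_negf)
  with 1 show ?thesis by simp
qed

text \<open>The coefficients on chains through \<open>x\<close>, read as a chain of the link of
  \<open>x\<close>. The sign makes this map anticommute with the boundary.\<close>

definition star_part :: "'a::order \<Rightarrow> ('a set \<Rightarrow> int) \<Rightarrow> 'a set \<Rightarrow> int" where
  "star_part x f c = bd_sign x c * f (insert x c)"

lemma bd_star_part:
  assumes X: "finite X" and x: "x \<in> X" and c: "c \<in> chains_of {y\<in>X. y < x \<or> x < y}"
  shows "bd {y\<in>X. y < x \<or> x < y} (star_part x f) c = - bd_sign x c * bd X f (insert x c)"
proof -
  let ?L = "{y\<in>X. y < x \<or> x < y}"
  have fc: "finite c" and cL: "c \<subseteq> ?L"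
    using finite_chain[of ?L c] X c chains_of_subset[OF c] by auto
  have xc: "x \<notin> c" using cL by auto
  have e: "ext_points ?L c = ext_points X (insert x c)"
    by (auto simp: ext_points_def)
  show ?thesis unfolding bd_def e sum_distrib_left
  proof (rule sum.cong[OF refl])
    fix y assume y: "y \<in> ext_points X (insert x c)"
    have yc: "y \<notin> c" and cmp: "y < x \<or> x < y" using y by (auto simp: ext_points_def)
    show "bd_sign y c * star_part x f (insert y c) =
        - bd_sign x c * (bd_sign y (insert x c) * f (insert y (insert x c)))"
      using cmp unfolding star_part_def
      by (auto simp: bd_sign_insert[OF fc xc] bd_sign_insert[OF fc yc] insert_commute)
  qed
qed

lemma insert_chain_star:
  assumes x: "x \<in> X" and c: "c \<in> chains_of {y\<in>X. y < x \<or> x < y}"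
  shows "insert x c \<in> chains_of X"
  using assms unfolding chains_of_def by (auto simp: less_le)

lemma remove_chain_star:
  assumes c: "c \<in> chains_of X" and "x \<in> c"
  shows "c - {x} \<in> chains_of {y\<in>X. y < x \<or> x < y}"
  using assms unfolding chains_of_def by (auto simp: less_le)

text \<open>Adding \<open>x\<close> glues a cone over its link to the order complex of
  \<open>X\<close>. Acyclicity of the link clears a cycle of the chains through \<open>x\<close>,
  and the rest is a cycle of \<open>X\<close>.\<close>

lemma acyclic_mod_add_point:
  assumes X: "finite X" and x: "x \<notin> X" and A: "acyclic_mod p X"
    and L: "acyclic_mod p {y\<in>X. y < x \<or> x < y}"
  shows "acyclic_mod p (insert x X)"
  unfolding acyclic_mod_def
proof (intro allI impI)
  let ?Y = "insert x X"
  let ?L = "{y\<in>X. y < x \<or> x < y}"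
  have Y: "finite ?Y" using X by simp
  have LY: "{y\<in>?Y. y < x \<or> x < y} = ?L" by auto
  fix f assume f: "\<forall>c\<in>chains_of ?Y. p dvd bd ?Y f c"
  have "p dvd bd ?L (star_part x f) c" if "c \<in> chains_of ?L" for c
    using bd_star_part[OF Y, of x c f, unfolded LY] insert_chain_star[of x ?Y c, unfolded LY] that f by simp
  then obtain u where u: "\<And>c. c \<in> chains_of ?L \<Longrightarrow> p dvd bd ?L u c - star_part x f c"
    using L unfolding acyclic_mod_def by blast
  have xL: "x \<notin> e" if "e \<in> chains_of ?L" for e
    using chains_of_subset[OF that] by blast
  \<comment> \<open>The cone over \<open>u\<close> with apex \<open>x\<close>. The minus sign
    compensates the anticommutation in \<open>bd_star_part\<close>, so that modulo \<open>p\<close>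
    the boundary of \<open>H\<close> agrees with \<open>f\<close> on chains through
    \<open>x\<close>.\<close>
  define H where "H c = (if x \<in> c then - bd_sign x (c - {x}) * u (c - {x}) else 0)" for c
  have star_H: "star_part x H c = - u c" if "x \<notin> c" for c
    using that bd_sign_square[of x c] unfolding star_part_def H_def by (simp flip: mult.assoc)
  have bH: "p dvd bd ?Y H c - f c" if c: "c \<in> chains_of ?Y" "x \<in> c" for c
  proof -
    define d where "d = c - {x}"
    have d: "d \<in> chains_of ?L" "c = insert x d" "x \<notin> d"
      using remove_chain_star[OF c] LY c by (auto simp: d_def)
    have "bd ?L (star_part x H) d = - bd_sign x d * bd ?Y H c"
      using bd_star_part[OF Y, of x d H, unfolded LY] d by simp
    moreover have "bd ?L (star_part x H) d = bd ?L (\<lambda>c. 0 - u c) d"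
      by (rule bd_cong[OF d(1)]) (simp add: star_H xL)
    moreover have "bd ?L (\<lambda>c. 0 - u c) d = - bd ?L u d"
      unfolding bd_diff by (simp add: bd_def)
    ultimately have "bd ?L u d = bd_sign x d * bd ?Y H c" by simp
    then have "p dvd bd_sign x d * bd ?Y H c - bd_sign x d * f c"
      using u[OF d(1)] d(2) by (simp add: star_part_def)
    then have "p dvd bd_sign x d * (bd_sign x d * (bd ?Y H c - f c))"
      by (metis dvd_mult right_diff_distrib)
    then show ?thesis by (simp add: bd_sign_square flip: mult.assoc)
  qed
  \<comment> \<open>On chains through \<open>x\<close> the difference \<open>f - bd H\<close> is
    only divisible by \<open>p\<close>; setting it to zero there makes it a chain of
    \<open>X\<close>.\<close>
  define f' where "f' c = (if x \<in> c then 0 else f c - bd ?Y H c)" for c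
  have f': "p dvd f' c - (f c - bd ?Y H c)" if c: "c \<in> chains_of ?Y" for c
    using bH[OF c] by (auto simp: f'_def)
  have XY: "c \<in> chains_of X \<longleftrightarrow> c \<in> chains_of ?Y \<and> x \<notin> c" for c
    using x by (auto simp: chains_of_def)
  have bdXY: "bd ?Y h c = bd X h c" if "c \<in> chains_of X" "\<And>d. x \<in> d \<Longrightarrow> h d = 0" for h c
    unfolding bd_def
    by (rule sum.mono_neutral_right) (use that x Y in \<open>auto simp: finite_ext_points ext_points_def\<close>)
  have "p dvd bd X f' c" if c: "c \<in> chains_of X" for c
  proof -
    have cY: "c \<in> chains_of ?Y" using c XY by blast
    have "p dvd bd ?Y f' c - bd ?Y (\<lambda>c. f c - bd ?Y H c) c"
      by (rule bd_cong_mod[OF cY _ Y]) (use f' in blast)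
    moreover have "p dvd bd ?Y (\<lambda>c. f c - bd ?Y H c) c"
      using f cY by (simp add: bd_diff bd_bd[OF Y cY])
    ultimately have "p dvd (bd ?Y f' c - bd ?Y (\<lambda>c. f c - bd ?Y H c) c) + bd ?Y (\<lambda>c. f c - bd ?Y H c) c"
      by (rule dvd_add)
    then have "p dvd bd ?Y f' c" by simp
    moreover have "bd ?Y f' c = bd X f' c" by (rule bdXY[OF c]) (simp add: f'_def)
    ultimately show ?thesis by simp
  qed
  then obtain w where w: "\<And>c. c \<in> chains_of X \<Longrightarrow> p dvd bd X w c - f' c"
    using A unfolding acyclic_mod_def by blast
  define w' where "w' c = (if x \<in> c then 0 else w c)" for c
  have "p dvd bd ?Y (\<lambda>c. w' c + H c) c - f c" if c: "c \<in> chains_of ?Y" for c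
  proof (cases "x \<in> c")
    case True
    have "bd ?Y w' c = 0" using True by (simp add: bd_def w'_def)
    then have "bd ?Y (\<lambda>c. w' c - (0 - H c)) c = bd ?Y H c"
      unfolding bd_diff by (simp add: bd_def)
    then show ?thesis using bH[OF c True] by simp
  next
    case False
    then have cX: "c \<in> chains_of X" using c XY by blast
    have "bd ?Y w' c = bd X w' c" by (rule bdXY[OF cX]) (simp add: w'_def)
    also have "\<dots> = bd X w c"
      by (rule bd_cong[OF cX]) (use XY in \<open>auto simp: w'_def\<close>)
    finally have "bd ?Y (\<lambda>c. w' c - (0 - H c)) c = bd X w c + bd ?Y H c"
      unfolding bd_diff by (simp add: bd_def)
    then show ?thesis using w[OF cX] False by (simp add: f'_def algebra_simps)
  qed
  then show "\<exists>h. \<forall>c\<in>chains_of ?Y. p dvd bd ?Y h c - f c" by blast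
qed

text \<open>Every chain can be extended by \<open>w\<close>, so the order complex is a cone with
  apex \<open>w\<close>. The witness \<open>h\<close> is the cone over the cycle
  \<open>f\<close>.\<close>

lemma acyclic_mod_cone:
  assumes X: "finite X" and w: "w \<in> X" and cmp: "\<And>x. x \<in> X \<Longrightarrow> x \<le> w \<or> w \<le> x"
  shows "acyclic_mod p X"
  unfolding acyclic_mod_def
proof (intro allI impI)
  fix f assume f: "\<forall>c\<in>chains_of X. p dvd bd X f c"
  let ?L = "{y\<in>X. y < w \<or> w < y}"
  define h where "h c = (if w \<in> c then bd_sign w (c - {w}) * f (c - {w}) else 0)" for c
  have star: "star_part w h c = f c" if "w \<notin> c" for c
    using that bd_sign_square[of w c] unfolding star_part_def h_def by (simp flip: mult.assoc)
  have LX: "c \<in> chains_of ?L \<longleftrightarrow> c \<in> chains_of X \<and> w \<notin> c" for c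
    using cmp unfolding chains_of_def by (auto simp: less_le)
  have wext: "w \<in> ext_points X c" if "c \<in> chains_of X" "w \<notin> c" for c
    using that w cmp unfolding ext_points_def chains_of_def by (auto simp: less_le)
  have eL: "ext_points ?L c = ext_points X c - {w}" for c
    using cmp unfolding ext_points_def by (auto simp: less_le)
  have split: "bd X g c = bd ?L g c + bd_sign w c * g (insert w c)"
    if "c \<in> chains_of X" "w \<notin> c" for g c
    unfolding bd_def eL 
    using sum.remove[OF finite_ext_points[OF X] wext[OF that], of "\<lambda>x. bd_sign x c * g (insert x c)"] by simp
  have "p dvd bd X h c - f c" if c: "c \<in> chains_of X" for c
  proof (cases "w \<in> c")
    case False
    have "bd ?L h c = 0" unfolding bd_def
      by (rule sum.neutral) (use False in \<open>auto simp: h_def ext_points_def\<close>)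
    then have "bd X h c = f c" using split[OF c False, of h] star[OF False]
      by (simp add: star_part_def)
    then show ?thesis by simp
  next
    case True
    define d where "d = c - {w}"
    have d: "d \<in> chains_of ?L" "c = insert w d" "w \<notin> d"
      using remove_chain_star[OF c True] True by (auto simp: d_def)
    then have dX: "d \<in> chains_of X" using LX by blast
    have "bd ?L (star_part w h) d = bd ?L f d"
      by (rule bd_cong[OF d(1)]) (use star LX in blast)
    then have "bd ?L f d = - bd_sign w d * bd X h c"
      using bd_star_part[OF X w d(1), of h] d(2) by simp
    then have "bd X f d = bd_sign w d * (f c - bd X h c)"
      using split[OF dX d(3), of f] d(2) by (simp add: algebra_simps)
    then have "p dvd bd_sign w d * (bd_sign w d * (f c - bd X h c))" using f dX by fastforce
    then have "p dvd f c - bd X h c" by (simp add: bd_sign_square flip: mult.assoc)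
    then show ?thesis by (metis dvd_minus_iff minus_diff_eq)
  qed
  then show "\<exists>h. \<forall>c\<in>chains_of X. p dvd bd X h c - f c" by blast
qed

section \<open>Automorphisms of prime order\<close>

locale prime_action =
  fixes K :: "'k set" and \<gamma> :: "'k \<Rightarrow> 'k" and p :: nat
  assumes p: "prime p" and maps: "\<And>c. c \<in> K \<Longrightarrow> \<gamma> c \<in> K"
    and order: "\<And>c. c \<in> K \<Longrightarrow> (\<gamma> ^^ p) c = c"
begin

definition orb :: "'k \<Rightarrow> 'k set" where "orb c = (\<lambda>i. (\<gamma> ^^ i) c) ` {..<p}"

text \<open>The choice is made from the orbit as a set, so the representative is the same all along
  the orbit.\<close>

definition orb_rep :: "'k \<Rightarrow> 'k" where "orb_rep c = (SOME d. d \<in> orb c)"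

lemma p_pos: "p > 0" using p prime_gt_0_nat by blast

lemma funpow_maps: "c \<in> K \<Longrightarrow> (\<gamma> ^^ i) c \<in> K"
  by (induction i) (auto simp: maps)

lemma funpow_mod: 
  assumes "c \<in> K" shows "(\<gamma> ^^ i) c = (\<gamma> ^^ (i mod p)) c"
proof -
  have 1: "(\<gamma> ^^ (p * k)) c = c" for k
  proof (induction k)
    case (Suc k)
    have "(\<gamma> ^^ (p * Suc k)) c = (\<gamma> ^^ p) ((\<gamma> ^^ (p * k)) c)"
      by (simp add: funpow_add)
    then show ?case using Suc order[OF assms] by simp
  qed simp
  have "(\<gamma> ^^ (i mod p + p * (i div p))) c = (\<gamma> ^^ (i mod p)) c"
    by (simp only: funpow_add o_apply 1)
  then show ?thesis by simp
qed

lemma orb_iff: "c \<in> K \<Longrightarrow> d \<in> orb c \<longleftrightarrow> (\<exists>i. d = (\<gamma> ^^ i) c)"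
  unfolding orb_def using funpow_mod[of c] p_pos
  by (metis (no_types, lifting) image_iff lessThan_iff mod_less_divisor)

lemma orb_step:
  assumes "c \<in> K" shows "orb (\<gamma> c) = orb c"
proof -
  have "(\<gamma> ^^ i) c = (\<gamma> ^^ (i + p - 1)) (\<gamma> c)" for i
  proof -
    have "(\<gamma> ^^ (i + p - 1)) (\<gamma> c) = (\<gamma> ^^ Suc (i + p - 1)) c" by (simp add: funpow_swap1)
    also have "Suc (i + p - 1) = i + p" using p_pos by simp
    finally show ?thesis using order[OF assms] by (simp add: funpow_add)
  qed
  moreover have "(\<gamma> ^^ i) (\<gamma> c) = (\<gamma> ^^ Suc i) c" for i by (simp add: funpow_swap1)
  ultimately show ?thesis
    using orb_iff[OF assms] orb_iff[OF maps[OF assms]] by (metis subsetI subset_antisym)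
qed

lemma orb_rep_step: "c \<in> K \<Longrightarrow> orb_rep (\<gamma> c) = orb_rep c"
  by (simp add: orb_rep_def orb_step)

lemma orb_rep_funpow: "c \<in> K \<Longrightarrow> orb_rep ((\<gamma> ^^ i) c) = orb_rep c"
  by (induction i) (simp_all add: orb_rep_step funpow_maps)

lemma orb_rep_in: "c \<in> K \<Longrightarrow> orb_rep c \<in> orb c"
  unfolding orb_rep_def by (rule someI[of _ c]) (auto simp: orb_iff intro: exI[of _ 0])

text \<open>A coincidence would make \<open>c\<close> fixed by the \<open>m\<close>-th power of
  \<open>\<gamma>\<close> for some \<open>0 < m < p\<close>; inverting \<open>m\<close> modulo the
  prime \<open>p\<close> would make it fixed by \<open>\<gamma>\<close> itself.\<close>

lemma funpow_inj:
  assumes c: "c \<in> K" "\<gamma> c \<noteq> c" and ij: "i < p" "j < p" "(\<gamma> ^^ i) c = (\<gamma> ^^ j) c"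
  shows "i = j"
proof -
  have False if ij: "i < j" "j < p" and eq: "(\<gamma> ^^ i) c = (\<gamma> ^^ j) c" for i j
  proof -
    define m where "m = j - i"
    have "(\<gamma> ^^ (p - i + i)) c = (\<gamma> ^^ (p - i + j)) c"
      by (metis eq funpow_add o_apply)
    also have "p - i + j = m + p" using ij m_def by simp
    also have "(\<gamma> ^^ (m + p)) c = (\<gamma> ^^ m) c" using order[OF c(1)] by (simp add: funpow_add)
    also have "p - i + i = p" using ij by simp
    finally have m: "(\<gamma> ^^ m) c = c" using order[OF c(1)] by argo
    have mk: "(\<gamma> ^^ (k * m)) c = c" for k
    proof (induction k)
      case (Suc k)
      have "(\<gamma> ^^ (Suc k * m)) c = (\<gamma> ^^ m) ((\<gamma> ^^ (k * m)) c)" by (simp add: funpow_add)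
      then show ?case using Suc m by simp
    qed simp
    have "m < p" "m > 0" using ij m_def by auto
    then have "coprime m p"
      using p by (metis coprime_commute nat_dvd_not_less prime_imp_coprime)
    then obtain u where u: "[m * u = 1] (mod p)"
      using cong_solve_coprime_nat[of m p] by auto
    have "u * m mod p = 1" using u p prime_gt_1_nat[OF p] by (simp add: unique_euclidean_semiring_class.cong_def mult.commute)
    then have "c = \<gamma> c" using mk[of u] funpow_mod[OF c(1), of "u * m"] by simp
    with c(2) show False by simp
  qed
  then show ?thesis using ij by (metis linorder_neqE_nat)
qed

text \<open>On an orbit of \<open>p\<close> points, a function invariant modulo \<open>p\<close> is
  the norm of its value placed at one representative. This is one of the two exactness properties of
  a free module over the group ring of a cyclic group.\<close>

lemma norm_image_decomp:
  assumes y: "\<And>c. c \<in> K \<Longrightarrow> int p dvd y c - y (\<gamma> c)"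
  shows "\<exists>h. \<forall>c\<in>K. \<gamma> c \<noteq> c \<longrightarrow> int p dvd y c - (\<Sum>i<p. h ((\<gamma> ^^ i) c))"
proof (intro exI ballI impI)
  fix c assume c: "c \<in> K" "\<gamma> c \<noteq> c"
  let ?h = "\<lambda>d. if d = orb_rep d then y d else (0::int)"
  obtain j where j: "j < p" "orb_rep c = (\<gamma> ^^ j) c" using orb_rep_in[OF c(1)] by (auto simp: orb_def)
  have "(\<Sum>i<p. ?h ((\<gamma> ^^ i) c)) = (\<Sum>i<p. if i = j then y (orb_rep c) else 0)"
  proof (rule sum.cong[OF refl])
    fix i assume "i \<in> {..<p}"
    then show "?h ((\<gamma> ^^ i) c) = (if i = j then y (orb_rep c) else 0)"
      using funpow_inj[OF c, of i j] j by (auto simp: orb_rep_funpow[OF c(1)])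
  qed
  also have "\<dots> = y (orb_rep c)" using j by simp
  finally have 1: "(\<Sum>i<p. ?h ((\<gamma> ^^ i) c)) = y (orb_rep c)" .
  have "int p dvd y c - y ((\<gamma> ^^ i) c)" for i
  proof (induction i)
    case (Suc i)
    show ?case using dvd_add[OF Suc y[OF funpow_maps[OF c(1), of i]]] by simp
  qed simp
  then show "int p dvd y c - (\<Sum>i<p. ?h ((\<gamma> ^^ i) c))" using 1 j by simp
qed

text \<open>The companion exactness: what the norm kills is a difference. The witness is the
  negative partial sum of \<open>y\<close> from the representative up to the given point.\<close>

lemma difference_image_decomp:
  assumes y: "\<And>c. c \<in> K \<Longrightarrow> int p dvd (\<Sum>i<p. y ((\<gamma> ^^ i) c))"
  shows "\<exists>h. \<forall>c\<in>K. \<gamma> c \<noteq> c \<longrightarrow> int p dvd y c - (h c - h (\<gamma> c))"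
proof (intro exI ballI impI)
  fix c assume c: "c \<in> K" "\<gamma> c \<noteq> c"
  define idx where "idx d = (SOME i. i < p \<and> (\<gamma> ^^ i) (orb_rep d) = d)" for d
  let ?h = "\<lambda>d. - (\<Sum>i<idx d. y ((\<gamma> ^^ i) (orb_rep d)))"
  define r where "r = orb_rep c"
  obtain j where j: "j < p" "r = (\<gamma> ^^ j) c" using orb_rep_in[OF c(1)] by (auto simp: orb_def r_def)
  have rK: "r \<in> K" using j funpow_maps[OF c(1)] by simp
  have cr: "c = (\<gamma> ^^ ((p - j) mod p)) r"
  proof -
    have "(\<gamma> ^^ (p - j)) r = (\<gamma> ^^ (p - j + j)) c" by (simp only: j(2) funpow_add o_apply)
    also have "\<dots> = c" using j order[OF c(1)] by simp
    finally show ?thesis using funpow_mod[OF rK, of "p - j"] by simp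
  qed
  define m where "m = (p - j) mod p"
  have m: "m < p" "c = (\<gamma> ^^ m) r" using p_pos cr by (auto simp: m_def)
  have rf: "\<gamma> r \<noteq> r"
  proof
    assume "\<gamma> r = r"
    then have "(\<gamma> ^^ i) r = r" for i by (induction i) auto
    then show False using m c \<open>\<gamma> r = r\<close> by simp
  qed
  have repr: "orb_rep ((\<gamma> ^^ i) r) = r" for i
    using orb_rep_funpow[OF rK] orb_rep_funpow[OF c(1), of j] j r_def by simp
  have idx: "idx ((\<gamma> ^^ i) r) = i" if "i < p" for i
  proof -
    have "idx ((\<gamma> ^^ i) r) < p \<and> (\<gamma> ^^ idx ((\<gamma> ^^ i) r)) r = (\<gamma> ^^ i) r"
      unfolding idx_def[of "(\<gamma> ^^ i) r"] repr by (rule someI[of _ i]) (use that in simp)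
    then show ?thesis using funpow_inj[OF rK rf] that by blast
  qed
  have hc: "?h c = - (\<Sum>i<m. y ((\<gamma> ^^ i) r))" using m idx[of m] repr[of m] by simp
  show "int p dvd y c - (?h c - ?h (\<gamma> c))"
  proof (cases "Suc m < p")
    case True
    have "\<gamma> c = (\<gamma> ^^ Suc m) r" using m by simp
    then have "?h (\<gamma> c) = - (\<Sum>i<Suc m. y ((\<gamma> ^^ i) r))"
      using idx[OF True] repr[of "Suc m"] by simp
    then show ?thesis using hc m by simp
  next
    \<comment> \<open>After the last point of the orbit comes the representative again. The gap is
      the full sum around the orbit, which the hypothesis makes divisible by
      \<open>p\<close>.\<close>
    case False
    then have pm: "p = Suc m" using m by simp
    have "\<gamma> c = r" using order[OF rK] m pm by simp
    then have "?h (\<gamma> c) = 0" using idx[of 0] p_pos repr[of 0] by simp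
    then have "y c - (?h c - ?h (\<gamma> c)) = (\<Sum>i<Suc m. y ((\<gamma> ^^ i) r))"
      using hc m by simp
    then show ?thesis using y[OF rK] pm by simp
  qed
qed

end

section \<open>Automorphisms of a finite poset and their fixed chains\<close>

definition poset_auto :: "'a::order set \<Rightarrow> ('a \<Rightarrow> 'a) \<Rightarrow> bool" where
  "poset_auto X g \<longleftrightarrow> bij_betw g X X \<and> (\<forall>x\<in>X. \<forall>y\<in>X. x < y \<longleftrightarrow> g x < g y)"

definition fixed_points :: "'a set \<Rightarrow> ('a \<Rightarrow> 'a) \<Rightarrow> 'a set" where
  "fixed_points X g = {x\<in>X. g x = x}"

lemma poset_auto_chain:
  assumes g: "poset_auto X g" and c: "c \<in> chains_of X"
  shows "g ` c \<in> chains_of X"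
proof -
  have cX: "c \<subseteq> X" and cmp: "\<And>x y. x \<in> c \<Longrightarrow> y \<in> c \<Longrightarrow> x = y \<or> x < y \<or> y < x"
    using c by (auto simp: chains_of_def less_le)
  have gX: "g ` X = X" using g by (simp add: poset_auto_def bij_betw_def)
  show ?thesis unfolding chains_of_def
  proof (intro CollectI conjI ballI)
    show "g ` c \<subseteq> X" using cX gX by blast
    fix u v assume "u \<in> g ` c" "v \<in> g ` c"
    then obtain x y where xy: "x \<in> c" "y \<in> c" "u = g x" "v = g y" by blast
    have "x \<in> X" "y \<in> X" using xy cX by auto
    then have "(x < y \<longrightarrow> g x < g y) \<and> (y < x \<longrightarrow> g y < g x)" using g unfolding poset_auto_def by simp
    then show "u \<le> v \<or> v \<le> u" using cmp[OF xy(1,2)] xy by (auto simp: less_le)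
  qed
qed

lemma poset_auto_card:
  assumes g: "poset_auto X g" and c: "c \<in> chains_of X"
  shows "card (g ` c) = card c"
  using g chains_of_subset[OF c] unfolding poset_auto_def bij_betw_def
  by (meson card_image inj_on_subset)

text \<open>Order automorphisms preserve the position of a point in a chain, so no orientation signs
  arise.\<close>

lemma bd_equivariant:
  assumes X: "finite X" and g: "poset_auto X g" and c: "c \<in> chains_of X"
  shows "bd X (\<lambda>d. f (g ` d)) c = bd X f (g ` c)"
proof -
  have cX: "c \<subseteq> X" and fc: "finite c" using chains_of_subset[OF c] finite_chain[OF X c] by auto
  have bij: "g ` X = X" "inj_on g X" and
    mono: "\<And>x y. x \<in> X \<Longrightarrow> y \<in> X \<Longrightarrow> x < y \<longleftrightarrow> g x < g y"
    using g by (auto simp: poset_auto_def bij_betw_def)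
  have ext: "g ` ext_points X c = ext_points X (g ` c)"
  proof (intro equalityI subsetI)
    fix u assume "u \<in> g ` ext_points X c"
    then obtain x where x: "u = g x" "x \<in> X" "x \<notin> c" "\<And>y. y \<in> c \<Longrightarrow> x < y \<or> y < x"
      by (auto simp: ext_points_def)
    have "g x \<notin> g ` c" using x cX bij by (meson inj_on_image_mem_iff)
    moreover have "g x < g y \<or> g y < g x" if "y \<in> c" for y
      using x(4)[OF that] mono[OF x(2), of y] mono[of y x] that cX x(2) by auto
    moreover have "g x \<in> X" using x(2) bij by auto
    ultimately show "u \<in> ext_points X (g ` c)" unfolding ext_points_def x(1) by simp
  next
    fix u assume u: "u \<in> ext_points X (g ` c)"
    then obtain x where x: "u = g x" "x \<in> X" using bij unfolding ext_points_def by blast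
    have "x < y \<or> y < x" if "y \<in> c" for y
    proof -
      have "g x < g y \<or> g y < g x" using u that x unfolding ext_points_def by simp
      then show ?thesis using mono[OF x(2), of y] mono[of y x] that cX x(2) by auto
    qed
    moreover have "x \<notin> c" using u x unfolding ext_points_def by auto
    ultimately have "x \<in> ext_points X c" using x unfolding ext_points_def by simp
    then show "u \<in> g ` ext_points X c" using x by simp
  qed
  have sgn: "bd_sign (g x) (g ` c) = bd_sign x c" if "x \<in> X" for x
  proof -
    have "g y < g x \<longleftrightarrow> y < x" if "y \<in> c" for y using mono[of y x] that cX \<open>x \<in> X\<close> by auto
    then have "{y \<in> g ` c. y < g x} = g ` {y\<in>c. y < x}" by auto
    moreover have "inj_on g {y\<in>c. y < x}" using bij cX by (auto intro: inj_on_subset)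
    ultimately show ?thesis by (simp add: bd_sign_def card_image)
  qed
  have inj: "inj_on g (ext_points X c)" using bij by (auto simp: ext_points_def intro: inj_on_subset)
  show ?thesis unfolding bd_def ext[symmetric] sum.reindex[OF inj]
    by (rule sum.cong) (auto simp: sgn ext_points_def)
qed

lemma poset_auto_funpow_less:
  assumes g: "poset_auto X g" and x: "x \<in> X" and lt: "x < g x"
  shows "n > 0 \<Longrightarrow> (g ^^ n) x \<in> X \<and> x < (g ^^ n) x"
proof (induction n)
  case (Suc n)
  have gX: "\<And>y. y \<in> X \<Longrightarrow> g y \<in> X" using g by (auto simp: poset_auto_def bij_betw_def)
  show ?case
  proof (cases "n = 0")
    case True then show ?thesis using gX[OF x] lt by simp
  next
    case False
    then have "(g ^^ n) x \<in> X" "x < (g ^^ n) x" using Suc by auto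
    then have "g x < g ((g ^^ n) x)" using g x unfolding poset_auto_def by blast
    then show ?thesis using gX[OF \<open>(g ^^ n) x \<in> X\<close>] lt by (simp del: funpow.simps add: funpow.simps(2))
  qed
qed simp

lemma poset_auto_funpow_greater:
  assumes g: "poset_auto X g" and x: "x \<in> X" and lt: "g x < x"
  shows "n > 0 \<Longrightarrow> (g ^^ n) x \<in> X \<and> (g ^^ n) x < x"
proof (induction n)
  case (Suc n)
  have gX: "\<And>y. y \<in> X \<Longrightarrow> g y \<in> X" using g by (auto simp: poset_auto_def bij_betw_def)
  show ?case
  proof (cases "n = 0")
    case True then show ?thesis using gX[OF x] lt by simp
  next
    case False
    then have "(g ^^ n) x \<in> X" "(g ^^ n) x < x" using Suc by auto
    then have "g ((g ^^ n) x) < g x" using g x unfolding poset_auto_def by blast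
    then show ?thesis using gX[OF \<open>(g ^^ n) x \<in> X\<close>] lt by (simp del: funpow.simps add: funpow.simps(2))
  qed
qed simp

text \<open>A point of the chain that moves is comparable with its image, so its iterates are
  strictly monotone; but in a finite chain they have to return.\<close>

lemma poset_auto_fixed_chain:
  assumes X: "finite X" and g: "poset_auto X g" and c: "c \<in> chains_of X" and gc: "g ` c = c" and x: "x \<in> c"
  shows "g x = x"
proof (rule ccontr)
  assume ne: "g x \<noteq> x"
  have cX: "c \<subseteq> X" using chains_of_subset[OF c] .
  have xX: "x \<in> X" using x cX by blast
  have "g x \<in> c" using x gc by blast
  then have "x < g x \<or> g x < x" using c x ne unfolding chains_of_def by (auto simp: less_le)
  moreover have "\<exists>n>0. (g ^^ n) x = x"
  proof -
    have "\<not> inj (\<lambda>n. (g ^^ n) x)"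
    proof
      assume "inj (\<lambda>n. (g ^^ n) x)"
      moreover have "(g ^^ n) x \<in> c" for n using x gc by (induction n) auto
      then have "finite (range (\<lambda>n. (g ^^ n) x))"
        by (meson finite_chain[OF X c] finite_subset image_subsetI)
      ultimately show False by (metis finite_imageD infinite_UNIV_nat)
    qed
    then obtain i j where ij: "i < j" "(g ^^ i) x = (g ^^ j) x"
      unfolding inj_def by (metis linorder_neqE_nat)
    have inj: "inj_on g c" using g cX unfolding poset_auto_def bij_betw_def by (blast intro: inj_on_subset)
    have mem: "(g ^^ n) x \<in> c" for n using x gc by (induction n) auto
    have "(g ^^ i) x = (g ^^ (i + d)) x \<Longrightarrow> x = (g ^^ d) x" for d
    proof (induction i)
      case (Suc i)
      have "g ((g ^^ i) x) = g ((g ^^ (i + d)) x)" using Suc.prems by simp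
      then show ?case using Suc.IH inj_onD[OF inj _ mem mem] by blast
    qed simp
    from this[of "j - i"] ij show ?thesis by (intro exI[of _ "j - i"]) auto
  qed
  ultimately show False
    using poset_auto_funpow_less[OF g xX] poset_auto_funpow_greater[OF g xX] by (metis order_less_irrefl)
qed

lemma chains_of_fixed_points:
  assumes X: "finite X" and g: "poset_auto X g"
  shows "chains_of (fixed_points X g) = {c\<in>chains_of X. g ` c = c}"
proof (intro equalityI subsetI)
  fix c assume c: "c \<in> chains_of (fixed_points X g)"
  then have "\<And>x. x \<in> c \<Longrightarrow> g x = x" by (auto simp: chains_of_def fixed_points_def)
  then have "g ` c = c" by simp
  then show "c \<in> {c\<in>chains_of X. g ` c = c}" using c by (auto simp: chains_of_def fixed_points_def)
next
  fix c assume c: "c \<in> {c\<in>chains_of X. g ` c = c}"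
  then have "\<And>x. x \<in> c \<Longrightarrow> g x = x" using poset_auto_fixed_chain[OF X g] by blast
  then show "c \<in> chains_of (fixed_points X g)" using c by (auto simp: chains_of_def fixed_points_def)
qed

section \<open>Smith theory\<close>

lemma funpow_image: "((`) g ^^ i) c = (g ^^ i) ` c" for g :: "'a \<Rightarrow> 'a"
  by (induction i) auto

lemma bd_equivariant_funpow:
  assumes X: "finite X" and g: "poset_auto X g"
  shows "c \<in> chains_of X \<Longrightarrow> bd X (\<lambda>d. f (((`) g ^^ i) d)) c = bd X f (((`) g ^^ i) c)"
proof (induction i arbitrary: f c)
  case (Suc i)
  have "bd X (\<lambda>d. f (((`) g ^^ Suc i) d)) c = bd X (\<lambda>d. f (((`) g ^^ i) (g ` d))) c"
    by (simp add: funpow_swap1)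
  also have "\<dots> = bd X (\<lambda>d. f (((`) g ^^ i) d)) (g ` c)"
    by (rule bd_equivariant[OF X g Suc.prems])
  also have "\<dots> = bd X f (((`) g ^^ i) (g ` c))"
    by (rule Suc.IH[OF poset_auto_chain[OF g Suc.prems]])
  finally show ?case by (simp add: funpow_swap1)
qed simp

lemma dvd_diff_trans: "(p::int) dvd a - b \<Longrightarrow> p dvd b - c \<Longrightarrow> p dvd a - c"
  using dvd_add[of p "a - b" "b - c"] by simp

text \<open>Smith theory. With \<open>\<tau> = 1 - g\<close> and \<open>\<sigma> = 1 + g + \<dots> + g\<^sup>p\<^sup>-\<^sup>1\<close> on chains modulo \<open>p\<close>, the kernel
  of each is the image of the other plus the chains of fixed points. Acyclicity of the images of
  \<open>\<tau>\<close> and \<open>\<sigma>\<close> is proved by downward induction on the size of the supporting chains.\<close>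

theorem smith_acyclic_mod:
  assumes X: "finite X" and g: "poset_auto X g" and p: "prime p"
    and order: "\<And>x. x \<in> X \<Longrightarrow> (g ^^ p) x = x" and A: "acyclic_mod (int p) X"
  shows "acyclic_mod (int p) (fixed_points X g)"
proof -
  define K where "K = chains_of X"
  define \<gamma> where "\<gamma> = (`) g"
  have \<gamma>: "\<gamma> c = g ` c" for c by (simp add: \<gamma>_def)
  have Kmap: "\<gamma> c \<in> K" if "c \<in> K" for c
    using poset_auto_chain[OF g] that by (simp add: K_def \<gamma>_def)
  interpret prime_action K \<gamma> p
  proof
    fix c assume c: "c \<in> K"
    have "(\<gamma> ^^ p) c = (g ^^ p) ` c" by (simp add: \<gamma>_def funpow_image)
    also have "\<dots> = (\<lambda>x. x) ` c"
      by (rule image_cong[OF refl]) (use chains_of_subset[of c X] c order in \<open>auto simp: K_def\<close>)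
    finally show "(\<gamma> ^^ p) c = c" by simp
  qed (use p Kmap in auto)
  define \<tau> :: "('a set \<Rightarrow> int) \<Rightarrow> 'a set \<Rightarrow> int" where "\<tau> u c = u c - u (\<gamma> c)" for u c
  define \<sigma> :: "('a set \<Rightarrow> int) \<Rightarrow> 'a set \<Rightarrow> int" where "\<sigma> u c = (\<Sum>i<p. u ((\<gamma> ^^ i) c))" for u c
  let ?D = "bd X"
  have dd: "?D (?D f) c = 0" if "c \<in> K" for f c using bd_bd[OF X] that by (simp add: K_def)
  have card\<gamma>: "card ((\<gamma> ^^ i) c) = card c" if "c \<in> K" for c i
  proof (induction i)
    case (Suc i)
    then show ?case using poset_auto_card[OF g, of "(\<gamma> ^^ i) c"] funpow_maps[OF that, of i]
      by (simp add: K_def flip: \<gamma>)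
  qed simp
  have card\<gamma>1: "card (\<gamma> c) = card c" if "c \<in> K" for c using card\<gamma>[OF that, of 1] by simp
  have Dmod: "int p dvd ?D u c - ?D v c" if "c \<in> K" "\<And>d. d \<in> K \<Longrightarrow> int p dvd u d - v d" for u v c
    using bd_cong_mod[of c X "int p" u v] that X by (simp add: K_def)
  have fixed_const: "(\<gamma> ^^ i) c = c" if "\<gamma> c = c" for c i using that by (induction i) auto
  have \<sigma>fix: "\<sigma> u c = int p * u c" if "\<gamma> c = c" for u c by (simp add: \<sigma>_def fixed_const[OF that])
  have D\<tau>: "?D (\<tau> u) c = \<tau> (?D u) c" if "c \<in> K" for u c
    unfolding \<tau>_def bd_diff using bd_equivariant[OF X g, of c u] that by (simp add: K_def \<gamma>_def)
  have D\<sigma>: "?D (\<sigma> u) c = \<sigma> (?D u) c" if "c \<in> K" for u c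
    using bd_sum[of X "\<lambda>_. 1" "\<lambda>i d. u ((\<gamma> ^^ i) d)" "{..<p}" c]
      bd_equivariant_funpow[OF X g, of c u] that by (simp add: K_def \<gamma>_def \<sigma>_def[abs_def])
  have \<tau>\<sigma>: "\<tau> (\<sigma> u) c = 0" if "c \<in> K" for u c
  proof -
    have "(\<Sum>i<p. u ((\<gamma> ^^ i) (\<gamma> c))) = (\<Sum>i<p. u ((\<gamma> ^^ Suc i) c))" by (simp add: funpow_swap1)
    also have "\<dots> = (\<Sum>i<p. u ((\<gamma> ^^ i) c))"
    proof -
      have "(\<Sum>i<p. u ((\<gamma> ^^ Suc i) c)) + u c = (\<Sum>i<Suc p. u ((\<gamma> ^^ i) c))"
        by (subst sum.lessThan_Suc_shift) simp
      also have "\<dots> = (\<Sum>i<p. u ((\<gamma> ^^ i) c)) + u c" using order[OF that] by simp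
      finally show ?thesis by simp
    qed
    finally show ?thesis by (simp add: \<tau>_def \<sigma>_def)
  qed
  have \<sigma>\<tau>: "\<sigma> (\<tau> u) c = 0" if "c \<in> K" for u c
  proof -
    have "\<sigma> (\<tau> u) c = (\<Sum>i<p. u ((\<gamma> ^^ i) c) - u ((\<gamma> ^^ Suc i) c))" by (simp add: \<sigma>_def \<tau>_def)
    also have "\<dots> = u c - u ((\<gamma> ^^ p) c)"
      using sum_lessThan_telescope'[of "\<lambda>i. u ((\<gamma> ^^ i) c)" p] by simp
    finally show ?thesis using prime_action.order[OF prime_action_axioms that] by simp
  qed
  \<comment> \<open>What the two operators share, so that \<open>\<tau>, \<sigma>\<close> and
    \<open>\<sigma>, \<tau>\<close> are handled by one argument: both are chain maps,
    \<open>\<rho>\<close> kills the image of \<open>\<rho>'\<close>, away from fixed chains the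
    kernel of \<open>\<rho>\<close> is the image of \<open>\<rho>'\<close>, and on fixed chains the
    image of \<open>\<rho>'\<close> vanishes modulo \<open>p\<close>.\<close>
  define good where "good = (\<lambda>\<rho> \<rho>' :: ('a set \<Rightarrow> int) \<Rightarrow> 'a set \<Rightarrow> int.
      (\<forall>u. \<forall>c\<in>K. ?D (\<rho> u) c = \<rho> (?D u) c) \<and>
      (\<forall>u. \<forall>c\<in>K. ?D (\<rho>' u) c = \<rho>' (?D u) c) \<and>
      (\<forall>u v. \<forall>c. \<rho> (\<lambda>d. u d - v d) c = \<rho> u c - \<rho> v c) \<and>
      (\<forall>u k. (\<forall>c\<in>K. card c < k \<longrightarrow> int p dvd u c) \<longrightarrow> (\<forall>c\<in>K. card c < k \<longrightarrow> int p dvd \<rho> u c)) \<and>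
      (\<forall>u. \<forall>c\<in>K. \<rho> (\<rho>' u) c = 0) \<and>
      (\<forall>y. (\<forall>c\<in>K. int p dvd \<rho> y c) \<longrightarrow> (\<exists>h. \<forall>c\<in>K. \<gamma> c \<noteq> c \<longrightarrow> int p dvd y c - \<rho>' h c)) \<and>
      (\<forall>u. \<forall>c\<in>K. \<gamma> c = c \<longrightarrow> int p dvd \<rho>' u c))"
  have g1: "good \<tau> \<sigma>"
    unfolding good_def
  proof (intro conjI allI impI ballI)
    fix y :: "'a set \<Rightarrow> int" assume "\<forall>c\<in>K. int p dvd \<tau> y c"
    then show "\<exists>h. \<forall>c\<in>K. \<gamma> c \<noteq> c \<longrightarrow> int p dvd y c - \<sigma> h c"
      using norm_image_decomp[of y] by (simp add: \<tau>_def \<sigma>_def)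
  next
    fix u :: "'a set \<Rightarrow> int" and k c assume "\<forall>c\<in>K. card c < k \<longrightarrow> int p dvd u c" "c \<in> K" "card c < k"
    then show "int p dvd \<tau> u c" using Kmap card\<gamma>1 by (simp add: \<tau>_def)
  qed (auto simp: D\<tau> D\<sigma> \<tau>\<sigma> \<sigma>fix, simp add: \<tau>_def)
  have g2: "good \<sigma> \<tau>"
    unfolding good_def
  proof (intro conjI allI impI ballI)
    fix y :: "'a set \<Rightarrow> int" assume "\<forall>c\<in>K. int p dvd \<sigma> y c"
    then show "\<exists>h. \<forall>c\<in>K. \<gamma> c \<noteq> c \<longrightarrow> int p dvd y c - \<tau> h c"
      using difference_image_decomp[of y] by (simp add: \<tau>_def \<sigma>_def)
  next
    fix u :: "'a set \<Rightarrow> int" and k c assume "\<forall>c\<in>K. card c < k \<longrightarrow> int p dvd u c" "c \<in> K" "card c < k"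
    then show "int p dvd \<sigma> u c" unfolding \<sigma>_def
      by (intro dvd_sum) (simp add: card\<gamma> funpow_maps)
  next
    fix u :: "'a set \<Rightarrow> int" and c assume "\<gamma> c = c"
    then show "int p dvd \<tau> u c" by (simp add: \<tau>_def)
  qed (auto simp: D\<tau> D\<sigma> \<sigma>\<tau>, simp add: \<sigma>_def sum_subtractf)
  \<comment> \<open>Modulo \<open>p\<close>, a cycle in the image of \<open>\<rho>\<close> supported
    on chains with at least \<open>k\<close> elements bounds within the image of
    \<open>\<rho>\<close>.\<close>
  define I where "I = (\<lambda>(\<rho> :: ('a set \<Rightarrow> int) \<Rightarrow> 'a set \<Rightarrow> int) k. \<forall>f u.
      (\<forall>c\<in>K. card c < k \<longrightarrow> int p dvd f c) \<and> (\<forall>c\<in>K. int p dvd ?D f c) \<and>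
      (\<forall>c\<in>K. int p dvd f c - \<rho> u c) \<longrightarrow> (\<exists>w. \<forall>c\<in>K. int p dvd f c - ?D (\<rho> w) c))"
  have ker: "\<exists>y. (\<forall>c\<in>K. int p dvd \<rho> y c) \<and> (\<forall>c\<in>K. int p dvd ?D y c - x c)"
    if good: "good \<rho> \<rho>'" and I: "I \<rho> (Suc k)" and sx: "\<And>c. c \<in> K \<Longrightarrow> card c < k \<Longrightarrow> int p dvd x c"
      and cyc: "\<And>c. c \<in> K \<Longrightarrow> int p dvd ?D x c" and kx: "\<And>c. c \<in> K \<Longrightarrow> int p dvd \<rho> x c"
    for \<rho> \<rho>' k x
  proof -
    have lin: "\<rho> (\<lambda>d. u d - v d) c = \<rho> u c - \<rho> v c" for u v c using good by (simp add: good_def)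
    have sup: "int p dvd \<rho> u c"
      if "\<And>c. c \<in> K \<Longrightarrow> card c < k \<Longrightarrow> int p dvd u c" "c \<in> K" "card c < k" for u c k
    proof -
      have "(\<forall>c\<in>K. card c < k \<longrightarrow> int p dvd u c) \<longrightarrow> (\<forall>c\<in>K. card c < k \<longrightarrow> int p dvd \<rho> u c)"
        using good by (simp add: good_def)
      then show ?thesis using that by blast
    qed
    have \<rho>mod: "int p dvd \<rho> u c - \<rho> v c"
      if "\<And>c. c \<in> K \<Longrightarrow> int p dvd u c - v c" "c \<in> K" for u v c
      using sup[of "Suc (card c)" "\<lambda>d. u d - v d" c] that lin by simp
    have D\<rho>: "?D (\<rho> u) c = \<rho> (?D u) c" if "c \<in> K" for u c using good that by (simp add: good_def)
    obtain y0 where y0: "\<And>c. c \<in> K \<Longrightarrow> int p dvd ?D y0 c - x c"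
      using A cyc unfolding acyclic_mod_def K_def by blast
    \<comment> \<open>The boundary at a chain with at least \<open>k\<close> elements reads only
      chains with more than \<open>k\<close>, so the cut changes nothing there; on smaller chains
      \<open>x\<close> vanishes modulo \<open>p\<close>. The support of \<open>\<rho> y\<close> now
      starts at \<open>Suc k\<close>, where the hypothesis \<open>I\<close> applies.\<close>
    define y where "y c = (if card c < Suc k then 0 else y0 c)" for c
    have y: "int p dvd ?D y c - x c" if c: "c \<in> K" for c
    proof (cases "card c < k")
      case True
      have "?D y c = 0" unfolding bd_def
      proof (rule sum.neutral, rule ballI)
        fix x assume "x \<in> ext_points X c"
        have "card (insert x c) \<le> Suc (card c)" by (rule card_insert_le_m1) auto
        then show "bd_sign x c * y (insert x c) = 0" using True by (simp add: y_def)
      qed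
      then show ?thesis using sx[OF c True] by simp
    next
      case False
      have "int p dvd ?D y c - ?D y0 c"
        by (rule bd_cong_mod[OF _ _ X]) (use c False in \<open>auto simp: K_def y_def\<close>)
      then show ?thesis using y0[OF c] by (rule dvd_diff_trans)
    qed
    have sy: "int p dvd y c" if "card c < Suc k" for c using that by (simp add: y_def)
    have "\<exists>w. \<forall>c\<in>K. int p dvd \<rho> y c - ?D (\<rho> w) c"
    proof -
      have "\<forall>c\<in>K. card c < Suc k \<longrightarrow> int p dvd \<rho> y c" using sup[of "Suc k" y] sy by blast
      moreover have "\<forall>c\<in>K. int p dvd ?D (\<rho> y) c"
      proof
        fix c assume c: "c \<in> K"
        have "int p dvd \<rho> (?D y) c - \<rho> x c" by (rule \<rho>mod[OF y c])
        then show "int p dvd ?D (\<rho> y) c" using kx[OF c] D\<rho>[OF c] by (metis dvd_add diff_add_cancel)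
      qed
      moreover have "\<forall>c\<in>K. int p dvd \<rho> y c - \<rho> y c" by simp
      ultimately show ?thesis using I unfolding I_def by blast
    qed
    then obtain w where w: "\<And>c. c \<in> K \<Longrightarrow> int p dvd \<rho> y c - ?D (\<rho> w) c" by blast
    \<comment> \<open>Subtracting the boundary of \<open>w\<close> moves \<open>y\<close> into the
      kernel of \<open>\<rho>\<close> without changing its own boundary.\<close>
    have "int p dvd \<rho> (\<lambda>d. y d - ?D w d) c" if "c \<in> K" for c
      using w[OF that] by (simp add: lin D\<rho>[OF that])
    moreover have "int p dvd ?D (\<lambda>d. y d - ?D w d) c - x c" if "c \<in> K" for c
      using y[OF that] by (simp add: bd_diff dd[OF that])
    ultimately show ?thesis by blast
  qed
  \<comment> \<open>Faces of fixed chains are fixed, so the chains supported on fixed chains form a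
    subcomplex.\<close>
  have nonfixed_up: "\<gamma> (insert x c) \<noteq> insert x c"
    if c: "c \<in> K" "\<gamma> c \<noteq> c" and x: "x \<in> ext_points X c" for x c
  proof
    assume eq: "\<gamma> (insert x c) = insert x c"
    have "insert x c \<in> chains_of X" using insert_chain[of c X x] c x by (simp add: K_def)
    then have "\<forall>y\<in>c. g y = y"
      using poset_auto_fixed_chain[OF X g _ eq[unfolded \<gamma>]] by blast
    then have "\<gamma> c = c" by (simp add: \<gamma>)
    with c show False by blast
  qed
  have decomp: "(\<forall>c\<in>K. \<gamma> c = c \<longrightarrow> int p dvd ?D y c - ?D (\<lambda>d. if \<gamma> d = d then y d else 0) c) \<and>
        (\<exists>h. \<forall>c\<in>K. \<gamma> c \<noteq> c \<longrightarrow> int p dvd ?D y c - ?D (\<rho>' h) c)"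
    if good: "good \<rho> \<rho>'" and ky: "\<And>c. c \<in> K \<Longrightarrow> int p dvd \<rho> y c" for \<rho> \<rho>' y
  proof -
    have "(\<forall>c\<in>K. int p dvd \<rho> y c) \<longrightarrow> (\<exists>h. \<forall>c\<in>K. \<gamma> c \<noteq> c \<longrightarrow> int p dvd y c - \<rho>' h c)"
      using good by (simp add: good_def)
    then obtain h where h: "\<And>c. c \<in> K \<Longrightarrow> \<gamma> c \<noteq> c \<Longrightarrow> int p dvd y c - \<rho>' h c"
      using ky by blast
    have fx: "int p dvd \<rho>' u c" if "c \<in> K" "\<gamma> c = c" for u c using good that by (simp add: good_def)
    let ?v = "\<lambda>d. if \<gamma> d = d then y d else 0"
    have D\<rho>: "?D (\<rho>' u) c = \<rho>' (?D u) c" if "c \<in> K" for u c using good that by (simp add: good_def)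
    have yv: "int p dvd y c - (?v c - (0 - \<rho>' h c))" if "c \<in> K" for c
      using h[OF that] fx[OF that] by auto
    have Dy: "int p dvd ?D y c - (?D ?v c + ?D (\<rho>' h) c)" if "c \<in> K" for c
    proof -
      have "int p dvd ?D y c - ?D (\<lambda>d. ?v d - (0 - \<rho>' h d)) c" by (rule Dmod[OF that yv])
      moreover have "?D (\<lambda>_. 0) c = 0" by (simp add: bd_def)
      ultimately show ?thesis unfolding bd_diff by simp
    qed
    have "int p dvd ?D y c - ?D ?v c" if "c \<in> K" "\<gamma> c = c" for c
    proof -
      have "int p dvd ?D (\<rho>' h) c" using fx[OF that] D\<rho>[OF that(1)] by simp
      then have "int p dvd (?D y c - (?D ?v c + ?D (\<rho>' h) c)) + ?D (\<rho>' h) c"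
        using Dy[OF that(1)] by (intro dvd_add)
      then show ?thesis by simp
    qed
    moreover have "int p dvd ?D y c - ?D (\<rho>' h) c" if "c \<in> K" "\<gamma> c \<noteq> c" for c
    proof -
      have "?D ?v c = 0" unfolding bd_def
        by (rule sum.neutral) (use nonfixed_up[OF that] in auto)
      then show ?thesis using Dy[OF that(1)] by simp
    qed
    ultimately show ?thesis by auto
  qed
  have step: "I \<rho>' k" if good: "good \<rho> \<rho>'" and I: "I \<rho> (Suc k)" for \<rho> \<rho>' k
    unfolding I_def
  proof (intro allI impI, elim conjE)
    fix f u
    assume sf: "\<forall>c\<in>K. card c < k \<longrightarrow> int p dvd f c" and cyc: "\<forall>c\<in>K. int p dvd ?D f c"
      and im: "\<forall>c\<in>K. int p dvd f c - \<rho>' u c"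
    have lin: "\<rho> (\<lambda>d. u d - v d) c = \<rho> u c - \<rho> v c" for u v c using good by (simp add: good_def)
    have fx: "int p dvd \<rho>' u c" if "c \<in> K" "\<gamma> c = c" for u c using good that by (simp add: good_def)
    have D\<rho>: "?D (\<rho>' u) c = \<rho>' (?D u) c" if "c \<in> K" for u c using good that by (simp add: good_def)
    have "int p dvd \<rho> f c" if "c \<in> K" for c
    proof -
      have "\<forall>u k. (\<forall>c\<in>K. card c < k \<longrightarrow> int p dvd u c) \<longrightarrow> (\<forall>c\<in>K. card c < k \<longrightarrow> int p dvd \<rho> u c)"
        using good unfolding good_def by (elim conjE) assumption
      from this[rule_format, of "Suc (card c)" "\<lambda>d. f d - \<rho>' u d" c]
      have "int p dvd \<rho> (\<lambda>d. f d - \<rho>' u d) c" using im that by blast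
      moreover have "\<rho> (\<rho>' u) c = 0" using good that by (simp add: good_def)
      ultimately show ?thesis by (simp add: lin)
    qed
    then obtain y where y: "\<And>c. c \<in> K \<Longrightarrow> int p dvd \<rho> y c" "\<And>c. c \<in> K \<Longrightarrow> int p dvd ?D y c - f c"
      using ker[OF good I, of f] sf cyc by blast
    obtain h where h: "\<And>c. c \<in> K \<Longrightarrow> \<gamma> c \<noteq> c \<Longrightarrow> int p dvd ?D y c - ?D (\<rho>' h) c"
      using conjunct2[OF decomp[OF good y(1)]] by auto
    \<comment> \<open>\<open>y\<close> is \<open>\<rho>' h\<close> plus a chain supported on fixed
      chains. Away from these the boundaries agree; on them both \<open>f\<close> and the boundary
      of \<open>\<rho>' h\<close> lie in the image of \<open>\<rho>'\<close> and vanish modulo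
      \<open>p\<close>.\<close>
    have "int p dvd f c - ?D (\<rho>' h) c" if c: "c \<in> K" for c
    proof (cases "\<gamma> c = c")
      case True
      have "int p dvd (f c - \<rho>' u c) + \<rho>' u c" using im c fx[OF c True] by (intro dvd_add) auto
      then show ?thesis using fx[OF c True] D\<rho>[OF c] by simp
    next
      case False
      have "int p dvd f c - ?D y c" using y(2)[OF c] by (metis dvd_minus_iff minus_diff_eq)
      then show ?thesis using h[OF c False] by (rule dvd_diff_trans)
    qed
    then show "\<exists>w. \<forall>c\<in>K. int p dvd f c - ?D (\<rho>' w) c" by blast
  qed
  have top: "I \<rho> (Suc (card X))" if "good \<rho> \<rho>'" for \<rho> \<rho>'
    unfolding I_def
  proof (intro allI impI, elim conjE)
    fix f u
    assume sf: "\<forall>c\<in>K. card c < Suc (card X) \<longrightarrow> int p dvd f c"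
    have lin: "\<rho> (\<lambda>d. u d - v d) c = \<rho> u c - \<rho> v c" for u v c using that by (simp add: good_def)
    have "\<rho> (\<lambda>_. 0) = (\<lambda>_. 0)" using lin[of "\<lambda>_. 0" "\<lambda>_. 0"] by auto
    then have "?D (\<rho> (\<lambda>_. 0)) c = 0" for c by (simp add: bd_def)
    moreover have "int p dvd f c" if "c \<in> K" for c
      using sf that card_mono[OF X chains_of_subset[of c X]] by (auto simp: K_def)
    ultimately show "\<exists>w. \<forall>c\<in>K. int p dvd f c - ?D (\<rho> w) c" by (intro exI[of _ "\<lambda>_. 0"]) simp
  qed
  \<comment> \<open>The two operators swap roles at each level, so both statements are carried
    along.\<close>
  have all: "I \<tau> (Suc (card X) - d) \<and> I \<sigma> (Suc (card X) - d)" if "d \<le> card X" for d using that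
  proof (induction d)
    case 0 then show ?case using top[OF g1] top[OF g2] by simp
  next
    case (Suc d)
    have "Suc (card X) - d = Suc (Suc (card X) - Suc d)" using Suc.prems by simp
    then show ?case using step[OF g1] step[OF g2] Suc by simp
  qed
  have I1: "I \<tau> (Suc 0)" using all[of "card X"] by simp
  define F where "F = fixed_points X g"
  have KF: "chains_of F = {c\<in>K. \<gamma> c = c}"
    using chains_of_fixed_points[OF X g] by (simp add: F_def K_def \<gamma>)
  have bdF: "?D (\<lambda>d. if \<gamma> d = d then f d else 0) c = bd F f c" if c: "c \<in> chains_of F" for f c
  proof -
    have cF: "c \<subseteq> F" using chains_of_subset[OF c] .
    have gc: "\<gamma> c = c" using c KF by blast
    have e: "\<gamma> (insert x c) = insert x c \<longleftrightarrow> x \<in> F" if x: "x \<in> ext_points X c" for x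
    proof
      assume "\<gamma> (insert x c) = insert x c"
      moreover have "insert x c \<in> chains_of X" using insert_chain[of c X x] c x KF by (simp add: K_def)
      ultimately have "g x = x" using poset_auto_fixed_chain[OF X g, of "insert x c" x] by (simp add: \<gamma>)
      then show "x \<in> F" using x by (simp add: F_def fixed_points_def ext_points_def)
    next
      assume "x \<in> F"
      then show "\<gamma> (insert x c) = insert x c" using gc by (simp add: \<gamma> F_def fixed_points_def)
    qed
    have "ext_points F c = {x\<in>ext_points X c. x \<in> F}"
      by (auto simp: ext_points_def F_def fixed_points_def)
    then show ?thesis unfolding bd_def
      by (intro sum.mono_neutral_cong_right) (use e X in \<open>auto simp: finite_ext_points\<close>)
  qed
  show ?thesis unfolding acyclic_mod_def F_def[symmetric]
  proof (intro allI impI)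
    fix f assume f: "\<forall>c\<in>chains_of F. int p dvd bd F f c"
    \<comment> \<open>Extension by zero turns a cycle of the fixed poset into a cycle of
      \<open>X\<close> in the kernel of \<open>\<tau>\<close>. A chain in that kernel with boundary
      \<open>e\<close> then restricts to a solution on the fixed chains.\<close>
    define e where "e c = (if \<gamma> c = c then f c else 0)" for c
    have cyc: "int p dvd ?D e c" if c: "c \<in> K" for c
    proof (cases "\<gamma> c = c")
      case True
      then have "?D e c = bd F f c" using bdF[of c f] c KF by (simp add: e_def[abs_def])
      then show ?thesis using f c True KF by simp
    next
      case False
      have "?D e c = 0" unfolding bd_def
        by (rule sum.neutral) (use nonfixed_up[OF c False] in \<open>auto simp: e_def\<close>)
      then show ?thesis by simp
    qed
    have "int p dvd \<tau> e c" if c: "c \<in> K" for c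
    proof (cases "\<gamma> c = c")
      case False
      have "\<gamma> (\<gamma> c) \<noteq> \<gamma> c"
      proof
        assume "\<gamma> (\<gamma> c) = \<gamma> c"
        then have "(\<gamma> ^^ i) (\<gamma> c) = \<gamma> c" for i by (rule fixed_const)
        then have "(\<gamma> ^^ Suc (p - 1)) c = \<gamma> c" by (simp add: funpow_swap1)
        then show False using prime_action.order[OF prime_action_axioms c] p_pos False by simp
      qed
      then show ?thesis using False by (simp add: \<tau>_def e_def)
    qed (simp add: \<tau>_def)
    then obtain y where y: "\<And>c. c \<in> K \<Longrightarrow> int p dvd \<tau> y c" "\<And>c. c \<in> K \<Longrightarrow> int p dvd ?D y c - e c"
      using ker[OF g1 I1, of e] cyc by blast
    have "int p dvd bd F y c - f c" if c: "c \<in> chains_of F" for c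
    proof -
      have cK: "c \<in> K" "\<gamma> c = c" using c KF by auto
      have "int p dvd ?D y c - bd F y c"
        using conjunct1[OF decomp[OF g1 y(1)]] cK bdF[OF c, of y] by auto
      then have "int p dvd bd F y c - ?D y c" by (metis dvd_minus_iff minus_diff_eq)
      moreover have "int p dvd ?D y c - f c" using y(2)[OF cK(1)] cK by (simp add: e_def)
      ultimately show ?thesis by (rule dvd_diff_trans)
    qed
    then show "\<exists>h. \<forall>c\<in>chains_of F. int p dvd bd F h c - f c" by blast
  qed
qed

section \<open>The Lefschetz fixed point theorem\<close>

definition mat_mul :: "'k set \<Rightarrow> ('k \<Rightarrow> 'k \<Rightarrow> int) \<Rightarrow> ('k \<Rightarrow> 'k \<Rightarrow> int) \<Rightarrow> 'k \<Rightarrow> 'k \<Rightarrow> int" where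
  "mat_mul K A B i j = (\<Sum>k\<in>K. A i k * B k j)"

definition mat_trace :: "'k set \<Rightarrow> ('k \<Rightarrow> 'k \<Rightarrow> int) \<Rightarrow> int" where
  "mat_trace K A = (\<Sum>i\<in>K. A i i)"

lemma mat_mul_assoc: "mat_mul K (mat_mul K A B) C = mat_mul K A (mat_mul K B C)"
  unfolding mat_mul_def sum_distrib_left sum_distrib_right
  by (intro ext, subst sum.swap) (simp add: mult.assoc)

lemma mat_trace_commute: "mat_trace K (mat_mul K A B) = mat_trace K (mat_mul K B A)"
  unfolding mat_trace_def mat_mul_def by (subst sum.swap) (simp add: mult.commute)

lemma mat_mul_add_left: "mat_mul K (\<lambda>i j. A i j + B i j) C = (\<lambda>i j. mat_mul K A C i j + mat_mul K B C i j)"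
  by (intro ext) (simp add: mat_mul_def sum.distrib algebra_simps)

lemma mat_mul_add_right: "mat_mul K C (\<lambda>i j. A i j + B i j) = (\<lambda>i j. mat_mul K C A i j + mat_mul K C B i j)"
  by (intro ext) (simp add: mat_mul_def sum.distrib algebra_simps)

lemma mat_mul_diff_left: "mat_mul K (\<lambda>i j. A i j - B i j) C = (\<lambda>i j. mat_mul K A C i j - mat_mul K B C i j)"
  by (intro ext) (simp add: mat_mul_def sum_subtractf algebra_simps)

lemma mat_mul_diff_right: "mat_mul K C (\<lambda>i j. A i j - B i j) = (\<lambda>i j. mat_mul K C A i j - mat_mul K C B i j)"
  by (intro ext) (simp add: mat_mul_def sum_subtractf algebra_simps)

lemma mat_mul_minus_left: "mat_mul K (\<lambda>i j. - A i j) C = (\<lambda>i j. - mat_mul K A C i j)"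
  by (intro ext) (simp add: mat_mul_def sum_negf)

lemma mat_trace_add: "mat_trace K (\<lambda>i j. A i j + B i j) = mat_trace K A + mat_trace K B"
  by (simp add: mat_trace_def sum.distrib)

lemma mat_trace_diff: "mat_trace K (\<lambda>i j. A i j - B i j) = mat_trace K A - mat_trace K B"
  by (simp add: mat_trace_def sum_subtractf)

lemma mat_trace_minus: "mat_trace K (\<lambda>i j. - A i j) = - mat_trace K A"
  by (simp add: mat_trace_def sum_negf)

text \<open>A contracting homotopy modulo \<open>p\<close> gives \<open>U = D S + S D = 1 - N\<close> with \<open>N\<close> divisible by \<open>p\<close>.
  Since \<open>tr (H U N\<^sup>k) = 0\<close>, the trace of \<open>H\<close> equals that of \<open>H N\<^sup>k\<close> for every \<open>k\<close>,
  so it is divisible by every power of \<open>p\<close>.\<close>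

lemma supertrace_zero:
  fixes D S H :: "'k \<Rightarrow> 'k \<Rightarrow> int"
  assumes K: "finite K" and p: "p > (1::int)"
    and Dsupp: "\<And>i j. D i j \<noteq> 0 \<Longrightarrow> i \<in> K \<and> j \<in> K"
    and Hsupp: "\<And>i j. H i j \<noteq> 0 \<Longrightarrow> i \<in> K \<and> j \<in> K"
    and DD: "mat_mul K D D = (\<lambda>_ _. 0)"
    and HD: "mat_mul K H D = (\<lambda>i j. - mat_mul K D H i j)"
    and U: "\<And>i j. i \<in> K \<Longrightarrow> j \<in> K \<Longrightarrow>
        p dvd mat_mul K D S i j + mat_mul K S D i j - (if i = j then 1 else 0)"
  shows "mat_trace K H = 0"
proof -
  let ?m = "mat_mul K"
  define Id where "Id = (\<lambda>i j::'k. if i = j \<and> i \<in> K then (1::int) else 0)"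
  define V where "V = (\<lambda>i j. ?m D S i j + ?m S D i j)"
  define N where "N = (\<lambda>i j. Id i j - V i j)"
  define P where "P k = ((\<lambda>M. ?m N M) ^^ k) Id" for k
  have IdR: "?m A Id = A" if "\<And>i j. A i j \<noteq> 0 \<Longrightarrow> i \<in> K \<and> j \<in> K" for A
  proof (intro ext)
    fix i j
    have "?m A Id i j = (\<Sum>k\<in>K. if k = j then A i k else 0)"
      unfolding mat_mul_def Id_def by (rule sum.cong) auto
    then show "?m A Id i j = A i j" using that[of i j] K by (auto simp: sum.delta)
  qed
  have IdL: "?m Id A = A" if "\<And>i j. A i j \<noteq> 0 \<Longrightarrow> i \<in> K \<and> j \<in> K" for A
  proof (intro ext)
    fix i j
    have "?m Id A i j = (\<Sum>k\<in>K. if k = i then A k j else 0)"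
      unfolding mat_mul_def Id_def by (rule sum.cong) auto
    then show "?m Id A i j = A i j" using that[of i j] K by (auto simp: sum.delta)
  qed
  have zeroL: "?m (\<lambda>_ _. 0) A = (\<lambda>_ _. 0)" and zeroR: "?m A (\<lambda>_ _. 0) = (\<lambda>_ _. 0)" for A
    by (simp_all add: mat_mul_def fun_eq_iff)
  have DV: "?m D V = ?m V D"
  proof -
    have "?m D (?m D S) = (\<lambda>_ _. 0)" by (simp only: mat_mul_assoc[symmetric] DD zeroL)
    moreover have "?m (?m S D) D = (\<lambda>_ _. 0)" by (simp only: mat_mul_assoc DD zeroR)
    ultimately show ?thesis
      unfolding V_def mat_mul_add_left mat_mul_add_right mat_mul_assoc[of K D S D] by simp
  qed
  have DN: "?m D N = ?m N D"
    unfolding N_def mat_mul_diff_left mat_mul_diff_right DV using IdR[OF Dsupp] IdL[OF Dsupp] by simp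
  have DP: "?m D (P k) = ?m (P k) D" for k
  proof (induction k)
    case 0 show ?case using IdR[OF Dsupp] IdL[OF Dsupp] by (simp add: P_def)
  next
    case (Suc k)
    have S: "P (Suc k) = ?m N (P k)" by (simp add: P_def)
    have "?m D (P (Suc k)) = ?m (?m N D) (P k)" unfolding S by (simp add: DN flip: mat_mul_assoc)
    also have "\<dots> = ?m N (?m (P k) D)" using Suc by (simp add: mat_mul_assoc)
    finally show ?case unfolding S by (simp add: mat_mul_assoc)
  qed
  \<comment> \<open>Since \<open>M\<close> commutes with \<open>D\<close>, both halves of
    \<open>V\<close> give traces with \<open>D\<close> next to \<open>H\<close>. Moving
    \<open>D\<close> around the trace costs no sign, moving it across \<open>H\<close> costs a minus
    sign, and the halves cancel.\<close>
  have zero: "mat_trace K (?m H (?m V M)) = 0" if M: "?m D M = ?m M D" for M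
  proof -
    have "?m H (?m V M) = (\<lambda>i j. ?m (?m H D) (?m S M) i j + ?m (?m H (?m S M)) D i j)"
      unfolding V_def mat_mul_add_left mat_mul_add_right by (simp add: mat_mul_assoc M)
    then have "mat_trace K (?m H (?m V M)) =
        mat_trace K (?m (?m H D) (?m S M)) + mat_trace K (?m (?m H (?m S M)) D)"
      by (simp add: mat_trace_add)
    also have "mat_trace K (?m (?m H (?m S M)) D) = mat_trace K (?m (?m D H) (?m S M))"
      by (subst mat_trace_commute) (simp add: mat_mul_assoc)
    also have "mat_trace K (?m (?m H D) (?m S M)) = - mat_trace K (?m (?m D H) (?m S M))"
      unfolding HD mat_mul_minus_left mat_trace_minus ..
    finally show ?thesis by simp
  qed
  have Hm: "?m H (?m Id M) = ?m H M" for M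
    unfolding mat_mul_assoc[symmetric] using IdR[OF Hsupp] by simp
  have tr: "mat_trace K (?m H (P k)) = mat_trace K H" for k
  proof (induction k)
    case 0 show ?case using IdR[OF Hsupp] by (simp add: P_def)
  next
    case (Suc k)
    have "?m H (P (Suc k)) = (\<lambda>i j. ?m H (P k) i j - ?m H (?m V (P k)) i j)"
      using Hm[of "P k"] by (simp add: P_def N_def mat_mul_diff_left mat_mul_diff_right)
    then show ?case using Suc zero[OF DP] by (simp add: mat_trace_diff)
  qed
  have "p ^ k dvd P k i j" if "i \<in> K" "j \<in> K" for k i j using that
  proof (induction k arbitrary: i)
    case (Suc k)
    have "p dvd N i l" if "l \<in> K" for l
      using U[OF Suc.prems(1) that] Suc.prems(1) unfolding N_def V_def Id_def
      by (simp add: dvd_diff_commute)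
    then have "p ^ Suc k dvd (\<Sum>l\<in>K. N i l * P k l j)"
      using Suc by (intro dvd_sum) (auto intro: mult_dvd_mono)
    then show ?case by (simp add: P_def mat_mul_def)
  qed simp
  then have "p ^ k dvd mat_trace K (?m H (P k))" for k
    unfolding mat_trace_def mat_mul_def by (intro dvd_sum dvd_mult) auto
  then have dv: "p ^ k dvd mat_trace K H" for k by (simp add: tr)
  show ?thesis
  proof (rule ccontr)
    assume ne: "mat_trace K H \<noteq> 0"
    define t where "t = nat \<bar>mat_trace K H\<bar>"
    have "p ^ t \<le> \<bar>mat_trace K H\<bar>" using dvd_imp_le_int[OF ne dv[of t]] p by simp
    moreover have "int t < p ^ t"
    proof -
      have "int t < 2 ^ t" using of_nat_less_two_power[of t, where 'a=int] by simp
      also have "(2::int) ^ t \<le> p ^ t" using p by (intro power_mono) auto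
      finally show ?thesis .
    qed
    ultimately show False by (simp add: t_def)
  qed
qed

definition delta :: "'k \<Rightarrow> 'k \<Rightarrow> int" where "delta c d = (if d = c then 1 else 0)"

lemma bd_delta_expand:
  assumes X: "finite X" and c: "c \<in> chains_of X"
  shows "bd X f c = (\<Sum>d\<in>chains_of X. f d * bd X (delta d) c)"
proof -
  have "bd X f c = bd X (\<lambda>e. \<Sum>d\<in>chains_of X. f d * delta d e) c"
  proof (rule bd_cong[OF c])
    fix e assume e: "e \<in> chains_of X"
    have "(\<Sum>d\<in>chains_of X. f d * delta d e) = (\<Sum>d\<in>chains_of X. if d = e then f d else 0)"
      by (rule sum.cong) (auto simp: delta_def)
    then show "f e = (\<Sum>d\<in>chains_of X. f d * delta d e)"
      using e by (simp add: finite_chains_of[OF X])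
  qed
  then show ?thesis by (simp add: bd_sum)
qed

text \<open>An acyclic complex with a basis is contractible. \<open>s c\<close> is chosen by
  induction on the size of \<open>c\<close>: subtracting from the basis vector
  \<open>delta c\<close> the homotopy of its boundary leaves a cycle modulo \<open>p\<close>, and
  \<open>s c\<close> is a chain with that boundary.\<close>

lemma acyclic_mod_homotopy:
  assumes X: "finite X" and A: "acyclic_mod p X"
  shows "\<exists>s. \<forall>c\<in>chains_of X. \<forall>i\<in>chains_of X.
     p dvd bd X (s c) i - (delta c i - (\<Sum>d\<in>chains_of X. bd X (delta c) d * s d i))"
proof -
  let ?K = "chains_of X"
  have fK: "finite ?K" by (rule finite_chains_of[OF X])
  have low: "bd X (delta c) d = 0" if "d \<in> ?K" "card c \<noteq> Suc (card d)" for c d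
    unfolding bd_def
  proof (rule sum.neutral, rule ballI)
    fix x assume "x \<in> ext_points X d"
    then have "card (insert x d) = Suc (card d)"
      using finite_chain[OF X that(1)] ext_points_notin by fastforce
    then have "insert x d \<noteq> c" using that by auto
    then show "bd_sign x d * delta c (insert x d) = 0" by (simp add: delta_def)
  qed
  have "\<exists>s. \<forall>c\<in>?K. card c < k \<longrightarrow> (\<forall>i\<in>?K.
     p dvd bd X (s c) i - (delta c i - (\<Sum>d\<in>?K. bd X (delta c) d * s d i)))" for k
  proof (induction k)
    case (Suc k)
    then obtain s where s: "\<And>c i. c \<in> ?K \<Longrightarrow> card c < k \<Longrightarrow> i \<in> ?K \<Longrightarrow>
      p dvd bd X (s c) i - (delta c i - (\<Sum>d\<in>?K. bd X (delta c) d * s d i))" by blast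
    define F where "F c i = delta c i - (\<Sum>d\<in>?K. bd X (delta c) d * s d i)" for c i
    have ex: "\<exists>y. \<forall>i\<in>?K. p dvd bd X y i - F c i" if c: "c \<in> ?K" "card c = k" for c
    proof -
      have "p dvd bd X (F c) i" if i: "i \<in> ?K" for i
      proof -
        have "bd X (F c) i = bd X (delta c) i - (\<Sum>d\<in>?K. bd X (delta c) d * bd X (s d) i)"
          unfolding F_def bd_diff bd_sum ..
        moreover have "p dvd (\<Sum>d\<in>?K. bd X (delta c) d * bd X (s d) i) - (\<Sum>d\<in>?K. bd X (delta c) d * F d i)"
          unfolding sum_subtractf[symmetric]
        proof (rule dvd_sum)
          fix d assume d: "d \<in> ?K"
          show "p dvd bd X (delta c) d * bd X (s d) i - bd X (delta c) d * F d i"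
          proof (cases "card c = Suc (card d)")
            case True
            then have "p dvd bd X (s d) i - F d i" using s[OF d _ i] c by (simp add: F_def)
            then show ?thesis by (metis dvd_mult right_diff_distrib)
          next
            case False then show ?thesis using low[OF d False] by simp
          qed
        qed
        moreover have "(\<Sum>d\<in>?K. bd X (delta c) d * F d i) = bd X (delta c) i"
        proof -
          have "(\<Sum>d\<in>?K. bd X (delta c) d * F d i) =
             (\<Sum>d\<in>?K. bd X (delta c) d * delta d i) -
             (\<Sum>d\<in>?K. bd X (delta c) d * (\<Sum>e\<in>?K. bd X (delta d) e * s e i))"
            unfolding F_def by (simp add: right_diff_distrib sum_subtractf)
          also have "(\<Sum>d\<in>?K. bd X (delta c) d * delta d i) = (\<Sum>d\<in>?K. if d = i then bd X (delta c) d else 0)"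
            by (rule sum.cong) (auto simp: delta_def)
          also have "\<dots> = bd X (delta c) i" using i fK by simp
          also have "(\<Sum>d\<in>?K. bd X (delta c) d * (\<Sum>e\<in>?K. bd X (delta d) e * s e i)) =
             (\<Sum>e\<in>?K. (\<Sum>d\<in>?K. bd X (delta c) d * bd X (delta d) e) * s e i)"
            unfolding sum_distrib_left sum_distrib_right by (subst sum.swap) (simp add: mult.assoc)
          also have "\<dots> = (\<Sum>e\<in>?K. bd X (bd X (delta c)) e * s e i)"
            by (rule sum.cong) (simp_all add: bd_delta_expand[OF X, of _ "bd X (delta c)"])
          also have "\<dots> = 0" by (rule sum.neutral) (simp add: bd_bd[OF X])
          finally show ?thesis by simp
        qed
        ultimately show ?thesis by (metis dvd_diff_commute)
      qed
      then show ?thesis using A unfolding acyclic_mod_def by blast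
    qed
    define s' where "s' c = (if card c = k then SOME y. \<forall>i\<in>?K. p dvd bd X y i - F c i else s c)" for c
    have sF: "(\<Sum>d\<in>?K. bd X (delta c) d * s' d i) = (\<Sum>d\<in>?K. bd X (delta c) d * s d i)"
      if "card c \<le> k" for c i
    proof (rule sum.cong[OF refl])
      fix d assume "d \<in> ?K"
      then show "bd X (delta c) d * s' d i = bd X (delta c) d * s d i"
        using low[of d c] that by (cases "card d = k") (auto simp: s'_def)
    qed
    have "p dvd bd X (s' c) i - (delta c i - (\<Sum>d\<in>?K. bd X (delta c) d * s' d i))"
      if c: "c \<in> ?K" "card c < Suc k" and i: "i \<in> ?K" for c i
    proof (cases "card c = k")
      case True
      have "\<forall>i\<in>?K. p dvd bd X (s' c) i - F c i"
        using someI_ex[OF ex[OF c(1) True]] True by (simp add: s'_def)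
      then show ?thesis using i sF[of c i] True by (simp add: F_def)
    next
      case False
      then show ?thesis using s[OF c(1) _ i] c sF[of c i] by (simp add: s'_def)
    qed
    then show ?case by blast
  qed simp
  from this[of "Suc (card X)"] obtain s where
    s: "\<And>c i. c \<in> ?K \<Longrightarrow> card c < Suc (card X) \<Longrightarrow> i \<in> ?K \<Longrightarrow>
      p dvd bd X (s c) i - (delta c i - (\<Sum>d\<in>?K. bd X (delta c) d * s d i))" by blast
  have "card c < Suc (card X)" if "c \<in> ?K" for c
    using card_mono[OF X chains_of_subset[OF that]] by simp
  then show ?thesis using s by blast
qed

definition reduced_euler :: "'a::order set \<Rightarrow> int" where
  "reduced_euler X = (\<Sum>c\<in>chains_of X. (-1) ^ card c)"

text \<open>The conclusion is an equation of integers although acyclicity is known only modulo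
  \<open>p\<close>. This is what allows the next layer of the group to have a different prime
  order.\<close>

theorem lefschetz_fixed_points:
  assumes X: "finite X" and g: "poset_auto X g" and p: "p > 1" and A: "acyclic_mod p X"
  shows "reduced_euler (fixed_points X g) = 0"
proof -
  let ?K = "chains_of X"
  have fK: "finite ?K" by (rule finite_chains_of[OF X])
  obtain s where s: "\<And>c i. c \<in> ?K \<Longrightarrow> i \<in> ?K \<Longrightarrow>
     p dvd bd X (s c) i - (delta c i - (\<Sum>d\<in>?K. bd X (delta c) d * s d i))"
    using acyclic_mod_homotopy[OF X A] by blast
  define D where "D i j = (if i \<in> ?K \<and> j \<in> ?K then bd X (delta j) i else 0)" for i j
  define S where "S i j = s j i" for i j
  \<comment> \<open>Pullback along \<open>g\<close>, signed by the parity of the size. The pullback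
    commutes with the boundary, and the parity turns this into anticommutation; the ordinary trace
    of \<open>H\<close> is the signed count of fixed chains.\<close>
  define H :: "'a set \<Rightarrow> 'a set \<Rightarrow> int" where
    "H i j = (if i \<in> ?K \<and> j \<in> ?K \<and> j = g ` i then (-1) ^ card i else 0)" for i j
  have Dm: "mat_mul ?K D A i j = (if i \<in> ?K then bd X (\<lambda>k. A k j) i else 0)" for A i j
  proof (cases "i \<in> ?K")
    case True
    then show ?thesis unfolding mat_mul_def bd_delta_expand[OF X True, of "\<lambda>k. A k j"]
      by (auto simp: D_def mult.commute intro!: sum.cong)
  qed (simp add: mat_mul_def D_def)
  have "mat_trace ?K H = 0"
  proof (rule supertrace_zero[OF fK p, of D H S])
    show "mat_mul ?K D D = (\<lambda>_ _. 0)"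
    proof (intro ext)
      fix i j show "mat_mul ?K D D i j = 0"
      proof (cases "i \<in> ?K \<and> j \<in> ?K")
        case True
        then have "bd X (\<lambda>k. D k j) i = bd X (bd X (delta j)) i"
          by (intro bd_cong) (auto simp: D_def)
        then show ?thesis using True bd_bd[OF X, of i] by (simp add: Dm)
      next
        case False
        then show ?thesis by (auto simp: mat_mul_def D_def intro!: sum.neutral)
      qed
    qed
    show "mat_mul ?K H D = (\<lambda>i j. - mat_mul ?K D H i j)"
    proof (intro ext)
      fix i j
      show "mat_mul ?K H D i j = - mat_mul ?K D H i j"
      proof (cases "i \<in> ?K \<and> j \<in> ?K")
        case True
        then have gi: "g ` i \<in> ?K" using poset_auto_chain[OF g] by blast
        have "mat_mul ?K H D i j = (\<Sum>k\<in>?K. if k = g ` i then (-1) ^ card i * D k j else 0)"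
          unfolding mat_mul_def by (rule sum.cong) (use True in \<open>auto simp: H_def\<close>)
        also have "\<dots> = (-1) ^ card i * bd X (delta j) (g ` i)"
          using gi fK True by (simp add: D_def)
        also have "bd X (delta j) (g ` i) = bd X (\<lambda>k. delta j (g ` k)) i"
          using bd_equivariant[OF X g, of i] True by simp
        finally have 1: "mat_mul ?K H D i j = (-1) ^ card i * bd X (\<lambda>k. delta j (g ` k)) i" .
        have "mat_mul ?K D H i j = bd X (\<lambda>k. H k j) i" using True by (simp add: Dm)
        also have "\<dots> = (\<Sum>x\<in>ext_points X i. bd_sign x i * (- ((-1) ^ card i) * delta j (g ` insert x i)))"
          unfolding bd_def
        proof (rule sum.cong[OF refl])
          fix x assume x: "x \<in> ext_points X i"
          have "insert x i \<in> ?K" using insert_chain x True by blast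
          moreover have "card (insert x i) = Suc (card i)"
            using finite_chain[OF X, of i] ext_points_notin[OF x] True by simp
          ultimately show "bd_sign x i * H (insert x i) j =
              bd_sign x i * (- ((-1) ^ card i) * delta j (g ` insert x i))"
            using True by (auto simp: H_def delta_def)
        qed
        also have "\<dots> = - ((-1) ^ card i) * bd X (\<lambda>k. delta j (g ` k)) i"
          unfolding bd_def sum_distrib_left by (rule sum.cong) auto
        finally show ?thesis using 1 by simp
      next
        case False
        then show ?thesis by (auto simp: mat_mul_def D_def H_def intro!: sum.neutral)
      qed
    qed
    fix i j assume ij: "i \<in> ?K" "j \<in> ?K"
    have "mat_mul ?K S D i j = (\<Sum>d\<in>?K. bd X (delta j) d * s d i)"
      unfolding mat_mul_def by (rule sum.cong) (use ij in \<open>auto simp: D_def S_def\<close>)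
    moreover have "mat_mul ?K D S i j = bd X (s j) i" using ij by (simp add: Dm S_def)
    ultimately show "p dvd mat_mul ?K D S i j + mat_mul ?K S D i j - (if i = j then 1 else 0)"
      using s[OF ij(2,1)] by (simp add: delta_def algebra_simps)
  qed (auto simp: D_def H_def split: if_splits)
  moreover have "mat_trace ?K H = (\<Sum>c\<in>{c\<in>?K. g ` c = c}. (-1) ^ card c)"
    unfolding mat_trace_def
    by (rule sum.mono_neutral_cong_right) (use fK in \<open>auto simp: H_def\<close>)
  ultimately show ?thesis unfolding reduced_euler_def chains_of_fixed_points[OF X g] by simp
qed

text \<open>Chains that move fall into orbits of \<open>q\<close> chains of equal size. Instead of
  counting orbits, the sign is written as a norm by \<open>norm_image_decomp\<close>; a norm summed
  over all moving chains is a multiple of \<open>q\<close>.\<close>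

lemma reduced_euler_prime_action:
  assumes X: "finite X" and g: "poset_auto X g" and q: "prime q"
    and order: "\<And>x. x \<in> X \<Longrightarrow> (g ^^ q) x = x"
  shows "int q dvd reduced_euler X - reduced_euler (fixed_points X g)"
proof -
  define K where "K = chains_of X"
  have fK: "finite K" using finite_chains_of[OF X] by (simp add: K_def)
  define \<gamma> where "\<gamma> = (`) g"
  interpret prime_action K \<gamma> q
  proof
    fix c assume c: "c \<in> K"
    show "\<gamma> c \<in> K" using poset_auto_chain[OF g] c by (simp add: K_def \<gamma>_def)
    have "(\<gamma> ^^ q) c = (g ^^ q) ` c" by (simp add: \<gamma>_def funpow_image)
    also have "\<dots> = (\<lambda>x. x) ` c"
      by (rule image_cong[OF refl]) (use chains_of_subset[of c X] c order in \<open>auto simp: K_def\<close>)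
    finally show "(\<gamma> ^^ q) c = c" by simp
  qed (use q in auto)
  define y :: "'a set \<Rightarrow> int" where "y c = (-1) ^ card c" for c
  have y\<gamma>: "y (\<gamma> c) = y c" if "c \<in> K" for c
    using poset_auto_card[OF g] that by (simp add: K_def y_def \<gamma>_def)
  obtain h where h: "\<And>c. c \<in> K \<Longrightarrow> \<gamma> c \<noteq> c \<Longrightarrow> int q dvd y c - (\<Sum>i<q. h ((\<gamma> ^^ i) c))"
    using norm_image_decomp[of y] y\<gamma> by auto
  let ?M = "{c\<in>K. \<gamma> c \<noteq> c}"
  have inj: "inj_on \<gamma> K"
  proof (rule inj_onI)
    fix c d assume cd: "c \<in> K" "d \<in> K" "\<gamma> c = \<gamma> d"
    obtain m where m: "q = Suc m" using p_pos by (cases q) auto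
    have "(\<gamma> ^^ q) c = (\<gamma> ^^ q) d" unfolding m by (simp only: funpow_Suc_right o_apply cd(3))
    then show "c = d" using prime_action.order[OF prime_action_axioms] cd by simp
  qed
  have M: "\<gamma> ` ?M = ?M"
  proof (rule card_subset_eq)
    show "finite ?M" using fK by simp
    show "\<gamma> ` ?M \<subseteq> ?M" using inj maps by (auto dest: inj_onD)
    show "card (\<gamma> ` ?M) = card ?M" by (rule card_image) (use inj in \<open>auto intro: inj_on_subset\<close>)
  qed
  have shift: "(\<Sum>c\<in>?M. h ((\<gamma> ^^ i) c)) = sum h ?M" for i
  proof (induction i)
    case (Suc i)
    have "sum (\<lambda>c. h ((\<gamma> ^^ i) c)) (\<gamma> ` ?M) = (\<Sum>c\<in>?M. h ((\<gamma> ^^ i) (\<gamma> c)))"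
      by (rule sum.reindex[unfolded o_def]) (use inj in \<open>auto intro: inj_on_subset\<close>)
    then show ?case using Suc M by (simp add: funpow_swap1)
  qed simp
  have "int q dvd (\<Sum>c\<in>?M. y c - (\<Sum>i<q. h ((\<gamma> ^^ i) c)))"
    using h by (intro dvd_sum) auto
  also have "(\<Sum>c\<in>?M. y c - (\<Sum>i<q. h ((\<gamma> ^^ i) c))) = sum y ?M - int q * sum h ?M"
    unfolding sum_subtractf by (subst sum.swap) (simp add: shift)
  finally have "int q dvd (sum y ?M - int q * sum h ?M) + int q * sum h ?M" by (intro dvd_add) auto
  then have "int q dvd sum y ?M" by simp
  moreover have "sum y K = sum y {c\<in>K. \<gamma> c = c} + sum y ?M"
    by (subst sum.union_disjoint[symmetric]) (auto simp: fK intro!: sum.cong)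
  ultimately show ?thesis
    unfolding reduced_euler_def chains_of_fixed_points[OF X g]
    by (simp add: K_def y_def \<gamma>_def)
qed

lemma reduced_euler_empty: "reduced_euler {} = 1"
proof -
  have "chains_of ({} :: 'a set) = {{}}" by (auto simp: chains_of_def)
  then show ?thesis by (simp add: reduced_euler_def)
qed

section \<open>Non-evasive properties and fixed points\<close>

text \<open>\<open>A\<close> holds the variables already answered 1 and \<open>V\<close> those still
  open. A query of \<open>v\<close> in \<open>V\<close> splits the members into those without
  \<open>v\<close> and those with \<open>v\<close>, and the subtrees make the two parts acyclic; a
  query outside \<open>V\<close> has a known answer.\<close>

lemma acyclic_mod_of_tree:
  assumes mono: "\<And>E E'. E \<in> P \<Longrightarrow> E' \<subseteq> E \<Longrightarrow> E' \<in> P"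
  shows "finite V \<Longrightarrow> V \<inter> A = {} \<Longrightarrow> tree_depth t < card V \<Longrightarrow> A \<in> P \<Longrightarrow> finite A \<Longrightarrow>
    (\<And>F. F \<subseteq> V \<Longrightarrow> tree_eval t (F \<union> A) \<longleftrightarrow> F \<union> A \<in> P) \<Longrightarrow>
    acyclic_mod p {E\<in>P. A \<subset> E \<and> E \<subseteq> A \<union> V}"
proof (induction t arbitrary: V A)
  case (Answer b)
  \<comment> \<open>The depth bound leaves an open variable at a leaf. As \<open>A\<close> is in
    \<open>P\<close>, the constant answer is yes, so \<open>A \<union> V\<close> is the largest
    element and the poset is a cone.\<close>
  have "V \<noteq> {}" using Answer.prems by auto
  have b: "b" using Answer.prems(6)[of "{}"] Answer.prems(4) by simp
  have fin: "finite {E\<in>P. A \<subset> E \<and> E \<subseteq> A \<union> V}"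
    by (rule finite_subset[of _ "Pow (A \<union> V)"]) (use Answer.prems in auto)
  have "A \<union> V \<in> P" using Answer.prems(6)[of V] b by (simp add: Un_commute)
  then have "A \<union> V \<in> {E\<in>P. A \<subset> E \<and> E \<subseteq> A \<union> V}" using Answer.prems(2) \<open>V \<noteq> {}\<close> by auto
  then show ?case by (rule acyclic_mod_cone[OF fin]) auto
next
  case (Query v t0 t1)
  let ?X = "{E\<in>P. A \<subset> E \<and> E \<subseteq> A \<union> V}"
  show ?case
  proof (cases "v \<in> V")
    case False
    show ?thesis
    proof (cases "v \<in> A")
      case True
      show ?thesis
        by (rule Query.IH(2)) (use Query.prems True in auto)
    next
      case vA: False
      have v: "v \<notin> F \<union> A" if "F \<subseteq> V" for F using that False vA by auto
      show ?thesis
        by (rule Query.IH(1)) (use Query.prems(1-5) Query.prems(6) v in auto)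
    qed
  next
    case True
    let ?V = "V - {v}"
    let ?B = "insert v A"
    let ?Del = "{E\<in>P. A \<subset> E \<and> E \<subseteq> A \<union> ?V}"
    let ?Lnk = "{E\<in>P. ?B \<subset> E \<and> E \<subseteq> ?B \<union> ?V}"
    have vA: "v \<notin> A" using True Query.prems(2) by auto
    have fX: "finite ?X" by (rule finite_subset[of _ "Pow (A \<union> V)"]) (use Query.prems in auto)
    have cV: "card ?V = card V - 1" using True Query.prems(1) by simp
    have cV0: "card V > 0" using Query.prems(3) by simp
    have X0: "acyclic_mod p ?Del"
    proof (rule Query.IH(1))
      fix F assume F: "F \<subseteq> ?V"
      then have "v \<notin> F \<union> A" using vA by auto
      then show "tree_eval t0 (F \<union> A) \<longleftrightarrow> F \<union> A \<in> P" using Query.prems(6)[of F] F by auto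
    qed (use Query.prems cV cV0 in auto)
    show ?thesis
    proof (cases "?B \<in> P")
      case False
      have "v \<notin> E" if "E \<in> ?X" for E
        using that False mono[of E ?B] by auto
      then have "?X \<subseteq> ?Del" by blast
      moreover have "?Del \<subseteq> ?X" by blast
      ultimately have "?X = ?Del" by blast
      then show ?thesis using X0 by (simp only:)
    next
      case B: True
      have X1: "acyclic_mod p ?Lnk"
      proof (rule Query.IH(2))
        fix F assume F: "F \<subseteq> ?V"
        then have "F \<subseteq> V" by blast
        then show "tree_eval t1 (F \<union> ?B) \<longleftrightarrow> F \<union> ?B \<in> P"
          using Query.prems(6)[of "insert v F"] True by simp
      qed (use Query.prems cV cV0 B in auto)
      have fX0: "finite ?Del" by (rule finite_subset[OF _ fX]) auto
      have fX1: "finite ?Lnk" by (rule finite_subset[OF _ fX]) (use True in auto)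
      \<comment> \<open>The members strictly above \<open>?B\<close> are added from the top down.
        When \<open>x\<close> is added, the members below it avoid \<open>v\<close> and those above
        it contain \<open>x\<close>, so everything comparable with \<open>x\<close> is comparable
        with \<open>x - {v}\<close>: the link is a cone.\<close>
      have up: "acyclic_mod p (?Del \<union> T)"
        if "T \<subseteq> ?Lnk" "\<And>x y. x \<in> T \<Longrightarrow> y \<in> ?Lnk \<Longrightarrow> x \<subseteq> y \<Longrightarrow> y \<in> T" for T
        using that
      proof (induction "card T" arbitrary: T)
        case 0
        then have "T = {}" using finite_subset[OF 0(2) fX1] by simp
        then show ?case using X0 by simp
      next
        case (Suc m)
        have fT: "finite T" by (rule finite_subset[OF Suc.prems(1) fX1])
        have "T \<noteq> {}" using Suc by auto
        then obtain x where x: "x \<in> T" "\<And>y. y \<in> T \<Longrightarrow> y \<subseteq> x \<Longrightarrow> y = x"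
          using finite_has_minimal[OF fT] by blast
        let ?T = "T - {x}"
        have T: "acyclic_mod p (?Del \<union> ?T)"
        proof (rule Suc.hyps(1))
          show "m = card ?T" using Suc.hyps(2) x fT by simp
          show "?T \<subseteq> ?Lnk" using Suc.prems by auto
          show "y \<in> ?T" if z: "z \<in> ?T" "y \<in> ?Lnk" "z \<subseteq> y" for z y
          proof -
            have "y \<in> T" using Suc.prems(2)[of z y] z by blast
            moreover have "y \<noteq> x" using x(2)[of z] z by blast
            ultimately show ?thesis by blast
          qed
        qed
        have xX: "x \<in> ?Lnk" using x Suc.prems by blast
        then have vx: "v \<in> x" and wP: "x - {v} \<in> P" and Ax: "A \<subset> x - {v}"
          using vA mono[of x "x - {v}"] by auto
        have w: "x - {v} \<in> ?Del" using wP Ax xX by auto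
        let ?L = "{y \<in> ?Del \<union> ?T. y < x \<or> x < y}"
        have fL: "finite (?Del \<union> ?T)" using fX0 fT by simp
        have "acyclic_mod p ?L"
        proof (rule acyclic_mod_cone)
          show "finite ?L" using fL by simp
          show "x - {v} \<in> ?L" using w vx by auto
          fix y assume y: "y \<in> ?L"
          show "y \<subseteq> x - {v} \<or> x - {v} \<subseteq> y"
          proof (cases "x < y")
            case False
            then have yx: "y < x" using y by auto
            then have "y \<notin> T" using x(2)[of y] by auto
            then have "y \<in> ?Del" using y by auto
            then have "v \<notin> y" using vA by auto
            then show ?thesis using yx by auto
          qed auto
        qed
        moreover have "x \<notin> ?Del \<union> ?T" using vx vA by auto
        ultimately have "acyclic_mod p (insert x (?Del \<union> ?T))"
          using acyclic_mod_add_point[OF fL _ T] by blast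
        moreover have "insert x (?Del \<union> ?T) = ?Del \<union> T" using x by auto
        ultimately show ?case by simp
      qed
      have X01: "acyclic_mod p (?Del \<union> ?Lnk)" by (rule up) auto
      \<comment> \<open>\<open>?B\<close> comes last. Removing \<open>v\<close> from it gives
        \<open>A\<close>, which is outside the poset, so there is no cone point; instead its link is
        the poset of the subtree for answer 1.\<close>
      have L: "{y \<in> ?Del \<union> ?Lnk. y < ?B \<or> ?B < y} = ?Lnk" using vA by auto
      have "acyclic_mod p (insert ?B (?Del \<union> ?Lnk))"
      proof (rule acyclic_mod_add_point)
        show "finite (?Del \<union> ?Lnk)" by (rule finite_UnI[OF fX0 fX1])
        show "?B \<notin> ?Del \<union> ?Lnk" using vA by blast
        show "acyclic_mod p (?Del \<union> ?Lnk)" by (rule X01)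
        show "acyclic_mod p {y \<in> ?Del \<union> ?Lnk. y < ?B \<or> ?B < y}" unfolding L by (rule X1)
      qed
      moreover have "insert ?B (?Del \<union> ?Lnk) = ?X"
      proof (intro equalityI subsetI)
        fix E assume "E \<in> insert ?B (?Del \<union> ?Lnk)"
        then show "E \<in> ?X" using B vA True by auto
      next
        fix E assume "E \<in> ?X"
        then show "E \<in> insert ?B (?Del \<union> ?Lnk)" by (cases "v \<in> E") auto
      qed
      ultimately show ?thesis by (simp only:)
    qed
  qed
qed

text \<open>Querying every variable takes depth at most \<open>card V\<close>, so a function that is
  not evasive has a tree of strictly smaller depth.\<close>

lemma decision_tree_exists:
  assumes "finite V"
  shows "\<exists>t. computes V t f \<and> tree_depth t \<le> card V"
  using assms
proof (induction V arbitrary: f rule: finite_induct)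
  case empty
  show ?case by (intro exI[of _ "Answer (f {})"]) (auto simp: computes_def)
next
  case (insert v V)
  obtain t0 where t0: "computes V t0 f" "tree_depth t0 \<le> card V" using insert.IH by blast
  obtain t1 where t1: "computes V t1 (\<lambda>X. f (insert v X))" "tree_depth t1 \<le> card V"
    using insert.IH by blast
  have irrel: "tree_eval t (X - {v}) = tree_eval t X" if "tree_vars t \<subseteq> V" for t X
    using that insert.hyps by (induction t) auto
  have "tree_eval (Query v t0 t1) X = f X" if X: "X \<subseteq> insert v V" for X
  proof (cases "v \<in> X")
    case True
    have "tree_eval t1 X = f (insert v (X - {v}))"
    proof -
      have "X - {v} \<subseteq> V" using X by auto
      then show ?thesis using t1 irrel[of t1 X] unfolding computes_def by metis
    qed
    then show ?thesis using True by (simp add: insert_absorb)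
  next
    case False
    then show ?thesis using t0 X unfolding computes_def by (auto simp: subset_insert)
  qed
  then have "computes (insert v V) (Query v t0 t1) f"
    using t0 t1 unfolding computes_def by auto
  then show ?case using t0 t1 insert.hyps by (intro exI[of _ "Query v t0 t1"]) auto
qed

lemma not_evasive_tree:
  assumes "finite V" "\<not> evasive V f"
  shows "\<exists>t. computes V t f \<and> tree_depth t < card V"
proof -
  obtain t where t: "computes V t f" "tree_depth t \<le> card V"
    using decision_tree_exists[OF assms(1)] by blast
  let ?Q = "\<lambda>d. \<exists>t. computes V t f \<and> tree_depth t = d"
  have "?Q (query_complexity V f)" "query_complexity V f \<le> tree_depth t"
    unfolding query_complexity_def using LeastI[of ?Q "tree_depth t"] Least_le[of ?Q "tree_depth t"] t by auto
  then show ?thesis using assms(2) t unfolding evasive_def by (metis le_neq_implies_less le_trans)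
qed

corollary not_evasive_acyclic_mod:
  assumes V: "finite V" and ne: "\<not> evasive V (\<lambda>E. E \<in> P)" and P: "P \<subseteq> Pow V" "P \<noteq> {}"
    and mono: "\<And>E E'. E \<in> P \<Longrightarrow> E' \<subseteq> E \<Longrightarrow> E' \<in> P"
  shows "acyclic_mod p (P - {{}})"
proof -
  obtain t where t: "computes V t (\<lambda>E. E \<in> P)" "tree_depth t < card V"
    using not_evasive_tree[OF V ne] by blast
  have "{} \<in> P" using P mono by blast
  then have "acyclic_mod p {E\<in>P. {} \<subset> E \<and> E \<subseteq> {} \<union> V}"
    using t by (intro acyclic_mod_of_tree[OF mono V]) (auto simp: computes_def)
  moreover have "{E\<in>P. {} \<subset> E \<and> E \<subseteq> {} \<union> V} = P - {{}}" using P by auto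
  ultimately show ?thesis by simp
qed

lemma poset_auto_restrict:
  assumes g: "poset_auto X g" and Y: "finite Y" "Y \<subseteq> X" and sub: "\<And>y. y \<in> Y \<Longrightarrow> g y \<in> Y"
  shows "poset_auto Y g"
proof -
  have inj: "inj_on g Y" using g Y unfolding poset_auto_def bij_betw_def by (blast intro: inj_on_subset)
  then have "g ` Y = Y" using endo_inj_surj[OF Y(1) _ inj] sub by blast
  then show ?thesis using g Y inj unfolding poset_auto_def bij_betw_def by blast
qed

text \<open>Smith's theorem is applied to one generator after another; commutation lets the
  remaining generators act on the fixed poset of the first.\<close>

lemma acyclic_mod_fixed_commuting:
  assumes p: "prime p"
  shows "finite X \<Longrightarrow> acyclic_mod (int p) X \<Longrightarrow> (\<And>t. t \<in> set ts \<Longrightarrow> poset_auto X t) \<Longrightarrow>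
     (\<And>t x. t \<in> set ts \<Longrightarrow> x \<in> X \<Longrightarrow> (t ^^ p) x = x) \<Longrightarrow>
     (\<And>t u x. t \<in> set ts \<Longrightarrow> u \<in> set ts \<Longrightarrow> x \<in> X \<Longrightarrow> t (u x) = u (t x)) \<Longrightarrow>
     acyclic_mod (int p) {x\<in>X. \<forall>t\<in>set ts. t x = x}"
proof (induction ts arbitrary: X)
  case (Cons t ts)
  let ?F = "fixed_points X t"
  have FX: "?F \<subseteq> X" "finite ?F" using Cons.prems(1) by (auto simp: fixed_points_def)
  have "acyclic_mod (int p) ?F"
    by (rule smith_acyclic_mod) (use p Cons.prems in auto)
  moreover have "poset_auto ?F u" if u: "u \<in> set ts" for u
  proof (rule poset_auto_restrict)
    show uX: "poset_auto X u" using Cons.prems u by simp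
    fix y assume y: "y \<in> ?F"
    then have "t (u y) = u y" using Cons.prems(5)[of t u y] u by (simp add: fixed_points_def)
    moreover have "u y \<in> X" using uX y by (auto simp: poset_auto_def bij_betw_def fixed_points_def)
    ultimately show "u y \<in> ?F" by (simp add: fixed_points_def)
  qed (use FX in auto)
  ultimately have "acyclic_mod (int p) {x\<in>?F. \<forall>t\<in>set ts. t x = x}"
    using Cons.prems FX by (intro Cons.IH) auto
  moreover have "{x\<in>?F. \<forall>t\<in>set ts. t x = x} = {x\<in>X. \<forall>u\<in>set (t # ts). u x = x}"
    by (auto simp: fixed_points_def)
  ultimately show ?case by simp
qed simp

text \<open>The case of Oliver's fixed point theorem where the bottom group is generated by commuting
  automorphisms of order \<open>p\<close>, and the top group has prime order.\<close>

theorem oliver_fixed_point: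
  assumes X: "finite X" and A: "acyclic_mod (int p) X" and p: "prime p" and q: "prime q"
    and ts: "\<And>t. t \<in> set ts \<Longrightarrow> poset_auto X t"
      "\<And>t x. t \<in> set ts \<Longrightarrow> x \<in> X \<Longrightarrow> (t ^^ p) x = x"
      "\<And>t u x. t \<in> set ts \<Longrightarrow> u \<in> set ts \<Longrightarrow> x \<in> X \<Longrightarrow> t (u x) = u (t x)"
    and g: "poset_auto X g"
      "\<And>t x. x \<in> X \<Longrightarrow> (\<And>u. u \<in> set ts \<Longrightarrow> u x = x) \<Longrightarrow> t \<in> set ts \<Longrightarrow> t (g x) = g x"
    and h: "poset_auto X h" "\<And>x. x \<in> X \<Longrightarrow> (h ^^ q) x = x"
      "\<And>t x. x \<in> X \<Longrightarrow> (\<And>u. u \<in> set ts \<Longrightarrow> u x = x) \<Longrightarrow> g x = x \<Longrightarrow> t \<in> set ts \<Longrightarrow> t (h x) = h x"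
      "\<And>x. x \<in> X \<Longrightarrow> (\<And>u. u \<in> set ts \<Longrightarrow> u x = x) \<Longrightarrow> g x = x \<Longrightarrow> g (h x) = h x"
  shows "\<exists>x\<in>X. (\<forall>t\<in>set ts. t x = x) \<and> g x = x \<and> h x = x"
proof -
  define Y where "Y = {x\<in>X. \<forall>t\<in>set ts. t x = x}"
  have Y: "Y \<subseteq> X" "finite Y" using X by (auto simp: Y_def)
  have AY: "acyclic_mod (int p) Y"
    unfolding Y_def by (rule acyclic_mod_fixed_commuting[OF p X A]) (use ts in auto)
  have gX: "g x \<in> X" "h x \<in> X" if "x \<in> X" for x
    using g(1) h(1) that by (auto simp: poset_auto_def bij_betw_def)
  have gY: "poset_auto Y g"
    by (rule poset_auto_restrict[OF g(1) Y(2,1)]) (use gX g(2) in \<open>auto simp: Y_def\<close>)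
  define Z where "Z = fixed_points Y g"
  have Z: "Z \<subseteq> X" "finite Z" using Y by (auto simp: Z_def fixed_points_def)
  have hZ: "poset_auto Z h"
    by (rule poset_auto_restrict[OF h(1) Z(2,1)])
      (use gX h(3,4) in \<open>auto simp: Z_def Y_def fixed_points_def\<close>)
  \<comment> \<open>An exact zero survives the change from \<open>p\<close> to \<open>q\<close>. The
    empty poset has reduced Euler characteristic 1, which \<open>q\<close> does not divide, so the
    fixed set cannot be empty.\<close>
  have "reduced_euler Z = 0"
    unfolding Z_def by (rule lefschetz_fixed_points[OF Y(2) gY _ AY]) (use prime_gt_1_nat[OF p] in simp)
  moreover have "int q dvd reduced_euler Z - reduced_euler (fixed_points Z h)"
    by (rule reduced_euler_prime_action[OF Z(2) hZ q]) (use h(2) Z in auto)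
  ultimately have "int q dvd reduced_euler (fixed_points Z h)" by simp
  then have "fixed_points Z h \<noteq> {}"
    using reduced_euler_empty[where 'a='a] prime_gt_1_nat[OF q] by auto
  then show ?thesis by (auto simp: fixed_points_def Z_def Y_def)
qed

section \<open>Selberg's sieve\<close>

lemma card_residue_class:
  fixes M b n :: nat
  assumes M: "M > 0"
  shows "\<bar>real (card {r\<in>{1..n}. [r = b] (mod M)}) - real n / real M\<bar> \<le> 1"
proof -
  \<comment> \<open>The representative is taken between 1 and \<open>M\<close>, because the count
    starts at 1.\<close>
  define a where "a = (if b mod M = 0 then M else b mod M)"
  have a: "a \<ge> 1" "a \<le> M" "[a = b] (mod M)" using M by (auto simp: a_def unique_euclidean_semiring_class.cong_def less_imp_le)
  have rep: "\<exists>k. r = M * k + a" if r: "r \<ge> 1" "[r = b] (mod M)" for r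
  proof (cases "b mod M = 0")
    case True
    then have "M dvd r" using r by (simp add: unique_euclidean_semiring_class.cong_def mod_eq_0_iff_dvd)
    then obtain k where k: "r = M * k" by blast
    then have "r = M * (k - 1) + a" using r True by (cases k) (auto simp: a_def)
    then show ?thesis by blast
  next
    case False
    then have "r mod M = a" using r by (simp add: unique_euclidean_semiring_class.cong_def a_def)
    then show ?thesis by (metis mult_div_mod_eq)
  qed
  have eq: "{r\<in>{1..n}. [r = b] (mod M)} = (\<lambda>k. M * k + a) ` {k. M * k + a \<le> n}"
  proof (intro equalityI subsetI)
    fix r assume "r \<in> {r\<in>{1..n}. [r = b] (mod M)}"
    then show "r \<in> (\<lambda>k. M * k + a) ` {k. M * k + a \<le> n}" using rep[of r] by auto
  next
    fix r assume "r \<in> (\<lambda>k. M * k + a) ` {k. M * k + a \<le> n}"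
    then obtain k where k: "r = M * k + a" "r \<le> n" by auto
    have "[r = a] (mod M)" by (simp add: k unique_euclidean_semiring_class.cong_def)
    then show "r \<in> {r\<in>{1..n}. [r = b] (mod M)}" using a k cong_trans by auto
  qed
  have inj: "inj_on (\<lambda>k. M * k + a) S" for S using M by (auto simp: inj_on_def)
  show ?thesis
  proof (cases "a \<le> n")
    case True
    have S: "{k. M * k + a \<le> n} = {..(n - a) div M}"
    proof -
      have "M * k + a \<le> n \<longleftrightarrow> k \<le> (n - a) div M" for k
        unfolding less_eq_div_iff_mult_less_eq[OF M] using True by (auto simp: mult.commute)
      then show ?thesis by auto
    qed
    have "card {r\<in>{1..n}. [r = b] (mod M)} = card {k. M * k + a \<le> n}"
      unfolding eq by (rule card_image[OF inj])
    then have c: "card {r\<in>{1..n}. [r = b] (mod M)} = (n - a) div M + 1" unfolding S by simp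
    have dm: "real (n - a) = real ((n - a) div M) * real M + real ((n - a) mod M)"
      by (metis div_mult_mod_eq of_nat_add of_nat_mult)
    have "real ((n - a) mod M) \<le> real M" using M by (simp add: less_imp_le)
    then have "real ((n - a) div M) \<le> real (n - a) / real M"
      and "real (n - a) / real M - 1 \<le> real ((n - a) div M)"
      using M unfolding dm by (auto simp: field_simps)
    moreover have "real (n - a) / real M = real n / real M - real a / real M"
      using True by (simp add: of_nat_diff diff_divide_distrib)
    moreover have "real a / real M \<le> 1" "real a / real M \<ge> 0" using a M by auto
    ultimately show ?thesis using c by linarith
  next
    case False
    then have "{k. M * k + a \<le> n} = {}" by auto
    then have c: "card {r\<in>{1..n}. [r = b] (mod M)} = 0" unfolding eq by simp
    have "real n \<le> real M" using False a by simp
    then have "real n / real M \<le> 1" "real n / real M \<ge> 0" using M by (auto simp: divide_le_eq)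
    then show ?thesis unfolding c by simp
  qed
qed

lemma card_residue_class_multiples:
  fixes L d a n :: nat
  assumes L: "L > 0" and d: "d > 0" and cop: "coprime L d"
  shows "\<bar>real (card {r\<in>{1..n}. [r = a] (mod L) \<and> d dvd r}) - real n / (real L * real d)\<bar> \<le> 1"
proof -
  obtain b where b: "[b = a] (mod L)" "[b = 0] (mod d)"
    using binary_chinese_remainder_nat[OF cop, of a 0] by blast
  have "[r = a] (mod L) \<and> d dvd r \<longleftrightarrow> [r = b] (mod (L * d))" for r
  proof
    assume "[r = a] (mod L) \<and> d dvd r"
    then have "[r = b] (mod L)" "[r = b] (mod d)"
      using b by (auto simp: unique_euclidean_semiring_class.cong_def)
    then show "[r = b] (mod (L * d))" using cop by (rule coprime_cong_mult_nat)
  next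
    assume r: "[r = b] (mod (L * d))"
    have "[r = b] (mod L)" "[r = b] (mod d)"
      using cong_dvd_modulus_nat[OF r] by auto
    then show "[r = a] (mod L) \<and> d dvd r"
      using b by (auto simp: unique_euclidean_semiring_class.cong_def mod_eq_0_iff_dvd)
  qed
  then show ?thesis using card_residue_class[of "L * d" n b] L d by simp
qed

lemma prod_primes_dvd_iff:
  fixes U :: "nat set"
  assumes "finite U" "\<And>l. l \<in> U \<Longrightarrow> prime l"
  shows "\<Prod>U dvd r \<longleftrightarrow> (\<forall>l\<in>U. l dvd r)"
  using assms
proof (induction U rule: finite_induct)
  case (insert l U)
  have "coprime l (\<Prod>U)"
    using insert by (intro prod_coprime_right) (auto intro: primes_coprime)
  then have "l * \<Prod>U dvd r \<longleftrightarrow> l dvd r \<and> \<Prod>U dvd r"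
    by (auto intro: divides_mult dvd_mult_left dvd_mult_right)
  then show ?case using insert by simp
qed simp

text \<open>Squarefree numbers up to \<open>Z\<close> without prime factors in \<open>Q\<close>,
  encoded by their sets of prime factors. On such sets \<open>phi_set\<close> is Euler's function,
  \<open>sig_set\<close> is the divisor sum, and \<open>sieve_G\<close> is Selberg's sum of
  reciprocals of Euler's function.\<close>

definition sieve_sets :: "nat set \<Rightarrow> nat \<Rightarrow> nat set set" where
  "sieve_sets Q Z = {A. finite A \<and> (\<forall>l\<in>A. prime l \<and> l \<notin> Q) \<and> \<Prod>A \<le> Z}"

definition phi_set :: "nat set \<Rightarrow> real" where "phi_set A = (\<Prod>l\<in>A. real l - 1)"

definition sig_set :: "nat set \<Rightarrow> real" where "sig_set A = (\<Prod>l\<in>A. real l + 1)"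

definition sieve_G :: "nat set \<Rightarrow> nat \<Rightarrow> real" where
  "sieve_G Q Z = (\<Sum>A\<in>sieve_sets Q Z. 1 / phi_set A)"

lemma sieve_sets_elem_le:
  assumes "A \<in> sieve_sets Q Z" "l \<in> A" shows "l \<le> Z"
proof -
  have "l dvd \<Prod>A" using assms by (auto simp: sieve_sets_def intro: dvd_prodI)
  moreover have "\<Prod>A > 0" using assms by (auto simp: sieve_sets_def intro!: prod_pos prime_gt_0_nat)
  ultimately have "l \<le> \<Prod>A" by (rule dvd_imp_le)
  then show ?thesis using assms by (simp add: sieve_sets_def)
qed

lemma finite_sieve_sets: "finite (sieve_sets Q Z)"
  by (rule finite_subset[of _ "Pow {..Z}"]) (use sieve_sets_elem_le in auto)

lemma phi_set_pos: "(\<And>l. l \<in> A \<Longrightarrow> prime l) \<Longrightarrow> phi_set A > 0"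
  unfolding phi_set_def by (rule prod_pos) (use prime_gt_1_nat in force)

text \<open>The factor of \<open>\<psi>\<close> at \<open>l\<close> has mean zero over the residues
  modulo \<open>l\<close> and mean square \<open>l - 1\<close>, so distinct functions are orthogonal
  on average; up to sign they are Ramanujan sums. Each divisor counted in a residue class costs an
  error of at most 1 times its coefficient.\<close>

lemma prod_correlation_bound:
  fixes A B :: "nat set"
  assumes L: "L > 0" and A: "finite A" "\<And>l. l \<in> A \<Longrightarrow> prime l \<and> coprime L l"
    and B: "finite B" "\<And>l. l \<in> B \<Longrightarrow> prime l \<and> coprime L l"
  defines "\<psi> \<equiv> \<lambda>A r. \<Prod>l\<in>A. 1 - (if l dvd r then real l else 0)"
  shows "(\<Sum>r\<in>{r\<in>{1..n}. [r = a] (mod L)}. \<psi> A r * \<psi> B r)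
     \<le> (if A = B then real n / real L * phi_set A else 0) + sig_set A * sig_set B"
proof -
  define T where "T = A \<union> B"
  \<comment> \<open>The coefficient of the indicator of \<open>l dvd r\<close> in the combined
    factor at \<open>l\<close>: that factor is squared if \<open>l\<close> lies in both sets and
    occurs once otherwise.\<close>
  define c where "c l = (if l \<in> A \<and> l \<in> B then (real l)\<^sup>2 - 2 * real l else - real l)" for l
  let ?R = "{r\<in>{1..n}. [r = a] (mod L)}"
  have T: "finite T" "\<And>l. l \<in> T \<Longrightarrow> prime l" "\<And>l. l \<in> T \<Longrightarrow> coprime L l" using A B by (auto simp: T_def)
  have l2: "real l \<ge> 2" if "l \<in> T" for l using prime_ge_2_nat[OF T(2)[OF that]] by simp
  have \<psi>T: "\<psi> C r = (\<Prod>l\<in>T. if l \<in> C then 1 - (if l dvd r then real l else 0) else 1)"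
    if "C \<subseteq> T" for C r
    unfolding \<psi>_def using that T by (subst prod.mono_neutral_right[of T C]) (auto intro!: prod.cong)
  have prod: "\<psi> A r * \<psi> B r = (\<Prod>l\<in>T. c l * (if l dvd r then 1 else 0) + 1)" for r
  proof -
    have "\<psi> A r * \<psi> B r = (\<Prod>l\<in>T. (if l \<in> A then 1 - (if l dvd r then real l else 0) else 1) *
        (if l \<in> B then 1 - (if l dvd r then real l else 0) else 1))"
      by (subst \<psi>T, simp add: T_def, subst \<psi>T, simp add: T_def, simp add: prod.distrib)
    also have "\<dots> = (\<Prod>l\<in>T. c l * (if l dvd r then 1 else 0) + 1)"
      by (rule prod.cong[OF refl]) (auto simp: c_def T_def power2_eq_square algebra_simps)
    finally show ?thesis .
  qed
  have expand: "\<psi> A r * \<psi> B r = (\<Sum>U\<in>Pow T. (\<Prod>l\<in>U. c l) * (if \<Prod>U dvd r then 1 else 0))" for r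
    unfolding prod prod_add[OF T(1)]
  proof (rule sum.cong[OF refl])
    fix U assume U: "U \<in> Pow T"
    then have fU: "finite U" using T finite_subset by auto
    have "(\<Prod>l\<in>U. if l dvd r then 1 else (0::real)) = (if \<forall>l\<in>U. l dvd r then 1 else 0)"
      using fU by (induction U rule: finite_induct) auto
    then show "(\<Prod>l\<in>U. c l * (if l dvd r then 1 else 0)) * (\<Prod>l\<in>T - U. 1) =
        (\<Prod>l\<in>U. c l) * (if \<Prod>U dvd r then 1 else 0)"
      using prod_primes_dvd_iff[OF fU, of r] U T by (auto simp: prod.distrib)
  qed
  have "(\<Sum>r\<in>?R. \<psi> A r * \<psi> B r) = (\<Sum>U\<in>Pow T. (\<Prod>l\<in>U. c l) * real (card {r\<in>{1..n}. [r = a] (mod L) \<and> \<Prod>U dvd r}))"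
    unfolding expand
  proof (subst sum.swap, rule sum.cong[OF refl])
    fix U
    have "(\<Sum>r\<in>?R. if \<Prod>U dvd r then 1 else (0::real)) = real (card {r\<in>?R. \<Prod>U dvd r})"
      by (simp add: sum.If_cases Int_def)
    also have "{r\<in>?R. \<Prod>U dvd r} = {r\<in>{1..n}. [r = a] (mod L) \<and> \<Prod>U dvd r}" by auto
    finally show "(\<Sum>r\<in>?R. (\<Prod>l\<in>U. c l) * (if \<Prod>U dvd r then 1 else 0)) =
      (\<Prod>l\<in>U. c l) * real (card {r\<in>{1..n}. [r = a] (mod L) \<and> \<Prod>U dvd r})"
      by (simp only: sum_distrib_left[symmetric])
  qed
  also have "\<dots> \<le> (\<Sum>U\<in>Pow T. (\<Prod>l\<in>U. c l) * (real n / (real L * real (\<Prod>U))) + (\<Prod>l\<in>U. \<bar>c l\<bar>))"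
  proof (rule sum_mono)
    fix U assume U: "U \<in> Pow T"
    then have fU: "finite U" using T finite_subset by auto
    let ?N = "real (card {r\<in>{1..n}. [r = a] (mod L) \<and> \<Prod>U dvd r})"
    let ?E = "real n / (real L * real (\<Prod>U))"
    have "\<Prod>U > 0" by (rule prod_pos) (use U T(2) prime_gt_0_nat in blast)
    moreover have "coprime L (\<Prod>U)" by (rule prod_coprime_right) (use U T(3) in blast)
    ultimately have "\<bar>?N - ?E\<bar> \<le> 1" by (rule card_residue_class_multiples[OF L])
    then have "\<bar>(\<Prod>l\<in>U. c l) * (?N - ?E)\<bar> \<le> \<bar>\<Prod>l\<in>U. c l\<bar> * 1"
      unfolding abs_mult by (intro mult_left_mono) auto
    then have "(\<Prod>l\<in>U. c l) * (?N - ?E) \<le> \<bar>\<Prod>l\<in>U. c l\<bar>" by linarith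
    then show "(\<Prod>l\<in>U. c l) * ?N \<le> (\<Prod>l\<in>U. c l) * ?E + (\<Prod>l\<in>U. \<bar>c l\<bar>)"
      by (simp add: abs_prod right_diff_distrib)
  qed
  also have "\<dots> = real n / real L * (\<Sum>U\<in>Pow T. \<Prod>l\<in>U. c l / real l) + (\<Sum>U\<in>Pow T. \<Prod>l\<in>U. \<bar>c l\<bar>)"
    unfolding sum.distrib sum_distrib_left
    by (intro arg_cong2[of _ _ _ _ "(+)"] sum.cong refl) (simp add: prod_dividef)
  also have "(\<Sum>U\<in>Pow T. \<Prod>l\<in>U. c l / real l) = (\<Prod>l\<in>T. c l / real l + 1)"
    unfolding prod_add[OF T(1)] by simp
  also have "(\<Sum>U\<in>Pow T. \<Prod>l\<in>U. \<bar>c l\<bar>) = (\<Prod>l\<in>T. \<bar>c l\<bar> + 1)"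
    unfolding prod_add[OF T(1)] by simp
  also have "(\<Prod>l\<in>T. c l / real l + 1) = (if A = B then phi_set A else 0)"
  proof (cases "A = B")
    case True
    have "(\<Prod>l\<in>T. c l / real l + 1) = (\<Prod>l\<in>A. real l - 1)"
    proof (rule prod.cong)
      show "T = A" using True by (simp add: T_def)
      fix l assume l: "l \<in> A"
      then have "real l \<noteq> 0" using l2[of l] by (auto simp: T_def)
      then show "c l / real l + 1 = real l - 1"
        using l True by (simp add: c_def power2_eq_square diff_divide_distrib)
    qed
    then show ?thesis using True by (simp add: phi_set_def)
  next
    case False
    then obtain l where l: "l \<in> T" "\<not> (l \<in> A \<and> l \<in> B)" by (auto simp: T_def)
    then have "c l / real l + 1 = 0" using l2[OF l(1)] by (auto simp: c_def)
    then show ?thesis using False l T(1) by auto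
  qed
  also have "(\<Prod>l\<in>T. \<bar>c l\<bar> + 1) \<le> (\<Prod>l\<in>T. (if l \<in> A then real l + 1 else 1) * (if l \<in> B then real l + 1 else 1))"
  proof (rule prod_mono)
    fix l assume l: "l \<in> T"
    have "\<bar>(real l)\<^sup>2 - 2 * real l\<bar> + 1 \<le> (real l + 1) * (real l + 1)"
    proof -
      have "(real l)\<^sup>2 - 2 * real l = real l * (real l - 2)" by (simp add: power2_eq_square algebra_simps)
      then have "(real l)\<^sup>2 - 2 * real l \<ge> 0" using l2[OF l] by simp
      then show ?thesis using l2[OF l] by (simp add: power2_eq_square algebra_simps)
    qed
    then show "0 \<le> \<bar>c l\<bar> + 1 \<and> \<bar>c l\<bar> + 1 \<le> (if l \<in> A then real l + 1 else 1) * (if l \<in> B then real l + 1 else 1)"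
      using l by (auto simp: c_def T_def)
  qed
  also have "\<dots> = sig_set A * sig_set B"
  proof -
    have "sig_set C = (\<Prod>l\<in>T. if l \<in> C then real l + 1 else 1)" if "C \<subseteq> T" for C
      unfolding sig_set_def using that T by (subst prod.mono_neutral_right[of T C]) (auto intro!: prod.cong)
    then show ?thesis by (simp add: T_def prod.distrib)
  qed
  finally show ?thesis by (auto split: if_splits)
qed

text \<open>Selberg's upper bound sieve: \<open>F = \<Sum>\<^sub>A \<psi>\<^sub>A / \<phi>(A)\<close> is constantly \<open>G\<close> on sifted numbers,
  and the functions \<open>\<psi>\<^sub>A\<close> are almost orthogonal.\<close>

theorem selberg_sieve:
  fixes L Z n a :: nat and Q :: "nat set"
  assumes L: "L > 0" and cop: "\<And>l. prime l \<Longrightarrow> l \<notin> Q \<Longrightarrow> coprime L l"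
  defines "N \<equiv> card {r\<in>{1..n}. [r = a] (mod L) \<and> (\<forall>l. prime l \<and> l \<le> Z \<and> l \<notin> Q \<longrightarrow> \<not> l dvd r)}"
  shows "real N * (sieve_G Q Z)\<^sup>2 \<le> real n / real L * sieve_G Q Z +
     (\<Sum>A\<in>sieve_sets Q Z. sig_set A / phi_set A)\<^sup>2"
proof -
  let ?D = "sieve_sets Q Z"
  let ?R = "{r\<in>{1..n}. [r = a] (mod L)}"
  let ?S = "{r\<in>{1..n}. [r = a] (mod L) \<and> (\<forall>l. prime l \<and> l \<le> Z \<and> l \<notin> Q \<longrightarrow> \<not> l dvd r)}"
  define \<psi> where "\<psi> = (\<lambda>A (r::nat). \<Prod>l\<in>A. 1 - (if l dvd r then real l else 0))"
  define F where "F r = (\<Sum>A\<in>?D. \<psi> A r / phi_set A)" for r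
  have D: "finite A" "\<And>l. l \<in> A \<Longrightarrow> prime l \<and> coprime L l" if "A \<in> ?D" for A
    using that cop by (auto simp: sieve_sets_def)
  have pos: "phi_set A > 0" if "A \<in> ?D" for A using D[OF that] phi_set_pos by blast
  have FG: "F r = sieve_G Q Z" if r: "r \<in> ?S" for r
    unfolding F_def sieve_G_def
  proof (rule sum.cong[OF refl])
    fix A assume A: "A \<in> ?D"
    have "\<psi> A r = 1" unfolding \<psi>_def
    proof (rule prod.neutral, rule ballI)
      fix l assume "l \<in> A"
      then have "\<not> l dvd r" using r A sieve_sets_elem_le[OF A] by (auto simp: sieve_sets_def)
      then show "1 - (if l dvd r then real l else 0) = 1" by simp
    qed
    then show "\<psi> A r / phi_set A = 1 / phi_set A" by simp
  qed
  have "real N * (sieve_G Q Z)\<^sup>2 = (\<Sum>r\<in>?S. (F r)\<^sup>2)" by (simp add: FG N_def)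
  \<comment> \<open>Squares are nonnegative, so the sum may be extended to the whole residue class,
    where the correlations are known.\<close>
  also have "\<dots> \<le> (\<Sum>r\<in>?R. (F r)\<^sup>2)" by (rule sum_mono2) auto
  also have "\<dots> = (\<Sum>r\<in>?R. \<Sum>A\<in>?D. \<Sum>B\<in>?D. \<psi> A r * \<psi> B r / (phi_set A * phi_set B))"
    unfolding F_def power2_eq_square sum_product by simp
  also have "\<dots> = (\<Sum>A\<in>?D. \<Sum>B\<in>?D. (\<Sum>r\<in>?R. \<psi> A r * \<psi> B r) / (phi_set A * phi_set B))"
    by (subst sum.swap, rule sum.cong[OF refl], subst sum.swap) (simp add: sum_divide_distrib)
  also have "\<dots> \<le> (\<Sum>A\<in>?D. \<Sum>B\<in>?D. ((if A = B then real n / real L * phi_set A else 0) + sig_set A * sig_set B) / (phi_set A * phi_set B))"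
  proof (intro sum_mono divide_right_mono)
    fix A B assume AB: "A \<in> ?D" "B \<in> ?D"
    show "(\<Sum>r\<in>?R. \<psi> A r * \<psi> B r) \<le> (if A = B then real n / real L * phi_set A else 0) + sig_set A * sig_set B"
      unfolding \<psi>_def by (rule prod_correlation_bound[OF L]) (use D AB in auto)
    show "0 \<le> phi_set A * phi_set B" using pos[OF AB(1)] pos[OF AB(2)] by simp
  qed
  also have "\<dots> = (\<Sum>A\<in>?D. \<Sum>B\<in>?D. if B = A then real n / real L * (1 / phi_set A) else 0) +
      (\<Sum>A\<in>?D. \<Sum>B\<in>?D. (sig_set A / phi_set A) * (sig_set B / phi_set B))"
    unfolding sum.distrib[symmetric]
  proof (intro sum.cong refl)
    fix A B assume "A \<in> ?D" "B \<in> ?D"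
    then show "((if A = B then real n / real L * phi_set A else 0) + sig_set A * sig_set B) / (phi_set A * phi_set B) =
      (if B = A then real n / real L * (1 / phi_set A) else 0) + sig_set A / phi_set A * (sig_set B / phi_set B)"
      using pos[of A] by (auto simp: add_divide_distrib)
  qed
  also have "\<dots> = real n / real L * sieve_G Q Z + (\<Sum>A\<in>?D. sig_set A / phi_set A)\<^sup>2"
    unfolding power2_eq_square sum_product sieve_G_def
    using finite_sieve_sets by (simp add: sum_distrib_left)
  finally show ?thesis .
qed

text \<open>The product is largest for the integers 2, 3, and so on, where it telescopes. A new
  maximum \<open>m\<close> is at least \<open>card A + 2\<close>, so its factor is at most
  \<open>(card A + 2) / (card A + 1)\<close>.\<close>

lemma prod_ratio_le_Suc_card:
  fixes A :: "nat set"
  assumes "finite A" "\<And>l. l \<in> A \<Longrightarrow> l \<ge> 2"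
  shows "(\<Prod>l\<in>A. real l / (real l - 1)) \<le> real (card A) + 1"
  using assms
proof (induction A rule: finite_linorder_max_induct)
  case (insert m A)
  have "A \<subseteq> {2..<m}" using insert by force
  then have "card A \<le> m - 2" using card_mono[of "{2..<m}" A] by simp
  then have m: "real m \<ge> real (card A) + 2" using insert.prems[of m] by simp
  have "(\<Prod>l\<in>insert m A. real l / (real l - 1)) = real m / (real m - 1) * (\<Prod>l\<in>A. real l / (real l - 1))"
    using insert by (subst prod.insert) auto
  also have "\<dots> \<le> real m / (real m - 1) * (real (card A) + 1)"
    using insert m by (intro mult_left_mono) auto
  also have "\<dots> \<le> real (card A) + 1 + 1"
    using m by (simp add: field_simps)
  also have "\<dots> = real (card (insert m A)) + 1" using insert by (subst card_insert_disjoint) auto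
  finally show ?case .
qed simp

text \<open>There are at most \<open>Z\<close> sets, each with at most \<open>log 2 Z\<close>
  elements. The factor at \<open>l\<close> is at most the square of \<open>l / (l - 1)\<close>, to
  which the telescoping bound applies.\<close>

lemma sieve_error_le:
  assumes Z: "Z \<ge> 1"
  shows "(\<Sum>A\<in>sieve_sets Q Z. sig_set A / phi_set A) \<le> real Z * (log 2 (real Z) + 1)\<^sup>2"
proof -
  have bnd: "sig_set A / phi_set A \<le> (log 2 (real Z) + 1)\<^sup>2" if A: "A \<in> sieve_sets Q Z" for A
  proof -
    have fA: "finite A" and pr: "\<And>l. l \<in> A \<Longrightarrow> prime l" and le: "\<Prod>A \<le> Z" using A by (auto simp: sieve_sets_def)
    have l2: "l \<ge> 2" if "l \<in> A" for l using prime_ge_2_nat[OF pr[OF that]] .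
    have "2 ^ card A = (\<Prod>l\<in>A. 2::nat)" by simp
    also have "\<dots> \<le> \<Prod>A" by (rule prod_mono) (use l2 in auto)
    finally have "2 ^ card A \<le> Z" using le by simp
    then have "2 ^ card A \<le> real Z" by (metis of_nat_le_iff of_nat_numeral of_nat_power)
    then have c: "real (card A) \<le> log 2 (real Z)" using Z by (simp add: le_log_iff powr_realpow)
    have "sig_set A / phi_set A = (\<Prod>l\<in>A. (real l + 1) / (real l - 1))"
      by (simp add: sig_set_def phi_set_def prod_dividef)
    also have "\<dots> \<le> (\<Prod>l\<in>A. (real l / (real l - 1))\<^sup>2)"
    proof (rule prod_mono)
      fix l assume "l \<in> A"
      then have "real l \<ge> 2" using l2 by fastforce
      then have "(real l + 1) * (real l - 1) \<le> (real l)\<^sup>2" "real l - 1 > 0"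
        by (auto simp: power2_eq_square algebra_simps)
      then have "(real l + 1) * (real l - 1) / (real l - 1)\<^sup>2 \<le> (real l)\<^sup>2 / (real l - 1)\<^sup>2" "real l - 1 > 0"
        by (auto intro: divide_right_mono)
      then show "0 \<le> (real l + 1) / (real l - 1) \<and> (real l + 1) / (real l - 1) \<le> (real l / (real l - 1))\<^sup>2"
        by (simp add: power_divide power2_eq_square)
    qed
    also have "\<dots> = (\<Prod>l\<in>A. real l / (real l - 1))\<^sup>2" by (simp add: prod_power_distrib)
    also have "\<dots> \<le> (real (card A) + 1)\<^sup>2"
    proof (rule power_mono[OF prod_ratio_le_Suc_card[OF fA l2]])
      show "0 \<le> (\<Prod>l\<in>A. real l / (real l - 1))"
        by (rule prod_nonneg) (use l2 in \<open>force intro!: divide_nonneg_nonneg\<close>)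
    qed auto
    also have "\<dots> \<le> (log 2 (real Z) + 1)\<^sup>2" using c by (intro power_mono) auto
    finally show ?thesis .
  qed
  have "inj_on Prod (sieve_sets Q Z)"
  proof (rule inj_onI)
    fix A B assume AB: "A \<in> sieve_sets Q Z" "B \<in> sieve_sets Q Z" "\<Prod>A = \<Prod>B"
    have pf: "prime_factors (\<Prod>C) = C" if "C \<in> sieve_sets Q Z" for C
    proof -
      have "0 \<notin> C" "finite C" using that by (auto simp: sieve_sets_def)
      then show ?thesis using that prime_factors_prod[of C "\<lambda>x. x"]
        by (auto simp: sieve_sets_def prime_factorization_prime)
    qed
    show "A = B" using pf AB by metis
  qed
  moreover have "Prod ` sieve_sets Q Z \<subseteq> {1..Z}"
    by (auto simp: sieve_sets_def Suc_le_eq intro!: prod_pos prime_gt_0_nat)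
  ultimately have "card (sieve_sets Q Z) \<le> Z"
    using card_inj_on_le[of Prod "sieve_sets Q Z" "{1..Z}"] by simp
  moreover have "(\<Sum>A\<in>sieve_sets Q Z. sig_set A / phi_set A) \<le> real (card (sieve_sets Q Z)) * (log 2 (real Z) + 1)\<^sup>2"
    by (rule sum_bounded_above[OF bnd])
  ultimately show ?thesis by (meson mult_right_mono of_nat_le_iff order_trans zero_le_power2)
qed

text \<open>By geometric series, \<open>1 / phi_set A\<close> is the sum of \<open>1 / m\<close>
  over all \<open>m\<close> whose set of prime factors is \<open>A\<close>, and every
  \<open>m\<close> up to \<open>Z\<close> has its radical up to \<open>Z\<close>.\<close>

lemma sum_inverse_le_sieve_G:
  assumes Z: "Z \<ge> 1"
  shows "(\<Sum>m=1..Z. 1 / real m) \<le> sieve_G {} Z"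
proof -
  have pf: "prime_factors m \<in> sieve_sets {} Z" if m: "m \<in> {1..Z}" for m
  proof -
    have "\<Prod>(prime_factors m) dvd m"
      using m by (subst prod_primes_dvd_iff) auto
    then have "\<Prod>(prime_factors m) \<le> m" using m by (intro dvd_imp_le) auto
    then show ?thesis using m by (auto simp: sieve_sets_def)
  qed
  have bnd: "(\<Sum>m | m \<in> {1..Z} \<and> prime_factors m = A. 1 / real m) \<le> 1 / phi_set A"
    if A: "A \<in> sieve_sets {} Z" for A
  proof -
    let ?M = "{m. m \<in> {1..Z} \<and> prime_factors m = A}"
    have fA: "finite A" and pr: "\<And>l. l \<in> A \<Longrightarrow> prime l" using A by (auto simp: sieve_sets_def)
    define e where "e m = restrict (\<lambda>l. multiplicity l m) A" for m
    have prodm: "(\<Prod>l\<in>A. l ^ e m l) = m" if "m \<in> ?M" for m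
    proof -
      have "(\<Prod>l\<in>A. l ^ e m l) = (\<Prod>l\<in>A. l ^ multiplicity l m)"
        by (rule prod.cong) (auto simp: e_def)
      then show ?thesis using that prod_prime_factors[of m] by simp
    qed
    have inj: "inj_on e ?M" by (rule inj_onI) (metis prodm)
    have eP: "e m \<in> PiE A (\<lambda>_. {1..Z})" if m: "m \<in> ?M" for m
    proof (rule PiE_I)
      fix l assume l: "l \<in> A"
      have "multiplicity l m > 0" using l m by (auto simp: prime_factors_multiplicity)
      moreover have "multiplicity l m \<le> Z"
      proof -
        have "l ^ multiplicity l m \<le> m" using m by (intro dvd_imp_le multiplicity_dvd) auto
        moreover have "multiplicity l m < l ^ multiplicity l m"
          using prime_ge_2_nat[OF pr[OF l]] by (intro power_gt_expt) auto
        ultimately show ?thesis using m by auto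
      qed
      ultimately show "e m l \<in> {1..Z}" using l by (simp add: e_def)
    qed (simp add: e_def)
    have "(\<Sum>m\<in>?M. 1 / real m) = (\<Sum>m\<in>?M. \<Prod>l\<in>A. (1 / real l) ^ e m l)"
    proof (rule sum.cong[OF refl])
      fix m assume "m \<in> ?M"
      then have "real (\<Prod>l\<in>A. l ^ e m l) = real m" using prodm[of m] by simp
      then have "real m = (\<Prod>l\<in>A. real l ^ e m l)" by simp
      then show "1 / real m = (\<Prod>l\<in>A. (1 / real l) ^ e m l)"
        by (simp add: power_divide prod_dividef)
    qed
    also have "\<dots> = (\<Sum>f\<in>e ` ?M. \<Prod>l\<in>A. (1 / real l) ^ f l)"
      by (subst sum.reindex[OF inj]) (simp add: o_def)
    also have "\<dots> \<le> (\<Sum>f\<in>PiE A (\<lambda>_. {1..Z}). \<Prod>l\<in>A. (1 / real l) ^ f l)"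
    proof (rule sum_mono2)
      show "finite (PiE A (\<lambda>_. {1..Z}))" using fA by (intro finite_PiE) auto
      show "e ` ?M \<subseteq> PiE A (\<lambda>_. {1..Z})" using eP by blast
    qed (intro prod_nonneg, simp)
    also have "\<dots> = (\<Prod>l\<in>A. \<Sum>j=1..Z. (1 / real l) ^ j)"
      by (rule prod_sum_PiE[symmetric]) (use fA in auto)
    also have "\<dots> \<le> (\<Prod>l\<in>A. 1 / (real l - 1))"
    proof (rule prod_mono)
      fix l assume l: "l \<in> A"
      then have l2: "real l \<ge> 2" using prime_ge_2_nat[OF pr] by fastforce
      define x where "x = 1 / real l"
      have x: "0 < x" "x < 1" using l2 by (auto simp: x_def)
      have "(\<Sum>j=1..Z. x ^ j) = x * (\<Sum>j<Z. x ^ j)"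
        unfolding sum_distrib_left by (rule sum.reindex_bij_witness[of _ Suc "\<lambda>j. j - 1"]) (auto simp flip: power_Suc)
      also have "(\<Sum>j<Z. x ^ j) = (1 - x ^ Z) / (1 - x)" using x by (subst sum_gp_strict) auto
      also have "x * ((1 - x ^ Z) / (1 - x)) \<le> x * (1 / (1 - x))"
        using x by (intro mult_left_mono divide_right_mono) auto
      also have "\<dots> = 1 / (real l - 1)" using l2 by (simp add: x_def field_simps)
      finally show "0 \<le> (\<Sum>j=1..Z. (1 / real l) ^ j) \<and> (\<Sum>j=1..Z. (1 / real l) ^ j) \<le> 1 / (real l - 1)"
        using x by (auto simp: x_def intro!: sum_nonneg)
    qed
    also have "\<dots> = 1 / phi_set A" by (simp add: phi_set_def prod_dividef)
    finally show ?thesis .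
  qed
  have "(\<Sum>m=1..Z. 1 / real m) = (\<Sum>A\<in>sieve_sets {} Z. \<Sum>m | m \<in> {1..Z} \<and> prime_factors m = A. 1 / real m)"
    by (rule sum.group[symmetric]) (use pf finite_sieve_sets in auto)
  also have "\<dots> \<le> sieve_G {} Z" unfolding sieve_G_def by (rule sum_mono[OF bnd])
  finally show ?thesis .
qed

lemma sieve_G_ge_1:
  assumes "Z \<ge> 1" shows "sieve_G Q Z \<ge> 1"
proof -
  have "{} \<in> sieve_sets Q Z" using assms by (simp add: sieve_sets_def)
  moreover have "0 \<le> 1 / phi_set A" if "A \<in> sieve_sets Q Z" for A
    using phi_set_pos[of A] that by (simp add: sieve_sets_def less_imp_le)
  ultimately have "(\<Sum>A\<in>{{}}. 1 / phi_set A) \<le> sieve_G Q Z" unfolding sieve_G_def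
    by (intro sum_mono2[OF finite_sieve_sets]) simp_all
  then show ?thesis by (simp add: phi_set_def)
qed

text \<open>Each \<open>A\<close> splits into its parts inside and outside \<open>Q\<close>. The
  loss \<open>l / (l - 1)\<close> per prime is what later turns the modulus of a progression into
  its Euler function.\<close>

lemma sieve_G_remove_primes:
  assumes Q: "finite Q" "\<And>l. l \<in> Q \<Longrightarrow> prime l"
  shows "sieve_G {} Z \<le> (\<Prod>l\<in>Q. real l / (real l - 1)) * sieve_G Q Z"
proof -
  let ?f = "\<lambda>A. (A \<inter> Q, A - Q)"
  have inj: "inj_on ?f (sieve_sets {} Z)" by (rule inj_onI) auto
  have sub: "?f ` sieve_sets {} Z \<subseteq> Pow Q \<times> sieve_sets Q Z"
  proof
    fix w assume "w \<in> ?f ` sieve_sets {} Z"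
    then obtain A where A: "A \<in> sieve_sets {} Z" "w = ?f A" by blast
    have "\<Prod>(A - Q) dvd \<Prod>A" using A by (intro prod_dvd_prod_subset) (auto simp: sieve_sets_def)
    then have "\<Prod>(A - Q) \<le> \<Prod>A"
      using A by (intro dvd_imp_le) (auto simp: sieve_sets_def intro!: prod_pos prime_gt_0_nat)
    then show "w \<in> Pow Q \<times> sieve_sets Q Z" using A by (auto simp: sieve_sets_def)
  qed
  have "sieve_G {} Z = (\<Sum>A\<in>sieve_sets {} Z. (case ?f A of (B, C) \<Rightarrow> 1 / phi_set B * (1 / phi_set C)))"
    unfolding sieve_G_def
  proof (rule sum.cong[OF refl])
    fix A assume A: "A \<in> sieve_sets {} Z"
    then have "phi_set A = phi_set (A \<inter> Q) * phi_set (A - Q)"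
      unfolding phi_set_def by (subst prod.union_disjoint[symmetric]) (auto simp: sieve_sets_def Int_Diff_Un)
    then show "1 / phi_set A = (case ?f A of (B, C) \<Rightarrow> 1 / phi_set B * (1 / phi_set C))" by simp
  qed
  also have "\<dots> = (\<Sum>(B, C)\<in>?f ` sieve_sets {} Z. 1 / phi_set B * (1 / phi_set C))"
    by (subst sum.reindex[OF inj]) (simp add: o_def)
  also have "\<dots> \<le> (\<Sum>(B, C)\<in>Pow Q \<times> sieve_sets Q Z. 1 / phi_set B * (1 / phi_set C))"
  proof (rule sum_mono2[OF _ sub])
    show "finite (Pow Q \<times> sieve_sets Q Z)" using Q finite_sieve_sets by simp
    fix w assume "w \<in> Pow Q \<times> sieve_sets Q Z - ?f ` sieve_sets {} Z"
    then obtain B C where w: "w = (B, C)" "B \<subseteq> Q" "C \<in> sieve_sets Q Z" by auto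
    have "phi_set B > 0" "phi_set C > 0" using w Q by (auto simp: sieve_sets_def intro!: phi_set_pos)
    then show "0 \<le> (case w of (B, C) \<Rightarrow> 1 / phi_set B * (1 / phi_set C))" using w by simp
  qed
  also have "\<dots> = (\<Sum>B\<in>Pow Q. 1 / phi_set B) * sieve_G Q Z"
    by (simp add: sum.cartesian_product[symmetric] sieve_G_def sum_product)
  also have "(\<Sum>B\<in>Pow Q. 1 / phi_set B) = (\<Prod>l\<in>Q. 1 / (real l - 1) + 1)"
    unfolding prod_add[OF Q(1)] by (simp add: phi_set_def prod_dividef)
  also have "\<dots> = (\<Prod>l\<in>Q. real l / (real l - 1))"
  proof (rule prod.cong[OF refl])
    fix l assume "l \<in> Q"
    then have "real l > 1" using prime_gt_1_nat[OF Q(2)] by simp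
    then show "1 / (real l - 1) + 1 = real l / (real l - 1)" by (simp add: field_simps)
  qed
  finally show ?thesis .
qed

section \<open>Estimates for primes\<close>

text \<open>Legendre's formula: the logarithm of each factor is a sum over its divisors, and
  \<open>n div d\<close> counts the multiples of \<open>d\<close>.\<close>

lemma ln_fact_mangoldt: "ln (fact n) = (\<Sum>d=1..n. (mangoldt d :: real) * real (n div d))"
proof -
  have "ln (fact n :: real) = (\<Sum>k=1..n. ln (real k))"
    by (simp add: fact_prod, subst ln_prod) auto
  also have "\<dots> = (\<Sum>k=1..n. \<Sum>d | d dvd k. mangoldt d)"
    by (rule sum.cong) (simp_all add: mangoldt_sum)
  also have "\<dots> = (\<Sum>k=1..n. \<Sum>d=1..n. if d dvd k then mangoldt d else 0)"
  proof (rule sum.cong[OF refl])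
    fix k assume k: "k \<in> {1..n}"
    have "{d. d dvd k} = {d\<in>{1..n}. d dvd k}"
      using k by (auto dest: dvd_imp_le intro: Nat.gr0I)
    then have "(\<Sum>d | d dvd k. mangoldt d :: real) = (\<Sum>d\<in>{d\<in>{1..n}. d dvd k}. mangoldt d)" by simp
    also have "\<dots> = (\<Sum>d=1..n. if d dvd k then mangoldt d else 0)"
      by (rule sum.inter_filter) simp
    finally show "(\<Sum>d | d dvd k. mangoldt d :: real) = (\<Sum>d=1..n. if d dvd k then mangoldt d else 0)" .
  qed
  also have "\<dots> = (\<Sum>d=1..n. \<Sum>k=1..n. if d dvd k then mangoldt d else 0)" by (rule sum.swap)
  also have "\<dots> = (\<Sum>d=1..n. mangoldt d * real (n div d))"
  proof (rule sum.cong[OF refl])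
    fix d assume d: "d \<in> {1..n}"
    have "card {k\<in>{1..n}. d dvd k} = n div d"
    proof -
      have "{k\<in>{1..n}. d dvd k} = (\<lambda>j. d * j) ` {1..n div d}"
      proof (intro equalityI subsetI)
        fix k assume "k \<in> {k\<in>{1..n}. d dvd k}"
        then obtain j where j: "k = d * j" "1 \<le> k" "k \<le> n" by auto
        then have "j \<ge> 1" by (cases j) auto
        moreover have "j \<le> n div d" using j d by (simp add: less_eq_div_iff_mult_less_eq mult.commute)
        ultimately show "k \<in> (\<lambda>j. d * j) ` {1..n div d}" using j by auto
      next
        fix k assume "k \<in> (\<lambda>j. d * j) ` {1..n div d}"
        then obtain j where "k = d * j" "j \<in> {1..n div d}" by blast
        then have j: "k = d * j" "1 \<le> j" "j \<le> n div d" by auto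
        then have "k \<le> n" using d by (simp add: less_eq_div_iff_mult_less_eq mult.commute)
        then show "k \<in> {k\<in>{1..n}. d dvd k}" using j d by auto
      qed
      moreover have "inj_on (\<lambda>j. d * j) {1..n div d}" using d by (auto simp: inj_on_def)
      ultimately show ?thesis by (simp add: card_image)
    qed
    moreover have "(\<Sum>k=1..n. if d dvd k then mangoldt d else (0::real)) = (\<Sum>k\<in>{k\<in>{1..n}. d dvd k}. mangoldt d)"
      by (rule sum.inter_filter[symmetric]) simp
    ultimately show "(\<Sum>k=1..n. if d dvd k then mangoldt d else 0) = (mangoldt d :: real) * real (n div d)"
      by simp
  qed
  finally show ?thesis .
qed

text \<open>The number of powers of \<open>p\<close> up to \<open>n\<close> is at most the logarithm
  of \<open>n\<close> to base \<open>p\<close>, so each prime contributes at most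
  \<open>ln n\<close> in total.\<close>

lemma sum_mangoldt_le:
  assumes n: "n \<ge> 1"
  shows "(\<Sum>d=1..n. mangoldt d :: real) \<le> real (card {p. prime p \<and> p \<le> n}) * ln (real n)"
proof -
  let ?P = "{p. prime p \<and> p \<le> n}"
  have fP: "finite ?P" by (rule finite_subset[of _ "{..n}"]) auto
  let ?D = "{d\<in>{1..n}. primepow d}"
  have ap: "aprimedivisor d \<in> ?P" if "d \<in> ?D" for d
  proof -
    have "d > 1" using that primepow_gt_Suc_0[of d] by simp
    then have "prime (aprimedivisor d)" "aprimedivisor d dvd d"
      by (auto intro!: prime_aprimedivisor' aprimedivisor_dvd')
    then show ?thesis using that dvd_imp_le[of "aprimedivisor d" d] by auto
  qed
  have "(\<Sum>d=1..n. mangoldt d :: real) = (\<Sum>d\<in>?D. ln (real (aprimedivisor d)))"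
    by (rule sum.mono_neutral_cong_right) (auto simp: mangoldt_def)
  also have "\<dots> = (\<Sum>p\<in>?P. \<Sum>d | d \<in> ?D \<and> aprimedivisor d = p. ln (real (aprimedivisor d)))"
    by (rule sum.group[symmetric]) (use fP ap in auto)
  also have "\<dots> \<le> (\<Sum>p\<in>?P. ln (real n))"
  proof (rule sum_mono)
    fix p assume p: "p \<in> ?P"
    then have pr: "prime p" and p2: "p \<ge> 2" using prime_ge_2_nat by auto
    define K where "K = nat \<lfloor>log (real p) (real n)\<rfloor>"
    have "{d. d \<in> ?D \<and> aprimedivisor d = p} \<subseteq> (\<lambda>k. p ^ k) ` {1..K}"
    proof
      fix d assume d: "d \<in> {d. d \<in> ?D \<and> aprimedivisor d = p}"
      then obtain p' k where pk: "prime p'" "k > 0" "d = p' ^ k"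
        by (auto simp: primepow_def)
      then have k: "d = p ^ k" "k > 0" using d aprimedivisor_prime_power[of p' k] by auto
      have "real p ^ k \<le> real n" using d k by (simp flip: of_nat_power)
      then have "real k \<le> log (real p) (real n)"
        using p2 n by (simp add: le_log_iff powr_realpow)
      then have "k \<le> K" unfolding K_def by linarith
      then show "d \<in> (\<lambda>k. p ^ k) ` {1..K}" using k by auto
    qed
    then have "card {d. d \<in> ?D \<and> aprimedivisor d = p} \<le> K"
      using surj_card_le[of "{1..K}"] by simp
    then have "(\<Sum>d | d \<in> ?D \<and> aprimedivisor d = p. ln (real (aprimedivisor d))) \<le> real K * ln (real p)"
      using p2 by (simp add: mult_right_mono)
    also have "\<dots> \<le> log (real p) (real n) * ln (real p)"
    proof (rule mult_right_mono)
      have "log (real p) (real n) \<ge> 0" using p2 n by (simp add: zero_le_log_cancel_iff)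
      then show "real K \<le> log (real p) (real n)" unfolding K_def by linarith
    qed (use p2 in simp)
    also have "\<dots> = ln (real n)" using p2 by (simp add: log_def)
    finally show "(\<Sum>d | d \<in> ?D \<and> aprimedivisor d = p. ln (real (aprimedivisor d))) \<le> ln (real n)" .
  qed
  finally show ?thesis by simp
qed

text \<open>The central binomial coefficient is nearly \<open>4 ^ m\<close>, while in its logarithm
  every von Mangoldt weight has coefficient at most 1.\<close>

theorem chebyshev_lower:
  assumes n: "n \<ge> 2"
  shows "real (card {p. prime p \<and> p \<le> n}) * ln (real n) \<ge> (real n - 1) * ln 2 - ln (real n)"
proof -
  define m where "m = n div 2"
  have m: "m > 0" "2 * m \<le> n" "n \<le> 2 * m + 1" using n by (auto simp: m_def)
  have "ln (4 ^ m / (2 * real m)) \<le> ln (real (2 * m choose m))"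
    using central_binomial_lower_bound[OF m(1)] m(1) by (intro ln_mono) auto
  then have 1: "real m * ln 4 - ln (2 * real m) \<le> ln (real (2 * m choose m))"
    using m(1) by (simp add: ln_div ln_realpow)
  have "real (2 * m choose m) = fact (2 * m) / (fact m * fact m)"
    by (subst binomial_fact) (auto simp: mult_2)
  then have "ln (real (2 * m choose m)) = ln (fact (2 * m)) - 2 * ln (fact m)"
    by (simp add: ln_div ln_mult)
  also have "ln (fact m) = (\<Sum>d=1..2*m. (mangoldt d :: real) * real (m div d))"
    unfolding ln_fact_mangoldt by (rule sum.mono_neutral_left) auto
  also have "ln (fact (2 * m)) - 2 * (\<Sum>d=1..2*m. (mangoldt d :: real) * real (m div d)) =
      (\<Sum>d=1..2*m. mangoldt d * (real (2 * m div d) - 2 * real (m div d)))"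
    unfolding ln_fact_mangoldt sum_distrib_left sum_subtractf[symmetric]
    by (rule sum.cong) (auto simp: algebra_simps)
  also have "\<dots> \<le> (\<Sum>d=1..2*m. mangoldt d * 1)"
  proof (intro sum_mono mult_left_mono mangoldt_nonneg)
    fix d assume d: "d \<in> {1..2*m}"
    have "2 * m div d \<le> 2 * (m div d) + 1"
    proof -
      have "m < d * (m div d) + d" using d dividend_less_times_div[of d m] by auto
      then have "2 * m < d * (2 * (m div d) + 2)" by (simp add: algebra_simps)
      then have "2 * m div d < 2 * (m div d) + 2" using d by (simp add: div_less_iff_less_mult mult.commute)
      then show ?thesis by simp
    qed
    then show "real (2 * m div d) - 2 * real (m div d) \<le> 1" by linarith
  qed
  also have "\<dots> \<le> (\<Sum>d=1..n. mangoldt d)"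
    using m by (simp, intro sum_mono2) (auto simp: mangoldt_nonneg)
  also have "\<dots> \<le> real (card {p. prime p \<and> p \<le> n}) * ln (real n)"
    using n by (intro sum_mangoldt_le) simp
  finally have 2: "ln (real (2 * m choose m)) \<le> real (card {p. prime p \<and> p \<le> n}) * ln (real n)" .
  have "ln (2 * real m) \<le> ln (real n)" using m by (intro ln_mono) auto
  moreover have "real m * ln 4 \<ge> (real n - 1) * ln 2"
  proof -
    have "ln 4 = 2 * ln (2::real)" using ln_realpow[of 2 2] by simp
    moreover have "(real n - 1) * ln 2 \<le> (2 * real m) * ln 2" using m by (intro mult_right_mono) auto
    ultimately show ?thesis by simp
  qed
  ultimately show ?thesis using 1 2 by linarith
qed

text \<open>A convergent majorant for the difference between the Mertens sums with denominators
  \<open>q - 1\<close> and \<open>q\<close>.\<close>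

definition prime_const :: real where "prime_const = (\<Sum>k. 4 * real k powr (-3/2))"

text \<open>Legendre's formula is applied at \<open>Y * K\<close> instead of \<open>Y\<close>.
  Rounding \<open>N / q\<close> costs at most \<open>ln Y\<close> for each of at most
  \<open>Y\<close> primes, altogether at most \<open>N\<close>, hence 1 after division by
  \<open>N\<close>. The price is only \<open>ln K\<close>.\<close>

theorem mertens_upper:
  assumes Y: "Y \<ge> 2" and K: "real K \<ge> ln (real Y)" "K \<ge> 1"
  shows "(\<Sum>q | prime q \<and> q \<le> Y. ln (real q) / (real q - 1)) \<le> ln (real Y) + ln (real K) + 1 + prime_const"
proof -
  let ?P = "{q. prime q \<and> q \<le> Y}"
  have fP: "finite ?P" by (rule finite_subset[of _ "{..Y}"]) auto
  define N where "N = Y * K"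
  have N: "N \<ge> Y" "N > 0" using K Y by (auto simp: N_def)
  have q2: "real q \<ge> 2" if "q \<in> ?P" for q using that prime_ge_2_nat[of q] by auto
  have "real N * (\<Sum>q\<in>?P. ln (real q) / real q) = (\<Sum>q\<in>?P. ln (real q) * (real N / real q))"
    by (simp add: sum_distrib_left mult.commute)
  also have "\<dots> \<le> (\<Sum>q\<in>?P. ln (real q) * real (N div q) + ln (real Y))"
  proof (rule sum_mono)
    fix q assume q: "q \<in> ?P"
    have "real N = real (N div q) * real q + real (N mod q)"
      by (metis div_mult_mod_eq of_nat_add of_nat_mult)
    moreover have "real (N mod q) \<le> real q" using q2[OF q] by (simp add: less_imp_le)
    ultimately have "real N / real q \<le> real (N div q) + 1" using q2[OF q] by (simp add: field_simps)
    then have "ln (real q) * (real N / real q) \<le> ln (real q) * (real (N div q) + 1)"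
      using q2[OF q] by (intro mult_left_mono) auto
    also have "\<dots> = ln (real q) * real (N div q) + ln (real q)" by (simp add: algebra_simps)
    finally have "ln (real q) * (real N / real q) \<le> ln (real q) * real (N div q) + ln (real q)" .
    moreover have "ln (real q) \<le> ln (real Y)" using q q2[OF q] by (intro ln_mono) auto
    ultimately show "ln (real q) * (real N / real q) \<le> ln (real q) * real (N div q) + ln (real Y)"
      by linarith
  qed
  also have "\<dots> = (\<Sum>q\<in>?P. mangoldt q * real (N div q)) + real (card ?P) * ln (real Y)"
    by (simp add: sum.distrib)
  also have "(\<Sum>q\<in>?P. mangoldt q * real (N div q)) \<le> (\<Sum>d=1..N. mangoldt d * real (N div d))"
  proof (rule sum_mono2)
    show "?P \<subseteq> {1..N}"
    proof
      fix q assume "q \<in> ?P"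
      then show "q \<in> {1..N}" using N q2[of q] by simp
    qed
  qed (simp_all add: mangoldt_nonneg)
  also have "\<dots> = ln (fact N)" by (simp add: ln_fact_mangoldt)
  also have "ln (fact N) \<le> real N * ln (real N)"
  proof -
    have "(fact N :: real) \<le> real N ^ N" using fact_le_power[of N, where 'a=real] by simp
    then have "ln (fact N :: real) \<le> ln (real N ^ N)" using N by (intro ln_mono) auto
    then show ?thesis using N by (simp add: ln_realpow)
  qed
  also have "real (card ?P) * ln (real Y) \<le> real Y * real K"
  proof (rule mult_mono)
    have "?P \<subseteq> {1..Y}" using prime_ge_1_nat by auto
    then have "card ?P \<le> Y" using card_mono[of "{1..Y}" ?P] by simp
    then show "real (card ?P) \<le> real Y" by simp
  qed (use K Y in auto)
  finally have "real N * (\<Sum>q\<in>?P. ln (real q) / real q) \<le> real N * (ln (real N) + 1)"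
    by (simp add: N_def algebra_simps)
  then have 1: "(\<Sum>q\<in>?P. ln (real q) / real q) \<le> ln (real N) + 1" using N by simp
  have "ln (real N) = ln (real Y) + ln (real K)" using Y K by (simp add: N_def ln_mult)
  moreover have "(\<Sum>q\<in>?P. ln (real q) / (real q * (real q - 1))) \<le> prime_const"
  proof -
    have sm: "summable (\<lambda>k. 4 * real k powr (-3/2))"
      by (intro summable_mult) (simp add: summable_real_powr_iff)
    have "(\<Sum>q\<in>?P. ln (real q) / (real q * (real q - 1))) \<le> (\<Sum>q\<in>?P. 4 * real q powr (-3/2))"
    proof (rule sum_mono)
      fix q assume q: "q \<in> ?P"
      let ?q = "real q"
      \<comment> \<open>This gives \<open>ln q \<le> 2 * sqrt q\<close>; with
        \<open>q - 1 \<ge> q / 2\<close> it is the origin of the constant 4 and the exponent 3/2 in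
        \<open>prime_const\<close>.\<close>
      have "ln (sqrt ?q) \<le> sqrt ?q" using q2[OF q] by (intro order_trans[OF ln_le_minus_one]) auto
      then have a: "ln ?q \<le> 2 * sqrt ?q" using q2[OF q] by (simp add: ln_sqrt)
      have "ln ?q / (?q * (?q - 1)) \<le> 2 * sqrt ?q / (?q * (?q / 2))"
        using q2[OF q] a by (intro frac_le mult_left_mono) auto
      also have "\<dots> = 4 * (sqrt ?q / (?q * ?q))" by simp
      also have "sqrt ?q / (?q * ?q) = ?q powr (1/2) / (?q powr 1 * ?q powr 1)"
        using q2[OF q] by (simp add: powr_half_sqrt)
      also have "\<dots> = ?q powr (1/2) / ?q powr 2" by (simp add: power2_eq_square)
      also have "\<dots> = ?q powr (-3/2)" by (subst powr_diff[symmetric]) simp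
      finally show "ln ?q / (?q * (?q - 1)) \<le> 4 * ?q powr (-3/2)" .
    qed
    also have "\<dots> \<le> prime_const" unfolding prime_const_def
      by (rule sum_le_suminf[OF sm fP]) auto
    finally show ?thesis .
  qed
  moreover have "(\<Sum>q\<in>?P. ln (real q) / (real q - 1)) =
      (\<Sum>q\<in>?P. ln (real q) / real q) + (\<Sum>q\<in>?P. ln (real q) / (real q * (real q - 1)))"
    unfolding sum.distrib[symmetric]
  proof (rule sum.cong[OF refl])
    fix q assume "q \<in> ?P"
    then have "real q \<noteq> 0" "real q - 1 \<noteq> 0" using q2[of q] by auto
    then show "ln (real q) / (real q - 1) = ln (real q) / real q + ln (real q) / (real q * (real q - 1))"
      by (simp add: divide_simps) (simp add: algebra_simps)
  qed
  ultimately show ?thesis using 1 by linarith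
qed

text \<open>Primes above \<open>Z\<close> survive a sieve by the primes up to \<open>Z\<close>.
  Leaving \<open>q1\<close> and \<open>q2\<close> out of the sieve makes it coprime to the modulus
  and puts Euler's function of \<open>q1 * q2\<close> into the main term.\<close>

lemma brun_titchmarsh_two_primes:
  fixes n a q1 q2 Z :: nat
  assumes q: "prime q1" "prime q2" "q1 \<noteq> q2" and Z: "Z \<ge> 2"
  shows "real (card {r\<in>{1..n}. prime r \<and> Z < r \<and> [r = a] (mod (q1 * q2))})
    \<le> real n / ((real q1 - 1) * (real q2 - 1) * ln (real Z)) + (real Z * (log 2 (real Z) + 1)\<^sup>2)\<^sup>2"
proof -
  define Q where "Q = {q1, q2}"
  let ?L = "q1 * q2"
  let ?G = "sieve_G Q Z"
  define N where "N = card {r\<in>{1..n}. [r = a] (mod ?L) \<and> (\<forall>l. prime l \<and> l \<le> Z \<and> l \<notin> Q \<longrightarrow> \<not> l dvd r)}"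
  let ?E = "(\<Sum>A\<in>sieve_sets Q Z. sig_set A / phi_set A)"
  have gt1: "real q1 > 1" "real q2 > 1" using q prime_gt_1_nat by auto
  have L: "?L > 0" using q prime_gt_0_nat by auto
  have sv: "real N * ?G\<^sup>2 \<le> real n / real ?L * ?G + ?E\<^sup>2"
    unfolding N_def
    by (rule selberg_sieve[OF L]) (use q in \<open>auto simp: Q_def intro: primes_coprime\<close>)
  have "card {r\<in>{1..n}. prime r \<and> Z < r \<and> [r = a] (mod ?L)} \<le> N"
    unfolding N_def
  proof (rule card_mono)
    show "{r\<in>{1..n}. prime r \<and> Z < r \<and> [r = a] (mod ?L)} \<subseteq>
      {r\<in>{1..n}. [r = a] (mod ?L) \<and> (\<forall>l. prime l \<and> l \<le> Z \<and> l \<notin> Q \<longrightarrow> \<not> l dvd r)}"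
    proof (rule subsetI)
      fix r assume r: "r \<in> {r\<in>{1..n}. prime r \<and> Z < r \<and> [r = a] (mod ?L)}"
      have "\<not> l dvd r" if "prime l" "l \<le> Z" for l
        using r that primes_dvd_imp_eq[of l r] by auto
      then show "r \<in> {r\<in>{1..n}. [r = a] (mod ?L) \<and> (\<forall>l. prime l \<and> l \<le> Z \<and> l \<notin> Q \<longrightarrow> \<not> l dvd r)}"
        using r by auto
    qed
  qed simp
  then have cN: "real (card {r\<in>{1..n}. prime r \<and> Z < r \<and> [r = a] (mod ?L)}) \<le> real N" by simp
  have G1: "?G \<ge> 1" using Z by (intro sieve_G_ge_1) simp
  have lnZ: "ln (real Z) > 0" using Z by simp
  have "ln (real Z) \<le> ln (real Z + 1)" using Z by simp
  also have "\<dots> \<le> harm Z" by (rule harm_ge_ln)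
  also have "harm Z = (\<Sum>m=1..Z. 1 / real m)" by (simp add: harm_def inverse_eq_divide)
  also have "\<dots> \<le> sieve_G {} Z" using Z by (intro sum_inverse_le_sieve_G) simp
  also have "\<dots> \<le> (\<Prod>l\<in>Q. real l / (real l - 1)) * ?G"
    by (rule sieve_G_remove_primes) (use q in \<open>auto simp: Q_def\<close>)
  also have "(\<Prod>l\<in>Q. real l / (real l - 1)) = real q1 * real q2 / ((real q1 - 1) * (real q2 - 1))"
    using q by (simp add: Q_def)
  finally have "ln (real Z) \<le> (real q1 * real q2 * ?G) / ((real q1 - 1) * (real q2 - 1))" by simp
  then have G: "ln (real Z) * ((real q1 - 1) * (real q2 - 1)) \<le> real q1 * real q2 * ?G"
    using gt1 by (subst (asm) pos_le_divide_eq) auto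
  have E0: "?E \<ge> 0"
  proof (rule sum_nonneg)
    fix A assume "A \<in> sieve_sets Q Z"
    then have "phi_set A > 0" by (intro phi_set_pos) (auto simp: sieve_sets_def)
    moreover have "sig_set A \<ge> 0" by (auto simp: sig_set_def intro: prod_nonneg)
    ultimately show "0 \<le> sig_set A / phi_set A" by simp
  qed
  have "real N = real N * ?G\<^sup>2 / ?G\<^sup>2" using G1 by simp
  also have "\<dots> \<le> (real n / real ?L * ?G + ?E\<^sup>2) / ?G\<^sup>2" using sv by (intro divide_right_mono) auto
  also have "\<dots> = real n / (real ?L * ?G) + ?E\<^sup>2 / ?G\<^sup>2"
    using G1 by (simp add: add_divide_distrib power2_eq_square)
  also have "?E\<^sup>2 / ?G\<^sup>2 \<le> ?E\<^sup>2 / 1" using G1 by (intro divide_left_mono) (auto simp: one_le_power)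
  also have "?E\<^sup>2 / 1 \<le> (real Z * (log 2 (real Z) + 1)\<^sup>2)\<^sup>2"
    using sieve_error_le[of Z Q] Z E0 by (simp add: power_mono)
  also have "real n / (real ?L * ?G) \<le> real n / ((real q1 - 1) * (real q2 - 1) * ln (real Z))"
    using G gt1 lnZ by (intro divide_left_mono mult_pos_pos) (auto simp: algebra_simps intro: order_less_le_trans[OF _ G1])
  finally show ?thesis using cN by simp
qed

text \<open>\<open>m\<close> is a square \<open>s^2\<close> times a number \<open>t\<close> dividing
  the radical. The sum sees each prime factor only once, so the square part has to be controlled
  separately.\<close>

lemma ln_le_sum_ln_prime_factors:
  fixes m S :: nat
  assumes m: "m > 0" and S: "\<And>s. s\<^sup>2 dvd m \<Longrightarrow> s \<le> S"
  shows "ln (real m) - 2 * ln (real S) \<le> (\<Sum>q\<in>prime_factors m. ln (real q))"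
proof -
  define s where "s = (\<Prod>q\<in>prime_factors m. q ^ (multiplicity q m div 2))"
  define t where "t = (\<Prod>q\<in>prime_factors m. q ^ (multiplicity q m mod 2))"
  have st: "m = s\<^sup>2 * t"
  proof -
    have "m = (\<Prod>q\<in>prime_factors m. q ^ multiplicity q m)" using m prod_prime_factors[of m] by simp
    also have "\<dots> = (\<Prod>q\<in>prime_factors m. (q ^ (multiplicity q m div 2))\<^sup>2 * q ^ (multiplicity q m mod 2))"
      by (rule prod.cong) (simp_all flip: power_mult power_add)
    also have "\<dots> = s\<^sup>2 * t" by (simp add: s_def t_def prod.distrib prod_power_distrib)
    finally show ?thesis .
  qed
  have pos: "s > 0" "t > 0" using st m by auto
  have "s \<le> S" using S[of s] st by simp
  have "t \<le> \<Prod>(prime_factors m)" unfolding t_def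
  proof (rule prod_mono)
    fix q assume "q \<in> prime_factors m"
    then have "prime q" by auto
    then have "q \<ge> 1" by (rule prime_ge_1_nat)
    then show "0 \<le> q ^ (multiplicity q m mod 2) \<and> q ^ (multiplicity q m mod 2) \<le> q"
      by (cases "multiplicity q m mod 2 = 0") (auto simp: mod2_eq_if)
  qed
  then have "ln (real t) \<le> ln (real (\<Prod>(prime_factors m)))"
    using pos by (intro ln_mono) (simp_all only: of_nat_le_iff of_nat_0_less_iff)
  also have "\<dots> = (\<Sum>q\<in>prime_factors m. ln (real q))"
    by (simp, subst ln_prod) (auto intro: prime_gt_0_nat)
  finally have "ln (real t) \<le> (\<Sum>q\<in>prime_factors m. ln (real q))" .
  moreover have "ln (real m) = 2 * ln (real s) + ln (real t)"
    using pos by (simp add: st ln_mult ln_realpow)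
  moreover have "ln (real s) \<le> ln (real S)" using \<open>s \<le> S\<close> pos by (intro ln_mono) auto
  ultimately show ?thesis by linarith
qed

text \<open>Shifted primes without large prime factors are rare: each is counted with weight
  \<open>\<Sum> ln q\<^sub>1 ln q\<^sub>2\<close> over ordered pairs of distinct primes dividing it, and the total weight is
  bounded by the sieve.\<close>

theorem smooth_shifted_primes_bound:
  fixes n a Y Z S :: nat and \<mu> :: "nat \<Rightarrow> nat" and x :: real
  assumes Z: "Z \<ge> 2" and Y: "Y \<ge> 2" and x0: "x \<ge> ln (real Y)"
    and R: "R \<subseteq> {r\<in>{1..n}. prime r \<and> Z < r}"
    and \<mu>: "\<And>r. r \<in> R \<Longrightarrow> \<mu> r > 0" "\<And>r d. r \<in> R \<Longrightarrow> d dvd \<mu> r \<Longrightarrow> [r = a] (mod d)"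
      "\<And>r. r \<in> R \<Longrightarrow> ln (real (\<mu> r)) - 2 * ln (real S) \<ge> x"
    and smooth: "\<And>r q. r \<in> R \<Longrightarrow> prime q \<Longrightarrow> q dvd \<mu> r \<Longrightarrow> q \<le> Y"
    and sqf: "\<And>r s. r \<in> R \<Longrightarrow> s\<^sup>2 dvd \<mu> r \<Longrightarrow> s \<le> S"
  shows "real (card R) * (x * (x - ln (real Y))) \<le>
     real n / ln (real Z) * (\<Sum>q | prime q \<and> q \<le> Y. ln (real q) / (real q - 1))\<^sup>2 +
     (real Y * ln (real Y))\<^sup>2 * (real Z * (log 2 (real Z) + 1)\<^sup>2)\<^sup>2"
proof -
  let ?P = "{q. prime q \<and> q \<le> Y}"
  have fP: "finite ?P" by (rule finite_subset[of _ "{..Y}"]) auto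
  have fR: "finite R" by (rule finite_subset[OF R]) simp
  let ?T = "{(q1,q2). q1 \<in> ?P \<and> q2 \<in> ?P \<and> q1 \<noteq> q2}"
  have fT: "finite ?T" by (rule finite_subset[of _ "?P \<times> ?P"]) (use fP in auto)
  let ?w = "\<lambda>(q1,q2). ln (real q1) * ln (real q2)"
  let ?E = "(real Z * (log 2 (real Z) + 1)\<^sup>2)\<^sup>2"
  have lnq: "0 \<le> ln (real q)" "ln (real q) \<le> ln (real Y)" if "q \<in> ?P" for q
    using that prime_ge_2_nat[of q] by (auto intro!: ln_mono)
  \<comment> \<open>The weight of \<open>r\<close> is the square of \<open>X\<close> minus the sum
    of the squared logarithms. As no prime factor exceeds \<open>Y\<close>, the subtracted part is
    at most \<open>X * ln Y\<close>.\<close>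
  have lower: "x * (x - ln (real Y)) \<le> (\<Sum>t\<in>?T. if fst t * snd t dvd \<mu> r then ?w t else 0)"
    if r: "r \<in> R" for r
  proof -
    let ?F = "prime_factors (\<mu> r)"
    define X where "X = (\<Sum>q\<in>?F. ln (real q))"
    have m0: "\<mu> r > 0" using \<mu>(1)[OF r] .
    have FP: "?F \<subseteq> ?P" using smooth[OF r] by auto
    have "ln (real (\<mu> r)) - 2 * ln (real S) \<le> X" unfolding X_def
      by (rule ln_le_sum_ln_prime_factors[OF m0]) (use sqf[OF r] in auto)
    then have xX: "x \<le> X" using \<mu>(3)[OF r] by linarith
    have "ln (real Y) \<ge> 0" using Y by simp
    then have "X \<ge> 0" using xX x0 by linarith
    then have "x * (x - ln (real Y)) \<le> X * (X - ln (real Y))"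
      using xX x0 by (intro mult_mono) auto
    also have "\<dots> \<le> (\<Sum>q1\<in>?F. \<Sum>q2\<in>?F - {q1}. ln (real q1) * ln (real q2))"
    proof -
      have "X * (X - ln (real Y)) = (\<Sum>q1\<in>?F. ln (real q1) * (X - ln (real Y)))"
        by (simp add: X_def sum_distrib_right)
      also have "\<dots> \<le> (\<Sum>q1\<in>?F. ln (real q1) * (X - ln (real q1)))"
        by (intro sum_mono mult_left_mono) (use lnq FP in auto)
      also have "\<dots> = (\<Sum>q1\<in>?F. \<Sum>q2\<in>?F - {q1}. ln (real q1) * ln (real q2))"
        by (rule sum.cong[OF refl]) (simp add: X_def sum_distrib_left[symmetric] sum_diff1)
      finally show ?thesis .
    qed
    also have "\<dots> = sum ?w (Sigma ?F (\<lambda>q1. ?F - {q1}))" by (subst sum.Sigma) auto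
    also have "\<dots> \<le> (\<Sum>t\<in>{t\<in>?T. fst t * snd t dvd \<mu> r}. ?w t)"
    proof (rule sum_mono2)
      show "finite {t\<in>?T. fst t * snd t dvd \<mu> r}" using fT by simp
      show "Sigma ?F (\<lambda>q1. ?F - {q1}) \<subseteq> {t\<in>?T. fst t * snd t dvd \<mu> r}"
      proof
        fix t assume "t \<in> Sigma ?F (\<lambda>q1. ?F - {q1})"
        then obtain q1 q2 where t: "t = (q1, q2)" "q1 \<in> ?F" "q2 \<in> ?F" "q1 \<noteq> q2" by auto
        have "coprime q1 q2" using t by (intro primes_coprime) auto
        then have "q1 * q2 dvd \<mu> r" using t by (intro divides_mult) auto
        then show "t \<in> {t\<in>?T. fst t * snd t dvd \<mu> r}" using t FP by auto
      qed
    qed (use lnq in auto)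
    also have "\<dots> = (\<Sum>t\<in>?T. if fst t * snd t dvd \<mu> r then ?w t else 0)"
      by (rule sum.inter_filter[OF fT])
    finally show ?thesis .
  qed
  have "real (card R) * (x * (x - ln (real Y))) = (\<Sum>r\<in>R. x * (x - ln (real Y)))" by simp
  also have "\<dots> \<le> (\<Sum>r\<in>R. \<Sum>t\<in>?T. if fst t * snd t dvd \<mu> r then ?w t else 0)"
    by (rule sum_mono[OF lower])
  also have "\<dots> = (\<Sum>t\<in>?T. \<Sum>r\<in>R. if fst t * snd t dvd \<mu> r then ?w t else 0)" by (rule sum.swap)
  also have "\<dots> = (\<Sum>t\<in>?T. ?w t * real (card {r\<in>R. fst t * snd t dvd \<mu> r}))"
    by (rule sum.cong[OF refl]) (simp add: sum.inter_filter[OF fR, symmetric])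
  also have "\<dots> \<le> (\<Sum>t\<in>?T. ?w t * (real n / ((real (fst t) - 1) * (real (snd t) - 1) * ln (real Z)) + ?E))"
  proof (intro sum_mono mult_left_mono)
    fix t assume "t \<in> ?T"
    then obtain q1 q2 where t: "t = (q1, q2)" "q1 \<in> ?P" "q2 \<in> ?P" "q1 \<noteq> q2" by auto
    have "card {r\<in>R. fst t * snd t dvd \<mu> r} \<le> card {r\<in>{1..n}. prime r \<and> Z < r \<and> [r = a] (mod (q1 * q2))}"
      by (rule card_mono) (use R \<mu>(2) t in auto)
    also have "real \<dots> \<le> real n / ((real q1 - 1) * (real q2 - 1) * ln (real Z)) + ?E"
      by (rule brun_titchmarsh_two_primes) (use t Z in auto)
    finally show "real (card {r\<in>R. fst t * snd t dvd \<mu> r}) \<le>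
        real n / ((real (fst t) - 1) * (real (snd t) - 1) * ln (real Z)) + ?E" using t by simp
    show "0 \<le> ?w t" using t lnq by auto
  qed
  \<comment> \<open>With the diagonal put back the sum over pairs factors, so the Mertens sum
    appears squared.\<close>
  also have "\<dots> \<le> (\<Sum>t\<in>?P \<times> ?P. ?w t * (real n / ((real (fst t) - 1) * (real (snd t) - 1) * ln (real Z)) + ?E))"
  proof (rule sum_mono2)
    fix t assume "t \<in> ?P \<times> ?P - ?T"
    then obtain q1 q2 where t: "t = (q1, q2)" "q1 \<in> ?P" "q2 \<in> ?P" by auto
    have "real q1 > 1" "real q2 > 1" using t prime_gt_1_nat by auto
    moreover have "?w t \<ge> 0" using t lnq by auto
    ultimately show "0 \<le> ?w t * (real n / ((real (fst t) - 1) * (real (snd t) - 1) * ln (real Z)) + ?E)"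
      using t Z by (intro mult_nonneg_nonneg add_nonneg_nonneg divide_nonneg_nonneg) auto
  qed (use fP in auto)
  also have "\<dots> = (\<Sum>q1\<in>?P. \<Sum>q2\<in>?P. real n / ln (real Z) * ((ln (real q1) / (real q1 - 1)) * (ln (real q2) / (real q2 - 1)))
      + ?E * (ln (real q1) * ln (real q2)))"
    unfolding sum.cartesian_product
    by (rule sum.cong[OF refl]) (auto simp: algebra_simps)
  also have "\<dots> = real n / ln (real Z) * (\<Sum>q\<in>?P. ln (real q) / (real q - 1))\<^sup>2 + ?E * (\<Sum>q\<in>?P. ln (real q))\<^sup>2"
    unfolding sum.distrib sum_distrib_left[symmetric] power2_eq_square sum_product ..
  also have "\<dots> \<le> real n / ln (real Z) * (\<Sum>q\<in>?P. ln (real q) / (real q - 1))\<^sup>2 + ?E * (real Y * ln (real Y))\<^sup>2"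
  proof (intro add_left_mono mult_left_mono power_mono)
    have "(\<Sum>q\<in>?P. ln (real q)) \<le> real (card ?P) * ln (real Y)" by (rule sum_bounded_above) (use lnq in auto)
    also have "\<dots> \<le> real Y * ln (real Y)"
    proof (rule mult_right_mono)
      have "?P \<subseteq> {1..Y}" using prime_ge_1_nat by auto
      then have "card ?P \<le> Y" using card_mono[of "{1..Y}" ?P] by simp
      then show "real (card ?P) \<le> real Y" by simp
    qed (use Y in simp)
    finally show "(\<Sum>q\<in>?P. ln (real q)) \<le> real Y * ln (real Y)" .
    show "0 \<le> (\<Sum>q\<in>?P. ln (real q))" by (rule sum_nonneg) (use lnq in auto)
  qed simp
  finally show ?thesis by (simp add: mult.commute)
qed

section \<open>Primes with two prescribed large factors\<close>

text \<open>The logarithms make room for the sieve error, which is the fourth power of this bound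
  times about the sixth power of a logarithm.\<close>

definition smooth_bound :: "real \<Rightarrow> real" where
  "smooth_bound x = x powr (1/4) / ln x ^ 2"

text \<open>A lower bound for the logarithm of the radical of a number that is at least
  \<open>x / ln x ^ 2 - 1\<close> and has no square divisor with root above
  \<open>ln x ^ 2 + 1\<close>.\<close>

definition weight_bound :: "real \<Rightarrow> real" where
  "weight_bound x = ln (x / ln x ^ 2 - 1) - 2 * ln (ln x ^ 2 + 1)"

lemma ln_2_ge: "ln (2::real) \<ge> 69/100"
  using ln_approx_bounds[of 2 2] by (simp add: eval_nat_numeral)

text \<open>At most \<open>n / s^2\<close> numbers are divisible by \<open>s^2\<close>, and the sum
  over \<open>s > S\<close> telescopes once \<open>s^2\<close> is replaced by
  \<open>s * (s - 1)\<close>.\<close>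

lemma card_large_square_divisor:
  assumes S: "S \<ge> 1"
  shows "real (card {m\<in>{1..n}. \<exists>s>S. s\<^sup>2 dvd m}) \<le> real n / real S"
proof -
  have "{m\<in>{1..n}. \<exists>s>S. s\<^sup>2 dvd m} \<subseteq> (\<Union>s\<in>{S<..n}. {m\<in>{1..n}. s\<^sup>2 dvd m})"
  proof
    fix m assume "m \<in> {m\<in>{1..n}. \<exists>s>S. s\<^sup>2 dvd m}"
    then obtain s where s: "m \<in> {1..n}" "s > S" "s\<^sup>2 dvd m" by auto
    have "s \<le> s\<^sup>2" by (simp add: power2_eq_square)
    also have "\<dots> \<le> m" using s by (intro dvd_imp_le) auto
    finally show "m \<in> (\<Union>s\<in>{S<..n}. {m\<in>{1..n}. s\<^sup>2 dvd m})" using s by auto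
  qed
  then have "card {m\<in>{1..n}. \<exists>s>S. s\<^sup>2 dvd m} \<le> card (\<Union>s\<in>{S<..n}. {m\<in>{1..n}. s\<^sup>2 dvd m})"
    by (intro card_mono) auto
  also have "\<dots> \<le> (\<Sum>s\<in>{S<..n}. card {m\<in>{1..n}. s\<^sup>2 dvd m})" by (rule card_UN_le) simp
  finally have "real (card {m\<in>{1..n}. \<exists>s>S. s\<^sup>2 dvd m}) \<le> (\<Sum>s\<in>{S<..n}. real (card {m\<in>{1..n}. s\<^sup>2 dvd m}))"
    by (simp flip: of_nat_sum)
  also have "\<dots> \<le> (\<Sum>s\<in>{S<..n}. real n * (1 / real (s - 1) - 1 / real s))"
  proof (rule sum_mono)
    fix s assume s: "s \<in> {S<..n}"
    then have s1: "real s > 1" using S by simp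
    have "{m\<in>{1..n}. s\<^sup>2 dvd m} \<subseteq> (\<lambda>j. s\<^sup>2 * j) ` {1..n div s\<^sup>2}"
    proof
      fix m assume "m \<in> {m\<in>{1..n}. s\<^sup>2 dvd m}"
      then have m: "1 \<le> m" "m \<le> n" "s\<^sup>2 dvd m" by auto
      from m(3) obtain j where "m = s\<^sup>2 * j" by (elim dvdE)
      then have j: "m = s\<^sup>2 * j" "1 \<le> m" "m \<le> n" using m by blast+
      then have "j \<ge> 1" by (cases j) auto
      moreover have "s\<^sup>2 > 0" using s1 by simp
      then have "j \<le> n div s\<^sup>2" using j by (simp add: less_eq_div_iff_mult_less_eq mult.commute)
      ultimately show "m \<in> (\<lambda>j. s\<^sup>2 * j) ` {1..n div s\<^sup>2}" using j by auto
    qed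
    then have "card {m\<in>{1..n}. s\<^sup>2 dvd m} \<le> n div s\<^sup>2" using surj_card_le[of "{1..n div s\<^sup>2}"] by simp
    then have "real (card {m\<in>{1..n}. s\<^sup>2 dvd m}) \<le> real (n div s\<^sup>2)" by simp
    also have "\<dots> \<le> real n / real (s\<^sup>2)"
    proof -
      have "real (n div s\<^sup>2 * s\<^sup>2) \<le> real n" by (simp only: of_nat_le_iff) (rule div_times_less_eq_dividend)
      then have "real (n div s\<^sup>2) * real (s\<^sup>2) \<le> real n" by (simp only: of_nat_mult)
      then show ?thesis using s1 by (simp add: field_simps)
    qed
    also have "\<dots> = real n * (1 / (real s * real s))" by (simp add: power2_eq_square)
    also have "\<dots> \<le> real n * (1 / (real (s - 1) * real s))"
      using s1 by (intro mult_left_mono divide_left_mono mult_right_mono) auto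
    also have "1 / (real (s - 1) * real s) = 1 / real (s - 1) - 1 / real s"
      using s1 by (simp add: of_nat_diff field_simps)
    finally show "real (card {m\<in>{1..n}. s\<^sup>2 dvd m}) \<le> real n * (1 / real (s - 1) - 1 / real s)" .
  qed
  also have "\<dots> = real n * (\<Sum>s\<in>{S<..n}. 1 / real (s - 1) - 1 / real s)" by (simp add: sum_distrib_left)
  also have "\<dots> \<le> real n * (1 / real S)"
  proof (rule mult_left_mono)
    show "(\<Sum>s\<in>{S<..n}. 1 / real (s - 1) - 1 / real s) \<le> 1 / real S"
    proof (cases "S \<le> n")
      case True
      have "(\<Sum>s\<in>{S<..n}. 1 / real (s - 1) - 1 / real s) = 1 / real S - 1 / real n" using True
      proof (induction n rule: dec_induct)
        case (step k)
        have "{S<..Suc k} = insert (Suc k) {S<..k}" using step by auto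
        then show ?case using step by simp
      qed simp
      then show ?thesis by simp
    qed simp
  qed simp
  finally show ?thesis by simp
qed

text \<open>In the limit the Mertens sum is 1/4 of \<open>ln n\<close>, the reciprocal of
  \<open>ln Y\<close> is \<open>4 / ln n\<close>, and the weight is 3/4 of the squared logarithm.
  The constants add slack so small that \<open>401/100 * (251/1000)^2 + 1/1000\<close>, divided by
  \<open>7499/10000\<close>, stays below \<open>34/100\<close>.\<close>

lemma eventually_smooth_bounds:
  shows "\<forall>\<^sub>F n::nat in sequentially.
     weight_bound (real n) \<ge> ln (smooth_bound (real n)) \<and>
     ln (smooth_bound (real n)) + ln (ln (smooth_bound (real n)) + 1) + 1 + prime_const \<le> 251/1000 * ln (real n) \<and>
     1 / ln (smooth_bound (real n) - 1) \<le> (401/100) / ln (real n) \<and>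
     (smooth_bound (real n) * ln (smooth_bound (real n)))\<^sup>2 *
       (smooth_bound (real n) * (ln (smooth_bound (real n)) / ln 2 + 1)\<^sup>2)\<^sup>2 \<le> 1/1000 * real n * ln (real n) \<and>
     weight_bound (real n) * (weight_bound (real n) - ln (smooth_bound (real n))) \<ge> 7499/10000 * ln (real n) ^ 2 \<and>
     5 * real n / ln (real n) ^ 2 + (ln (real n) ^ 2 + 2) ^ 2 + 10 \<le> 1/1000 * real n / ln (real n) \<and>
     real n / ln (real n) ^ 2 - 1 > smooth_bound (real n) \<and> smooth_bound (real n) \<ge> 4 \<and>
     ln (real n) \<ge> 2 \<and> n \<ge> 2"
proof -
  have e: "\<forall>\<^sub>F x::real in at_top.
     weight_bound x \<ge> ln (smooth_bound x) \<and>
     ln (smooth_bound x) + ln (ln (smooth_bound x) + 1) + 1 + prime_const \<le> 251/1000 * ln x \<and>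
     1 / ln (smooth_bound x - 1) \<le> (401/100) / ln x \<and>
     (smooth_bound x * ln (smooth_bound x))\<^sup>2 *
       (smooth_bound x * (ln (smooth_bound x) / ln 2 + 1)\<^sup>2)\<^sup>2 \<le> 1/1000 * x * ln x \<and>
     weight_bound x * (weight_bound x - ln (smooth_bound x)) \<ge> 7499/10000 * ln x ^ 2 \<and>
     5 * x / ln x ^ 2 + (ln x ^ 2 + 2) ^ 2 + 10 \<le> 1/1000 * x / ln x \<and>
     x / ln x ^ 2 - 1 > smooth_bound x \<and> smooth_bound x \<ge> 4 \<and> ln x \<ge> 2"
    unfolding eventually_conj_iff smooth_bound_def weight_bound_def by (intro conjI; real_asymp)
  show ?thesis
    using eventually_compose_filterlim[OF e filterlim_real_sequentially] eventually_ge_at_top[of "2::nat"]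
    by eventually_elim auto
qed

text \<open>One statement for both shifts: \<open>r - 1\<close> with \<open>a = 1\<close> and
  \<open>n - r\<close> with \<open>a = n\<close>. All that varies is quantified after
  \<open>n\<close>, so the threshold is uniform. The sieve level is the smoothness bound
  itself.\<close>

lemma eventually_few_smooth_shifts:
  "\<forall>\<^sub>F n in sequentially. \<forall>R a (\<mu> :: nat \<Rightarrow> nat).
     R \<subseteq> {r\<in>{1..n}. prime r \<and> real r \<ge> real n / ln (real n) ^ 2} \<and>
     (\<forall>r\<in>R. real (\<mu> r) \<ge> real n / ln (real n) ^ 2 - 1) \<and>
     (\<forall>r\<in>R. \<forall>d. d dvd \<mu> r \<longrightarrow> [r = a] (mod d)) \<and>
     (\<forall>r\<in>R. \<forall>q. prime q \<and> q dvd \<mu> r \<longrightarrow> real q \<le> smooth_bound (real n)) \<and>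
     (\<forall>r\<in>R. \<forall>s. s\<^sup>2 dvd \<mu> r \<longrightarrow> real s \<le> ln (real n) ^ 2 + 1)
     \<longrightarrow> real (card R) \<le> 34/100 * real n / ln (real n)"
  using eventually_smooth_bounds
proof eventually_elim
  case (elim n)
  let ?l = "ln (real n)"
  define y where "y = smooth_bound (real n)"
  define x where "x = weight_bound (real n)"
  define Y where "Y = nat \<lfloor>y\<rfloor>"
  define S where "S = nat \<lfloor>?l ^ 2 + 1\<rfloor>"
  define K where "K = nat \<lceil>ln y\<rceil>"
  have y4: "y \<ge> 4" and l2: "?l \<ge> 2" and xy: "x \<ge> ln y" using elim by (auto simp: y_def x_def)
  have Yy: "real Y \<le> y" "real Y \<ge> y - 1" "Y \<ge> 2" using y4 unfolding Y_def by linarith+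
  have lnY: "ln (real Y) \<le> ln y" "ln (real Y) > 0" using Yy by auto
  have lny1: "ln y > 1"
  proof -
    have "ln 4 \<le> ln y" using y4 by simp
    moreover have "ln 4 = 2 * ln (2::real)" using ln_realpow[of 2 2] by simp
    ultimately show ?thesis using ln_2_ge by linarith
  qed
  have K: "real K \<ge> ln y" "real K \<le> ln y + 1" "K \<ge> 1" using lny1 unfolding K_def by linarith+
  have l0: "?l > 0" using l2 by linarith
  show ?case
  proof (intro allI impI, elim conjE)
    fix R a and \<mu> :: "nat \<Rightarrow> nat"
    assume R: "R \<subseteq> {r\<in>{1..n}. prime r \<and> real r \<ge> real n / ?l ^ 2}"
      and big: "\<forall>r\<in>R. real (\<mu> r) \<ge> real n / ?l ^ 2 - 1"
      and cg: "\<forall>r\<in>R. \<forall>d. d dvd \<mu> r \<longrightarrow> [r = a] (mod d)"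
      and sm: "\<forall>r\<in>R. \<forall>q. prime q \<and> q dvd \<mu> r \<longrightarrow> real q \<le> smooth_bound (real n)"
      and sq: "\<forall>r\<in>R. \<forall>s. s\<^sup>2 dvd \<mu> r \<longrightarrow> real s \<le> ?l ^ 2 + 1"
    let ?M = "\<Sum>q | prime q \<and> q \<le> Y. ln (real q) / (real q - 1)"
    have yn: "real n / ?l ^ 2 - 1 > y" using elim by (simp add: y_def)
    have pos: "\<mu> r > 0" if "r \<in> R" for r
    proof -
      have "real (\<mu> r) > 0" using big that yn y4 by force
      then show ?thesis by simp
    qed
    have S1: "S \<ge> 1" "real S \<le> ?l ^ 2 + 1" unfolding S_def using l0 by (auto simp: le_nat_iff)
    have main: "real (card R) * (x * (x - ln (real Y))) \<le>
       real n / ln (real Y) * ?M\<^sup>2 + (real Y * ln (real Y))\<^sup>2 * (real Y * (log 2 (real Y) + 1)\<^sup>2)\<^sup>2"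
    proof (rule smooth_shifted_primes_bound[where a = a and \<mu> = \<mu> and S = S])
      show "Y \<ge> 2" "Y \<ge> 2" by (rule Yy)+
      show "x \<ge> ln (real Y)" using xy lnY by linarith
      show "R \<subseteq> {r\<in>{1..n}. prime r \<and> Y < r}"
      proof
        fix r assume "r \<in> R"
        then have r: "r \<in> {1..n}" "prime r" "real r \<ge> real n / ?l ^ 2" using R by auto
        then have "real Y < real r" using yn Yy(1) by linarith
        then show "r \<in> {r\<in>{1..n}. prime r \<and> Y < r}" using r by simp
      qed
      fix r assume r: "r \<in> R"
      show "\<mu> r > 0" by (rule pos[OF r])
      show "[r = a] (mod d)" if "d dvd \<mu> r" for d using cg r that by blast
      show "ln (real (\<mu> r)) - 2 * ln (real S) \<ge> x"
      proof -
        have "ln (real n / ?l ^ 2 - 1) \<le> ln (real (\<mu> r))" using big r yn y4 by (intro ln_mono) auto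
        moreover have "ln (real S) \<le> ln (?l ^ 2 + 1)" using S1 by (intro ln_mono) auto
        ultimately show ?thesis unfolding x_def weight_bound_def by linarith
      qed
      show "q \<le> Y" if "prime q" "q dvd \<mu> r" for q
      proof -
        have "real q \<le> y" using sm r that by (auto simp: y_def)
        then show ?thesis unfolding Y_def by linarith
      qed
      show "s \<le> S" if "s\<^sup>2 dvd \<mu> r" for s
      proof -
        have "real s \<le> ?l ^ 2 + 1" using sq r that by blast
        then show ?thesis unfolding S_def by linarith
      qed
    qed
    have M: "?M \<le> 251/1000 * ?l"
    proof -
      have "?M \<le> ln (real Y) + ln (real K) + 1 + prime_const"
        by (rule mertens_upper) (use Yy K lnY in linarith)+
      also have "\<dots> \<le> ln y + ln (ln y + 1) + 1 + prime_const"
      proof -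
        have "ln (real K) \<le> ln (ln y + 1)" using K by (intro ln_mono) auto
        then show ?thesis using lnY by linarith
      qed
      also have "\<dots> \<le> 251/1000 * ?l" using elim by (simp add: y_def)
      finally show ?thesis .
    qed
    have M0: "?M \<ge> 0"
    proof (rule sum_nonneg)
      fix q assume "q \<in> {q. prime q \<and> q \<le> Y}"
      then have "real q \<ge> 2" using prime_ge_2_nat[of q] by auto
      then show "0 \<le> ln (real q) / (real q - 1)" by simp
    qed
    have "1 / ln (real Y) \<le> 1 / ln (y - 1)"
      using Yy y4 by (intro divide_left_mono mult_pos_pos) auto
    also have "\<dots> \<le> (401/100) / ?l" using elim by (simp add: y_def)
    finally have iY: "1 / ln (real Y) \<le> (401/100) / ?l" .
    have t1: "real n / ln (real Y) * ?M\<^sup>2 \<le> 2527/10000 * real n * ?l"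
    proof -
      have "real n / ln (real Y) * ?M\<^sup>2 = real n * (1 / ln (real Y)) * ?M\<^sup>2" by simp
      also have "\<dots> \<le> real n * ((401/100) / ?l) * (251/1000 * ?l)\<^sup>2"
        using iY M M0 l0 lnY(2) by (intro mult_mono power_mono) (auto simp: less_imp_le)
      also have "\<dots> = (401/100 * (251/1000)\<^sup>2) * real n * ?l"
        using l0 by (simp add: power2_eq_square)
      also have "\<dots> \<le> 2527/10000 * real n * ?l"
        using l0 by (intro mult_right_mono) (auto simp: power2_eq_square)
      finally show ?thesis .
    qed
    have t2: "(real Y * ln (real Y))\<^sup>2 * (real Y * (log 2 (real Y) + 1)\<^sup>2)\<^sup>2 \<le> 1/1000 * real n * ?l"
    proof -
      have "(real Y * ln (real Y))\<^sup>2 * (real Y * (log 2 (real Y) + 1)\<^sup>2)\<^sup>2 \<le>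
         (y * ln y)\<^sup>2 * (y * (ln y / ln 2 + 1)\<^sup>2)\<^sup>2"
        unfolding log_def using Yy lnY y4
        by (intro mult_mono power_mono add_mono divide_right_mono) (auto intro!: mult_nonneg_nonneg)
      also have "\<dots> \<le> 1/1000 * real n * ?l" using elim by (simp add: y_def)
      finally show ?thesis .
    qed
    have "7499/10000 * ?l ^ 2 \<le> x * (x - ln y)" using elim by (simp add: x_def y_def)
    also have "\<dots> \<le> x * (x - ln (real Y))" using xy lnY by (intro mult_left_mono) auto
    finally have "real (card R) * (7499/10000 * ?l ^ 2) \<le> real (card R) * (x * (x - ln (real Y)))"
      by (intro mult_left_mono) auto
    then have "real (card R) * (7499/10000 * ?l ^ 2) \<le> 2537/10000 * real n * ?l"
      using main t1 t2 by linarith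
    then have "(real (card R) * (7499/10000) * ?l) * ?l \<le> (2537/10000 * real n) * ?l"
      by (simp add: power2_eq_square mult.assoc)
    then have "real (card R) * (7499/10000) * ?l \<le> 2537/10000 * real n" using l0 by simp
    then have "real (card R) * ?l \<le> 34/100 * real n" by simp
    then show "real (card R) \<le> 34/100 * real n / ?l" using l0 by (simp add: pos_le_divide_eq)
  qed
qed

text \<open>Each shift may cost \<open>34/100\<close> and all exceptional sets together
  \<open>1/1000\<close>, in units of \<open>n / ln n\<close>; the sum \<open>681/1000\<close> stays
  below \<open>69/100\<close>, which is a lower bound for \<open>ln 2\<close>.\<close>

theorem eventually_good_prime:
  "\<forall>\<^sub>F n in sequentially. \<exists>p q r k :: nat. prime p \<and> prime q \<and> prime r \<and> n = k * p + r \<and> k > 0 \<and>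
     q dvd r - 1 \<and> coprime r (k * (p - 1)) \<and>
     real p > smooth_bound (real n) \<and> real q > smooth_bound (real n) \<and>
     real r \<ge> real n / ln (real n) ^ 2 \<and> real (k * p) \<ge> real n / ln (real n) ^ 2"
  using eventually_smooth_bounds eventually_few_smooth_shifts
proof eventually_elim
  case (elim n)
  let ?l = "ln (real n)"
  define y where "y = smooth_bound (real n)"
  define t where "t = real n / ?l ^ 2"
  note few = elim(2)[rule_format]
  have n2: "n \<ge> 2" and l2: "?l \<ge> 2" using elim(1) by auto
  have l0: "?l > 0" using l2 by linarith
  have "real n / ?l ^ 2 - 1 > smooth_bound (real n) \<and> smooth_bound (real n) \<ge> 4" using elim(1) by blast
  then have t1: "t > 1" unfolding t_def by linarith
  define S where "S = nat \<lfloor>?l ^ 2\<rfloor> + 1"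
  have fl: "real S = real_of_int \<lfloor>?l ^ 2\<rfloor> + 1" unfolding S_def by simp
  have S: "real S \<ge> ?l ^ 2" "real S \<le> ?l ^ 2 + 1" "S \<ge> 1"
    using fl floor_correct[of "?l ^ 2"] by (linarith, linarith, simp add: S_def)
  define P where "P = {r. prime r \<and> r \<le> n}"
  have fP: "finite P" unfolding P_def by (rule finite_subset[of _ "{..n}"]) auto
  have P1: "r \<in> {1..n}" if "r \<in> P" for r using that prime_ge_1_nat[of r] by (auto simp: P_def)
  define E1 where "E1 = {r\<in>P. real r < t}"
  define E2 where "E2 = {r\<in>P. real (n - r) < t}"
  define E3 where "E3 = {r\<in>P. \<exists>s>S. s\<^sup>2 dvd r - 1}"
  define E4 where "E4 = {r\<in>P. r < n \<and> (\<exists>s>S. s\<^sup>2 dvd n - r)}"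
  \<comment> \<open>The primes that might divide \<open>k * (p - 1)\<close>, described before
    \<open>p\<close> and \<open>k\<close> are chosen. A divisor of \<open>k\<close> divides
    \<open>n - 0\<close>, and a divisor of \<open>p - 1\<close> divides
    \<open>n - k\<close>.\<close>
  define E5 where "E5 = {r\<in>P. real r \<ge> t \<and> (\<exists>k. real k < ?l ^ 2 \<and> k < n \<and> r dvd n - k)}"
  define B1 where "B1 = {r\<in>P. r \<notin> E1 \<and> r \<notin> E3 \<and> (\<forall>q. prime q \<and> q dvd r - 1 \<longrightarrow> real q \<le> y)}"
  define B2 where "B2 = {r\<in>P. r \<notin> E1 \<and> r \<notin> E2 \<and> r \<notin> E4 \<and> (\<forall>q. prime q \<and> q dvd n - r \<longrightarrow> real q \<le> y)}"
  have nat_lt: "real (card {m::nat. real m < u}) \<le> u + 1" if "u \<ge> 0" for u :: real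
  proof -
    have "{m::nat. real m < u} \<subseteq> {..nat \<lfloor>u\<rfloor>}" by (auto simp: le_nat_iff le_floor_iff)
    then have "card {m::nat. real m < u} \<le> nat \<lfloor>u\<rfloor> + 1" using card_mono[of "{..nat \<lfloor>u\<rfloor>}"] by fastforce
    then show ?thesis using that by linarith
  qed
  have fin_lt: "finite {m::nat. real m < u}" for u
    by (rule finite_subset[of _ "{..nat \<lfloor>u\<rfloor>}"]) (auto simp: le_nat_iff le_floor_iff)
  have c1: "real (card E1) \<le> t + 1"
  proof -
    have "card E1 \<le> card {m::nat. real m < t}" by (rule card_mono[OF fin_lt]) (auto simp: E1_def)
    then show ?thesis using nat_lt[of t] t1 by linarith
  qed
  have c2: "real (card E2) \<le> t + 1"
  proof -
    have "card E2 \<le> card {m::nat. real m < t}"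
      by (rule card_inj_on_le[of "\<lambda>r. n - r"])
        (auto simp: E2_def P_def inj_on_def fin_lt intro: eq_diff_iff[THEN iffD1])
    then show ?thesis using nat_lt[of t] t1 by linarith
  qed
  have nS: "real n / real S \<le> t"
    unfolding t_def using S l0 by (intro divide_left_mono mult_pos_pos) auto
  have c3: "real (card E3) \<le> t + 1"
  proof -
    have "card (E3 - {1}) \<le> card {m\<in>{1..n}. \<exists>s>S. s\<^sup>2 dvd m}"
    proof (rule card_inj_on_le[of "\<lambda>r. r - 1"])
      show "inj_on (\<lambda>r. r - 1) (E3 - {1})" using P1 by (auto simp: inj_on_def E3_def)
      show "(\<lambda>r. r - 1) ` (E3 - {1}) \<subseteq> {m\<in>{1..n}. \<exists>s>S. s\<^sup>2 dvd m}"
        using P1 by (fastforce simp: E3_def)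
    qed simp
    moreover have "E3 - {1} = E3" using prime_gt_1_nat by (auto simp: E3_def P_def)
    ultimately have "card E3 \<le> card {m\<in>{1..n}. \<exists>s>S. s\<^sup>2 dvd m}" by (simp only:)
    then show ?thesis using card_large_square_divisor[OF S(3), of n] nS by linarith
  qed
  have c4: "real (card E4) \<le> t"
  proof -
    have "card E4 \<le> card {m\<in>{1..n}. \<exists>s>S. s\<^sup>2 dvd m}"
    proof (rule card_inj_on_le[of "\<lambda>r. n - r"])
      show "inj_on (\<lambda>r. n - r) E4" by (auto simp: inj_on_def E4_def)
      show "(\<lambda>r. n - r) ` E4 \<subseteq> {m\<in>{1..n}. \<exists>s>S. s\<^sup>2 dvd m}" by (auto simp: E4_def)
    qed simp
    then show ?thesis using card_large_square_divisor[OF S(3), of n] nS by linarith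
  qed
  \<comment> \<open>\<open>r\<close> is determined by \<open>k\<close> and the cofactor of
    \<open>r\<close> in \<open>n - k\<close>, and both are at most the square of
    \<open>ln n\<close>.\<close>
  have c5: "real (card E5) \<le> (?l ^ 2 + 2) ^ 2"
  proof -
    let ?T = "{m::nat. real m < ?l ^ 2 + 1}"
    have "E5 \<subseteq> (\<lambda>(k, s). (n - k) div s) ` (?T \<times> ?T)"
    proof
      fix r assume r: "r \<in> E5"
      then obtain k where k: "real k < ?l ^ 2" "k < n" "r dvd n - k" and rt: "real r \<ge> t"
        by (auto simp: E5_def)
      obtain s where s: "n - k = r * s" using k by blast
      have s0: "s > 0" using s k by (cases s) auto
      have "t * real s \<le> real r * real s" using rt by (intro mult_right_mono) auto
      also have "\<dots> = real (n - k)" using s by simp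
      also have "\<dots> \<le> real n" by simp
      finally have "real n / ?l ^ 2 * real s \<le> real n" by (simp add: t_def)
      then have "real s \<le> ?l ^ 2" using n2 l0 by (simp add: field_simps)
      moreover have "(n - k) div s = r" using s s0 by simp
      ultimately show "r \<in> (\<lambda>(k, s). (n - k) div s) ` (?T \<times> ?T)" using k
        by (intro image_eqI[of _ _ "(k, s)"]) auto
    qed
    then have "card E5 \<le> card (?T \<times> ?T)"
      by (intro surj_card_le) (simp_all add: fin_lt)
    then have "real (card E5) \<le> real (card ?T) ^ 2"
      by (simp add: card_cartesian_product power2_eq_square flip: of_nat_mult)
    also have "\<dots> \<le> (?l ^ 2 + 2) ^ 2" using nat_lt[of "?l ^ 2 + 1"] by (intro power_mono) auto
    finally show ?thesis .
  qed
  have c6: "real (card B1) \<le> 34/100 * real n / ?l"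
  proof (rule few[of B1 "\<lambda>r. r - 1" 1], intro conjI ballI allI impI)
    show "B1 \<subseteq> {r\<in>{1..n}. prime r \<and> real n / ?l ^ 2 \<le> real r}"
      using P1 by (auto simp: B1_def E1_def t_def P_def)
    fix r assume r: "r \<in> B1"
    have rP: "r \<ge> 1" using r P1 by (auto simp: B1_def)
    show "real n / ?l ^ 2 - 1 \<le> real (r - 1)" using r rP by (auto simp: B1_def E1_def t_def of_nat_diff)
    show "[r = 1] (mod d)" if "d dvd r - 1" for d
      using that rP by (simp add: cong_altdef_nat)
    show "real q \<le> smooth_bound (real n)" if "prime q \<and> q dvd r - 1" for q
      using r that by (auto simp: B1_def y_def)
    show "real s \<le> ?l ^ 2 + 1" if "s\<^sup>2 dvd r - 1" for s
    proof -
      have "\<not> S < s" using r that unfolding B1_def E3_def by blast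
      then show ?thesis using S by linarith
    qed
  qed
  have c7: "real (card B2) \<le> 34/100 * real n / ?l"
  proof (rule few[of B2 "\<lambda>r. n - r" n], intro conjI ballI allI impI)
    show "B2 \<subseteq> {r\<in>{1..n}. prime r \<and> real n / ?l ^ 2 \<le> real r}"
      using P1 by (auto simp: B2_def E1_def t_def P_def)
    fix r assume r: "r \<in> B2"
    have rn: "r < n"
    proof -
      have "real (n - r) \<ge> t" using r by (auto simp: B2_def E2_def)
      then have "real (n - r) > 0" using t1 by linarith
      then show ?thesis by simp
    qed
    show "real n / ?l ^ 2 - 1 \<le> real (n - r)" using r by (auto simp: B2_def E2_def t_def)
    show "[r = n] (mod d)" if "d dvd n - r" for d
    proof -
      have "[n = r] (mod d)" using that rn by (simp add: cong_altdef_nat)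
      then show ?thesis by (rule cong_sym)
    qed
    show "real q \<le> smooth_bound (real n)" if "prime q \<and> q dvd n - r" for q
      using r that by (auto simp: B2_def y_def)
    show "real s \<le> ?l ^ 2 + 1" if "s\<^sup>2 dvd n - r" for s
    proof -
      have "\<not> S < s" using r that rn unfolding B2_def E4_def by blast
      then show ?thesis using S by linarith
    qed
  qed
  have "\<exists>r\<in>P. r \<notin> E1 \<union> E2 \<union> E3 \<union> E4 \<union> E5 \<union> B1 \<union> B2"
  proof (rule ccontr)
    assume "\<not> ?thesis"
    then have "P \<subseteq> E1 \<union> E2 \<union> E3 \<union> E4 \<union> E5 \<union> B1 \<union> B2" by blast
    moreover have "finite (E1 \<union> E2 \<union> E3 \<union> E4 \<union> E5 \<union> B1 \<union> B2)"
      by (rule finite_subset[OF _ fP]) (auto simp: E1_def E2_def E3_def E4_def E5_def B1_def B2_def)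
    ultimately have "card P \<le> card (E1 \<union> E2 \<union> E3 \<union> E4 \<union> E5 \<union> B1 \<union> B2)" by (intro card_mono)
    also have "\<dots> \<le> card E1 + card E2 + card E3 + card E4 + card E5 + card B1 + card B2"
      by (intro order_trans[OF card_Un_le] add_mono order_refl)
    finally have "real (card P) \<le> 4 * t + 3 + (?l ^ 2 + 2) ^ 2 + 68/100 * real n / ?l"
      using c1 c2 c3 c4 c5 c6 c7 by linarith
    moreover have "5 * real n / ?l ^ 2 + (?l ^ 2 + 2) ^ 2 + 10 \<le> 1/1000 * real n / ?l" using elim(1) by blast
    ultimately have ub: "real (card P) \<le> 681/1000 * real n / ?l - 7" using t1 by (simp add: t_def)
    have "(real n - 1) * ln 2 - ?l \<le> real (card P) * ?l"
      using chebyshev_lower[OF n2] by (simp add: P_def)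
    also have "\<dots> \<le> (681/1000 * real n / ?l - 7) * ?l" using ub l0 by (intro mult_right_mono) auto
    also have "\<dots> = 681/1000 * real n - 7 * ?l" using l0 by (simp add: left_diff_distrib)
    finally have "(real n - 1) * ln 2 \<le> 681/1000 * real n - 6 * ?l" by simp
    moreover have "(real n - 1) * (69/100) \<le> (real n - 1) * ln 2"
      using ln_2_ge n2 by (intro mult_left_mono) auto
    ultimately have "(real n - 1) * (69/100) \<le> 681/1000 * real n - 6 * ?l" by (rule order_trans[rotated])
    moreover have "real n \<ge> 2" using n2 by simp
    ultimately show False using l2 by argo
  qed
  then obtain r where r: "r \<in> P" "r \<notin> E1" "r \<notin> E2" "r \<notin> E3" "r \<notin> E4" "r \<notin> E5" "r \<notin> B1" "r \<notin> B2"
    by blast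
  have pr: "prime r" and rn: "r \<le> n" and rt: "real r \<ge> t" and nrt: "real (n - r) \<ge> t"
    using r by (auto simp: P_def E1_def E2_def)
  obtain q where q: "prime q" "q dvd r - 1" "real q > y" using r by (auto simp: B1_def not_le)
  obtain p where p: "prime p" "p dvd n - r" "real p > y" using r by (auto simp: B2_def not_le)
  obtain k where k: "n - r = k * p" using p(2) by (metis dvd_def mult.commute)
  have "real (n - r) > 0" using nrt t1 by linarith
  then have rn': "r < n" by simp
  have nk: "n = k * p + r" using k rn by simp
  have k0: "k > 0" using k rn' by (cases k) auto
  have "\<not> r dvd k * (p - 1)"
  proof
    assume "r dvd k * (p - 1)"
    then consider "r dvd k" | "r dvd p - 1" using pr by (auto simp: prime_dvd_mult_iff)
    then show False
    proof cases
      case 1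
      then have "r dvd n - 0" using nk by simp
      then have "r \<in> E5" using r rt l0 n2 unfolding E5_def by (auto intro!: exI[of _ 0])
      then show False using r by blast
    next
      case 2
      have p1: "p - 1 > 0" using prime_gt_1_nat[OF p(1)] by simp
      have "r \<le> p - 1" using 2 p1 by (rule dvd_imp_le)
      \<comment> \<open>As \<open>p\<close> exceeds \<open>r\<close> and hence \<open>t\<close>, the
        number \<open>k\<close> of blocks is below \<open>n / t\<close>, the range covered by
        \<open>E5\<close>.\<close>
      then have rp: "real r < real p" using p1 by linarith
      have "real k * real p \<le> real n" using nk by (metis le_add1 of_nat_le_iff of_nat_mult)
      moreover have "real k * t < real k * real p" using rt rp k0 by (intro mult_strict_left_mono) auto
      ultimately have "real k * t < real n" by linarith
      then have "real k < ?l ^ 2" using n2 l0 by (simp add: t_def field_simps)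
      moreover have "k < n"
      proof -
        have "k * 1 \<le> k * p" using prime_ge_1_nat[OF p(1)] by (intro mult_le_mono2)
        then show ?thesis using nk prime_gt_0_nat[OF pr] by linarith
      qed
      moreover have "n - k = k * (p - 1) + r"
        using nk prime_gt_0_nat[OF p(1)] by (cases p) auto
      then have "r dvd n - k" using 2 by simp
      ultimately have "r \<in> E5" using r rt unfolding E5_def by auto
      then show False using r by blast
    qed
  qed
  then have cop: "coprime r (k * (p - 1))" using pr by (intro prime_imp_coprime)
  have "real (k * p) \<ge> t" using nrt unfolding k .
  then show ?case
    using p(1,3) q pr nk k0 rt cop unfolding y_def t_def
    by (intro exI[of _ p] exI[of _ q] exI[of _ r] exI[of _ k] conjI)
qed

section \<open>The permutation group\<close>

type_synonym block_vertex = "(nat \<times> nat) + nat"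

text \<open>The vertices are \<open>k\<close> blocks \<open>Inl ` ({i} \<times> \<int>/p)\<close> and one copy \<open>Inr\<close> of \<open>\<int>/r\<close>.\<close>

locale block_group =
  fixes k p q r a c :: nat
  assumes p: "prime p" and q: "prime q" and r: "prime r" and k: "k > 0"
    and cop: "coprime r (k * (p - 1))"
    and a: "coprime p a" "ord p a = p - 1" and c: "coprime r c" "ord r c = q"
begin

definition verts :: "block_vertex set" where
  "verts = Inl ` ({..<k} \<times> {..<p}) \<union> Inr ` {..<r}"

fun trans :: "nat \<Rightarrow> block_vertex \<Rightarrow> block_vertex" where
  "trans i (Inl (j, x)) = (if j = i then Inl (j, (x + 1) mod p) else Inl (j, x))"
| "trans i (Inr b) = Inr b"

text \<open>The twist occurs only on passing from the last block to the first, so the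
  \<open>k\<close>-th power multiplies every block by \<open>a\<close> and
  \<open>k * (p - 1)\<close> is a period.\<close>

fun rotA :: "block_vertex \<Rightarrow> block_vertex" where
  "rotA (Inl (j, x)) = (if Suc j < k then Inl (Suc j, x) else Inl (0, (a * x) mod p))"
| "rotA (Inr b) = Inr b"

fun rotB :: "block_vertex \<Rightarrow> block_vertex" where
  "rotB (Inl v) = Inl v"
| "rotB (Inr b) = Inr ((b + 1) mod r)"

fun scale :: "block_vertex \<Rightarrow> block_vertex" where
  "scale (Inl v) = Inl v"
| "scale (Inr b) = Inr ((c * b) mod r)"

definition rot :: "block_vertex \<Rightarrow> block_vertex" where "rot v = rotA (rotB v)"

lemma pos: "p > 0" "r > 0" "p - 1 > 0" "q > 0"
  using p r q prime_gt_1_nat[OF p] by (auto intro: prime_gt_0_nat)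

lemma verts_cases:
  assumes "v \<in> verts"
  obtains (A) i x where "v = Inl (i, x)" "i < k" "x < p" | (B) b where "v = Inr b" "b < r"
  using assms by (auto simp: verts_def)

lemma in_verts [simp]: "Inl (i, x) \<in> verts \<longleftrightarrow> i < k \<and> x < p" "Inr b \<in> verts \<longleftrightarrow> b < r"
  by (auto simp: verts_def)

lemma finite_verts: "finite verts" by (simp add: verts_def)

lemma card_verts: "card verts = k * p + r"
proof -
  have "card verts = card (Inl ` ({..<k} \<times> {..<p}) :: block_vertex set) + card (Inr ` {..<r} :: block_vertex set)"
    unfolding verts_def by (rule card_Un_disjoint) auto
  then show ?thesis by (simp add: card_image)
qed

lemma maps_verts:
  assumes "v \<in> verts"
  shows "trans i v \<in> verts" "rotA v \<in> verts" "rotB v \<in> verts" "scale v \<in> verts" "rot v \<in> verts"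
  using assms pos k by (cases rule: verts_cases; auto simp: rot_def)+

lemma trans_funpow: "x < p \<Longrightarrow> (trans i ^^ s) (Inl (i, x)) = Inl (i, (x + s) mod p)"
  by (induction s) (auto simp: mod_Suc_eq)

lemma trans_funpow_other: "j \<noteq> i \<Longrightarrow> (trans i ^^ s) (Inl (j, x)) = Inl (j, x)"
  by (induction s) auto

lemma trans_funpow_Inr: "(trans i ^^ s) (Inr b) = Inr b"
  by (induction s) auto

lemma trans_order:
  assumes "v \<in> verts" shows "(trans i ^^ p) v = v"
  using assms
proof (cases rule: verts_cases)
  case (A j x)
  then show ?thesis by (cases "j = i") (auto simp: trans_funpow trans_funpow_other)
qed (simp add: trans_funpow_Inr)

lemma trans_commute: "trans i (trans j v) = trans j (trans i v)"
  by (cases v) (auto split: sum.splits prod.splits)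

lemma rotA_funpow:
  "j < k \<Longrightarrow> x < p \<Longrightarrow> (rotA ^^ s) (Inl (j, x)) = Inl ((j + s) mod k, (a ^ ((j + s) div k) * x) mod p)"
proof (induction s)
  case (Suc s)
  let ?m = "(j + s) mod k" and ?d = "(j + s) div k"
  have IH: "(rotA ^^ s) (Inl (j, x)) = Inl (?m, (a ^ ?d * x) mod p)" using Suc by blast
  show ?case
  proof (cases "Suc ?m < k")
    case True
    have "Suc (j + s) mod k = Suc ?m" "Suc (j + s) div k = ?d"
      using True by (simp_all add: mod_Suc div_Suc)
    then show ?thesis using IH True by simp
  next
    case False
    have "?m < k" using k by simp
    then have "Suc ?m = k" using False by simp
    then have "Suc (j + s) mod k = 0" "Suc (j + s) div k = Suc ?d"
      by (simp_all add: mod_Suc div_Suc)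
    then show ?thesis using IH False by (simp add: mod_mult_right_eq mult.assoc)
  qed
qed simp

lemma rotA_funpow_Inr: "(rotA ^^ s) (Inr b) = Inr b"
  by (induction s) auto

lemma a_power_order: "(a ^ (p - 1) * x) mod p = x mod p"
proof -
  have "[a ^ (p - 1) = 1] (mod p)" using ord[of a p] a(2) by simp
  then have "[a ^ (p - 1) * x = 1 * x] (mod p)" by (rule cong_scalar_right)
  then show ?thesis by (simp add: unique_euclidean_semiring_class.cong_def)
qed

text \<open>Block \<open>i\<close> is carried to block \<open>j\<close> without a twist: the added
  period \<open>k * (p - 1)\<close> keeps the subtraction exact and contributes
  \<open>a ^ (p - 1)\<close>, which is 1 modulo \<open>p\<close>.\<close>

lemma rotA_shift:
  assumes "i < k" "x < p" "j < k"
  shows "(rotA ^^ (j + k * (p - 1) - i)) (Inl (i, x)) = Inl (j, x)"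
proof -
  have "k * 1 \<le> k * (p - 1)" using pos by (intro mult_le_mono2) simp
  then have e: "i + (j + k * (p - 1) - i) = j + k * (p - 1)" using assms by linarith
  have "(j + k * (p - 1)) mod k = j" "(j + k * (p - 1)) div k = p - 1" using assms k by auto
  then show ?thesis using assms by (simp only: rotA_funpow e a_power_order) simp
qed

lemma rotA_order:
  assumes "v \<in> verts" shows "(rotA ^^ (k * (p - 1))) v = v"
  using assms
proof (cases rule: verts_cases)
  case (A i x)
  then show ?thesis using rotA_shift[of i x i] by simp
qed (simp add: rotA_funpow_Inr)

lemma rotB_funpow: "b < r \<Longrightarrow> (rotB ^^ s) (Inr b) = Inr ((b + s) mod r)"
  by (induction s) (auto simp: mod_Suc_eq)

lemma rotB_funpow_Inl: "(rotB ^^ s) (Inl v) = Inl v"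
  by (induction s) auto

lemma rotB_order:
  assumes "v \<in> verts" shows "(rotB ^^ r) v = v"
  using assms by (cases rule: verts_cases) (auto simp: rotB_funpow rotB_funpow_Inl)

lemma scale_funpow: "b < r \<Longrightarrow> (scale ^^ s) (Inr b) = Inr ((c ^ s * b) mod r)"
  by (induction s) (auto simp: mod_mult_right_eq mult.assoc)

lemma scale_funpow_Inl: "(scale ^^ s) (Inl v) = Inl v"
  by (induction s) auto

lemma scale_order:
  assumes "v \<in> verts" shows "(scale ^^ q) v = v"
  using assms
proof (cases rule: verts_cases)
  case (B b)
  have "[c ^ q = 1] (mod r)" using ord[of c r] c(2) by simp
  then have "[c ^ q * b = 1 * b] (mod r)" by (rule cong_scalar_right)
  then show ?thesis using B by (simp add: scale_funpow unique_euclidean_semiring_class.cong_def)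
qed (simp add: scale_funpow_Inl)

lemma rotA_rotB_commute: "rotA (rotB v) = rotB (rotA v)"
proof (cases v)
  case (Inl w)
  then show ?thesis by (cases w) auto
qed simp

lemma rot_funpow: "(rot ^^ s) v = (rotA ^^ s) ((rotB ^^ s) v)"
proof (induction s)
  case (Suc s)
  have AB: "rotB ((rotA ^^ m) w) = (rotA ^^ m) (rotB w)" for m w
    by (induction m) (simp_all add: rotA_rotB_commute[symmetric])
  show ?case using Suc AB by (simp add: rot_def)
qed simp

lemma funpow_multiple:
  assumes "(f ^^ N) v = v" shows "(f ^^ (N * m)) v = v"
proof (induction m)
  case (Suc m)
  have "(f ^^ (N * Suc m)) v = (f ^^ N) ((f ^^ (N * m)) v)" by (simp add: funpow_add)
  then show ?case using Suc assms by simp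
qed simp

text \<open>The exponent is 1 modulo the period of \<open>rotA\<close> and 0 modulo that of
  \<open>rotB\<close>. Through such exponents, invariance under the single permutation
  \<open>rot\<close> gives invariance under both factors.\<close>

lemma rotA_eq_rot_power: "\<exists>s. \<forall>v\<in>verts. (rot ^^ s) v = rotA v"
proof -
  have "coprime (k * (p - 1)) r" using cop by (simp add: coprime_commute)
  then obtain s where s: "[s = 1] (mod (k * (p - 1)))" "[s = 0] (mod r)"
    using binary_chinese_remainder_nat by blast
  \<comment> \<open>One period is added because \<open>s\<close> can be 0 when the modulus is
    1.\<close>
  obtain m where m: "s + k * (p - 1) = 1 + k * (p - 1) * m"
  proof -
    have "[s + k * (p - 1) = 1] (mod (k * (p - 1)))" using s(1) by (simp add: unique_euclidean_semiring_class.cong_def)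
    moreover have "k * (p - 1) > 0" using k pos by (intro mult_pos_pos)
    then have "s + k * (p - 1) \<ge> 1" by linarith
    moreover note this
    ultimately have "k * (p - 1) dvd s + k * (p - 1) - 1" by (simp add: cong_altdef_nat)
    then obtain m where "s + k * (p - 1) - 1 = k * (p - 1) * m" by (elim dvdE)
    then show ?thesis using that[of m] \<open>s + k * (p - 1) \<ge> 1\<close> by linarith
  qed
  obtain l where l: "s = r * l" using s(2) by (auto simp: cong_0_iff)
  have "(rot ^^ s) v = rotA v" if v: "v \<in> verts" for v
  proof -
    have "(rotB ^^ s) v = v" unfolding l by (rule funpow_multiple[OF rotB_order[OF v]])
    then have "(rot ^^ s) v = (rotA ^^ s) v" by (simp add: rot_funpow)
    also have "\<dots> = (rotA ^^ s) ((rotA ^^ (k * (p - 1))) v)" using rotA_order[OF v] by simp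
    also have "\<dots> = (rotA ^^ (s + k * (p - 1))) v" by (simp add: funpow_add)
    also have "\<dots> = rotA ((rotA ^^ (k * (p - 1) * m)) v)" unfolding m by (simp add: funpow_add)
    also have "(rotA ^^ (k * (p - 1) * m)) v = v" by (rule funpow_multiple[OF rotA_order[OF v]])
    finally show ?thesis .
  qed
  then show ?thesis by blast
qed

lemma rotB_eq_rot_power: "\<exists>s. \<forall>v\<in>verts. (rot ^^ s) v = rotB v"
proof -
  have "coprime (k * (p - 1)) r" using cop by (simp add: coprime_commute)
  then obtain s where s: "[s = 0] (mod (k * (p - 1)))" "[s = 1] (mod r)"
    using binary_chinese_remainder_nat by blast
  obtain m where m: "s + r = 1 + r * m"
  proof -
    have "[s + r = 1] (mod r)" using s(2) by (simp add: unique_euclidean_semiring_class.cong_def)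
    moreover have "s + r \<ge> 1" using pos by simp
    ultimately have "r dvd s + r - 1" by (simp add: cong_altdef_nat)
    then obtain m where "s + r - 1 = r * m" by (elim dvdE)
    then show ?thesis using that[of m] \<open>s + r \<ge> 1\<close> by linarith
  qed
  obtain l where l: "s = k * (p - 1) * l" using s(1) by (auto simp: cong_0_iff)
  have "(rot ^^ s) v = rotB v" if v: "v \<in> verts" for v
  proof -
    have Bs: "(rotB ^^ s) w \<in> verts" if "w \<in> verts" for w using that
      by (induction s) (auto simp: maps_verts)
    have "(rotB ^^ s) v = (rotB ^^ s) ((rotB ^^ r) v)" using rotB_order[OF v] by simp
    also have "\<dots> = (rotB ^^ (s + r)) v" by (simp add: funpow_add)
    also have "\<dots> = rotB ((rotB ^^ (r * m)) v)" unfolding m by (simp add: funpow_add)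
    also have "(rotB ^^ (r * m)) v = v" by (rule funpow_multiple[OF rotB_order[OF v]])
    finally have B: "(rotB ^^ s) v = rotB v" .
    have "(rotA ^^ s) (rotB v) = rotB v" unfolding l
      by (rule funpow_multiple[OF rotA_order[OF maps_verts(3)[OF v]]])
    then show ?thesis using B by (simp add: rot_funpow)
  qed
  then show ?thesis by blast
qed

text \<open>\<open>rot\<close> normalises the group of block translations. Across the twist, a unit
  translation corresponds to a translation by the inverse of \<open>a\<close> modulo
  \<open>p\<close>.\<close>

lemma trans_rot:
  assumes i: "i < k"
  shows "\<exists>j<k. \<exists>s. \<forall>v\<in>verts. trans i (rot v) = rot ((trans j ^^ s) v)"
proof (cases i)
  case 0
  obtain m where m: "[a * m = 1] (mod p)"
    using cong_solve_coprime_nat[of a p] a(1) by (auto simp: coprime_commute)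
  have "trans 0 (rot v) = rot ((trans (k - 1) ^^ m) v)" if v: "v \<in> verts" for v
    using v
  proof (cases rule: verts_cases)
    case (A j x)
    show ?thesis
    proof (cases "j = k - 1")
      case True
      have "(a * x + 1) mod p = (a * (x + m)) mod p"
      proof -
        have "[a * x + 1 = a * x + a * m] (mod p)" using m by (intro cong_add) (auto simp: cong_sym_eq)
        then show ?thesis by (simp add: unique_euclidean_semiring_class.cong_def distrib_left)
      qed
      then show ?thesis using A True k
        by (simp add: rot_def trans_funpow mod_mult_right_eq mod_Suc_eq)
    next
      case False
      then show ?thesis using A by (auto simp: rot_def trans_funpow_other)
    qed
  next
    case (B b)
    then show ?thesis by (simp add: rot_def trans_funpow_Inr)
  qed
  then show ?thesis using 0 k by (intro exI[of _ "k - 1"] conjI exI[of _ m]) auto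
next
  case (Suc j)
  have "trans i (rot v) = rot ((trans j ^^ 1) v)" if v: "v \<in> verts" for v
    using v
  proof (cases rule: verts_cases)
    case (A l x)
    then show ?thesis using Suc i by (auto simp: rot_def)
  next
    case (B b)
    then show ?thesis by (simp add: rot_def)
  qed
  then show ?thesis using Suc i by (intro exI[of _ j] conjI exI[of _ 1]) auto
qed

lemma trans_scale: "trans i (scale v) = scale (trans i v)"
  by (cases v) (auto split: sum.splits prod.splits)

lemma rotA_scale: "rotA (scale v) = scale (rotA v)"
  by (cases v) (auto split: sum.splits prod.splits)

text \<open>Multiplication normalises the translations of the prime block; the exponent is the
  inverse of \<open>c\<close> modulo \<open>r\<close>.\<close>

lemma rotB_scale: "\<exists>s. \<forall>v\<in>verts. rotB (scale v) = scale ((rotB ^^ s) v)"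
proof -
  obtain m where m: "[c * m = 1] (mod r)"
    using cong_solve_coprime_nat[of c r] c(1) by (auto simp: coprime_commute)
  have "rotB (scale v) = scale ((rotB ^^ m) v)" if v: "v \<in> verts" for v
    using v
  proof (cases rule: verts_cases)
    case (B b)
    have "(c * b + 1) mod r = (c * (b + m)) mod r"
    proof -
      have "[c * b + 1 = c * b + c * m] (mod r)" using m by (intro cong_add) (auto simp: cong_sym_eq)
      then show ?thesis by (simp add: unique_euclidean_semiring_class.cong_def distrib_left)
    qed
    then show ?thesis using B by (simp add: rotB_funpow mod_mult_right_eq mod_Suc_eq)
  qed (simp add: rotB_funpow_Inl)
  then show ?thesis by blast
qed

text \<open>The powers of \<open>u\<close> are distinct over one period, and multiplication by the
  unit \<open>d\<close> keeps them distinct.\<close>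

lemma scaled_translates_inj:
  fixes M u d z :: nat
  assumes M: "prime M" and u: "coprime M u" and d: "\<not> M dvd d"
  shows "inj_on (\<lambda>s. (z + u ^ s * d) mod M) {..<ord M u}"
proof (rule inj_onI)
  fix s t assume st: "s \<in> {..<ord M u}" "t \<in> {..<ord M u}"
    and eq: "(z + u ^ s * d) mod M = (z + u ^ t * d) mod M"
  have "[z + u ^ s * d = z + u ^ t * d] (mod M)" using eq by (simp add: unique_euclidean_semiring_class.cong_def)
  then have "[u ^ s * d = u ^ t * d] (mod M)" by (simp add: cong_add_lcancel_nat)
  moreover have "coprime d M" using prime_imp_coprime[OF M d] by (simp add: coprime_commute)
  ultimately have "[u ^ s = u ^ t] (mod M)" by (simp add: cong_mult_rcancel_nat)
  then have "[s = t] (mod ord M u)" using u by (simp add: order_divides_expdiff)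
  then show "s = t" using st by (simp add: unique_euclidean_semiring_class.cong_def)
qed

end

section \<open>Invariant graphs\<close>

lemma funpow_bij_betw:
  assumes V: "finite V" and maps: "\<And>v. v \<in> V \<Longrightarrow> f v \<in> V" and N: "N > 0" "\<And>v. v \<in> V \<Longrightarrow> (f ^^ N) v = v"
  shows "bij_betw f V V"
proof -
  obtain m where m: "N = Suc m" using N by (cases N) auto
  have "inj_on f V"
  proof (rule inj_onI)
    fix u v assume uv: "u \<in> V" "v \<in> V" "f u = f v"
    have "(f ^^ N) u = (f ^^ N) v" unfolding m funpow_Suc_right o_apply uv(3) ..
    then show "u = v" using N uv by simp
  qed
  then show ?thesis using endo_inj_surj[OF V] maps by (auto simp: bij_betw_def)
qed

lemma relabel_comp: "relabel (f \<circ> g) E = relabel f (relabel g E)"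
  by (simp add: relabel_def image_image image_comp)

lemma relabel_poset_auto:
  assumes P: "graph_property n P" and \<pi>: "\<pi> permutes {1..n}"
  shows "poset_auto (P - {{}}) (relabel \<pi>)"
proof -
  have fV: "finite (vertex_pairs n)" by (simp add: vertex_pairs_def finite_imp_finite_nsets)
  have fin: "finite (P - {{}})"
    using P fV unfolding graph_property_def graphs_on_def by (meson finite_Diff finite_Pow_iff finite_subset)
  have inj: "inj (\<lambda>e. \<pi> ` e)" using permutes_inj[OF \<pi>] by (simp add: inj_image_eq_iff inj_def)
  have inj2: "inj (relabel \<pi>)" unfolding relabel_def using inj_image_eq_iff[OF inj] by (simp add: inj_def)
  have sub: "relabel \<pi> E \<in> P - {{}}" if "E \<in> P - {{}}" for E
    using that P \<pi> unfolding graph_property_def by (auto simp: relabel_def)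
  have "relabel \<pi> ` (P - {{}}) = P - {{}}"
    by (rule endo_inj_surj[OF fin]) (use sub inj2 in \<open>auto intro: inj_on_subset\<close>)
  moreover have "E < E' \<longleftrightarrow> relabel \<pi> E < relabel \<pi> E'" for E E'
    unfolding less_le_not_le relabel_def using inj_image_subset_iff[OF inj] by simp
  ultimately show ?thesis using inj2 unfolding poset_auto_def bij_betw_def by (auto intro: inj_on_subset)
qed

text \<open>Degrees are bounded on abstract vertices while edges are counted in the labelled graph;
  \<open>\<phi>\<close> translates, and each edge contains at most two images of points of
  \<open>W\<close>.\<close>

lemma handshake_bound:
  fixes \<phi> :: "'v \<Rightarrow> nat"
  assumes E: "finite E" "\<And>e. e \<in> E \<Longrightarrow> card e = 2" and inj: "inj_on \<phi> V" and W: "W \<subseteq> V" "finite W"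
    and N: "\<And>v. v \<in> W \<Longrightarrow> N v \<subseteq> V \<and> finite (N v) \<and> D \<le> card (N v)"
    and adj: "\<And>v w. v \<in> W \<Longrightarrow> w \<in> N v \<Longrightarrow> {\<phi> v, \<phi> w} \<in> E"
  shows "D * card W \<le> 2 * card E"
proof -
  have "D * card W = (\<Sum>v\<in>W. D)" by simp
  also have "\<dots> \<le> (\<Sum>v\<in>W. card {e\<in>E. \<phi> v \<in> e})"
  proof (rule sum_mono)
    fix v assume v: "v \<in> W"
    have "inj_on (\<lambda>w. {\<phi> v, \<phi> w}) (N v)"
    proof (rule inj_onI)
      fix u w assume uw: "u \<in> N v" "w \<in> N v" "{\<phi> v, \<phi> u} = {\<phi> v, \<phi> w}"
      then have "\<phi> u = \<phi> w" by (metis doubleton_eq_iff)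
      then show "u = w" using inj uw N[OF v] by (meson inj_onD subsetD)
    qed
    moreover have "(\<lambda>w. {\<phi> v, \<phi> w}) ` N v \<subseteq> {e\<in>E. \<phi> v \<in> e}" using adj[OF v] by auto
    ultimately have "card (N v) \<le> card {e\<in>E. \<phi> v \<in> e}" by (rule card_inj_on_le) (use E in simp)
    then show "D \<le> card {e\<in>E. \<phi> v \<in> e}" using N[OF v] by linarith
  qed
  also have "\<dots> = (\<Sum>v\<in>W. \<Sum>e\<in>E. if \<phi> v \<in> e then 1 else 0)"
    by (rule sum.cong[OF refl]) (simp add: E(1) sum.If_cases Int_def)
  also have "\<dots> = (\<Sum>e\<in>E. \<Sum>v\<in>W. if \<phi> v \<in> e then 1 else 0)" by (rule sum.swap)
  also have "\<dots> \<le> (\<Sum>e\<in>E. 2)"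
  proof (rule sum_mono)
    fix e assume e: "e \<in> E"
    have fe: "finite e" using E(2)[OF e] by (metis card.infinite zero_neq_numeral)
    have "card {v\<in>W. \<phi> v \<in> e} \<le> card e"
      by (rule card_inj_on_le[of \<phi>]) (use inj W fe in \<open>auto intro: inj_on_subset\<close>)
    then show "(\<Sum>v\<in>W. if \<phi> v \<in> e then 1 else 0) \<le> (2::nat)"
      using E(2)[OF e] W by (simp add: sum.If_cases Int_def)
  qed
  also have "\<dots> = 2 * card E" by simp
  finally show ?thesis .
qed

section \<open>Action on labelled graphs and the size of invariant graphs\<close>

context block_group
begin

context
  fixes n :: nat and \<phi> :: "block_vertex \<Rightarrow> nat"
  assumes \<phi>: "bij_betw \<phi> verts {1..n}"
begin

definition conj_perm :: "(block_vertex \<Rightarrow> block_vertex) \<Rightarrow> nat \<Rightarrow> nat" where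
  "conj_perm \<sigma> v = (if v \<in> {1..n} then \<phi> (\<sigma> (inv_into verts \<phi> v)) else v)"

definition act :: "(block_vertex \<Rightarrow> block_vertex) \<Rightarrow> nat set set \<Rightarrow> nat set set" where
  "act \<sigma> = relabel (conj_perm \<sigma>)"

lemma inv_in_verts: "v \<in> {1..n} \<Longrightarrow> inv_into verts \<phi> v \<in> verts"
  using \<phi> by (metis bij_betw_def inv_into_into)

lemma phi_in: "u \<in> verts \<Longrightarrow> \<phi> u \<in> {1..n}"
  using \<phi> by (auto simp: bij_betw_def)

lemma conj_perm_phi: "u \<in> verts \<Longrightarrow> conj_perm \<sigma> (\<phi> u) = \<phi> (\<sigma> u)"
  using \<phi> phi_in[of u] by (simp add: conj_perm_def bij_betw_def)

lemma conj_perm_cong: "(\<And>v. v \<in> verts \<Longrightarrow> \<sigma> v = \<tau> v) \<Longrightarrow> conj_perm \<sigma> = conj_perm \<tau>"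
  by (auto simp: conj_perm_def inv_in_verts)

text \<open>The group relations hold only on \<open>verts\<close>, where the coordinates are reduced
  residues; this carries them over to graphs.\<close>

lemma act_cong: "(\<And>v. v \<in> verts \<Longrightarrow> \<sigma> v = \<tau> v) \<Longrightarrow> act \<sigma> = act \<tau>"
  unfolding act_def using conj_perm_cong by metis

lemma act_act:
  assumes "\<And>v. v \<in> verts \<Longrightarrow> \<tau> v \<in> verts"
  shows "act \<sigma> (act \<tau> E) = act (\<lambda>v. \<sigma> (\<tau> v)) E"
proof -
  have "conj_perm \<sigma> \<circ> conj_perm \<tau> = conj_perm (\<lambda>v. \<sigma> (\<tau> v))"
  proof
    fix v
    show "(conj_perm \<sigma> \<circ> conj_perm \<tau>) v = conj_perm (\<lambda>v. \<sigma> (\<tau> v)) v"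
    proof (cases "v \<in> {1..n}")
      case True
      define u where "u = inv_into verts \<phi> v"
      have u: "u \<in> verts" using inv_in_verts[OF True] by (simp add: u_def)
      have "conj_perm \<tau> v = \<phi> (\<tau> u)" unfolding conj_perm_def u_def using True by simp
      then have "(conj_perm \<sigma> \<circ> conj_perm \<tau>) v = \<phi> (\<sigma> (\<tau> u))" using conj_perm_phi[OF assms[OF u]] by simp
      also have "\<dots> = conj_perm (\<lambda>v. \<sigma> (\<tau> v)) v" unfolding conj_perm_def u_def using True by simp
      finally show ?thesis .
    qed (auto simp: conj_perm_def)
  qed
  then show ?thesis unfolding act_def relabel_comp[symmetric] by simp
qed

lemma act_id: "(\<And>v. v \<in> verts \<Longrightarrow> \<sigma> v = v) \<Longrightarrow> act \<sigma> E = E"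
proof -
  assume s: "\<And>v. v \<in> verts \<Longrightarrow> \<sigma> v = v"
  have "conj_perm \<sigma> v = v" for v
    unfolding conj_perm_def using s[OF inv_in_verts] \<phi> by (auto simp: bij_betw_def f_inv_into_f)
  then show ?thesis by (simp add: act_def relabel_def)
qed

lemma funpow_verts: "(\<And>v. v \<in> verts \<Longrightarrow> \<sigma> v \<in> verts) \<Longrightarrow> v \<in> verts \<Longrightarrow> (\<sigma> ^^ s) v \<in> verts"
  by (induction s) auto

lemma act_funpow:
  assumes "\<And>v. v \<in> verts \<Longrightarrow> \<sigma> v \<in> verts"
  shows "(act \<sigma> ^^ s) E = act (\<sigma> ^^ s) E"
proof (induction s)
  case 0 show ?case by (simp add: act_id)
next
  case (Suc s)
  have "act \<sigma> (act (\<sigma> ^^ s) E) = act (\<lambda>v. \<sigma> ((\<sigma> ^^ s) v)) E"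
    by (rule act_act, rule funpow_verts, rule assms)
  then show ?case using Suc by (simp add: o_def)
qed

lemma act_funpow_fixed:
  assumes "\<And>v. v \<in> verts \<Longrightarrow> \<sigma> v \<in> verts" "act \<sigma> E = E"
  shows "act (\<sigma> ^^ s) E = E"
proof -
  have "(act \<sigma> ^^ s) E = E" using assms(2) by (induction s) auto
  then show ?thesis using act_funpow[OF assms(1)] by simp
qed

lemma act_poset_auto:
  assumes P: "graph_property n P" and \<sigma>: "bij_betw \<sigma> verts verts"
  shows "poset_auto (P - {{}}) (act \<sigma>)"
  unfolding act_def
proof (rule relabel_poset_auto[OF P])
  have "bij_betw (conj_perm \<sigma>) {1..n} {1..n}"
  proof -
    have "bij_betw (\<phi> \<circ> (\<sigma> \<circ> inv_into verts \<phi>)) {1..n} {1..n}"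
      by (intro bij_betw_trans[OF _ \<phi>] bij_betw_trans[OF _ \<sigma>] bij_betw_inv_into[OF \<phi>])
    then show ?thesis by (rule bij_betw_cong[THEN iffD1, rotated]) (simp add: conj_perm_def)
  qed
  then show "conj_perm \<sigma> permutes {1..n}"
    by (rule bij_imp_permutes) (auto simp: conj_perm_def)
qed

lemma exists_invariant_graph:
  assumes P: "graph_property n P" "monotone_property P" "P \<noteq> {}" and ne: "\<not> evasive_property n P"
  shows "\<exists>E\<in>P - {{}}. (\<forall>i<k. act (trans i) E = E) \<and> act rotA E = E \<and> act rotB E = E \<and> act scale E = E"
proof -
  let ?X = "P - {{}}"
  let ?ts = "map (\<lambda>i. act (trans i)) [0..<k]"
  have fV: "finite (vertex_pairs n)" by (simp add: vertex_pairs_def finite_imp_finite_nsets)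
  have PV: "P \<subseteq> Pow (vertex_pairs n)" using P by (simp add: graph_property_def graphs_on_def)
  have fX: "finite ?X" using PV fV by (meson finite_Diff finite_Pow_iff finite_subset)
  have A: "acyclic_mod (int p) ?X"
    by (rule not_evasive_acyclic_mod[OF fV _ PV P(3)])
      (use ne P(2) in \<open>auto simp: evasive_property_def monotone_property_def\<close>)
  have rotAB: "act rotA E = E \<and> act rotB E = E" if E: "act rot E = E" for E
  proof -
    obtain s where s: "\<And>v. v \<in> verts \<Longrightarrow> (rot ^^ s) v = rotA v" using rotA_eq_rot_power by blast
    obtain s' where s': "\<And>v. v \<in> verts \<Longrightarrow> (rot ^^ s') v = rotB v" using rotB_eq_rot_power by blast
    have "act rotA E = act (rot ^^ s) E" using act_cong[of "rot ^^ s" rotA] s by simp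
    moreover have "act rotB E = act (rot ^^ s') E" using act_cong[of "rot ^^ s'" rotB] s' by simp
    moreover have "act (rot ^^ m) E = E" for m by (rule act_funpow_fixed, rule maps_verts(5)) (use E in simp_all)
    ultimately show ?thesis by simp
  qed
  have "\<exists>E\<in>?X. (\<forall>t\<in>set ?ts. t E = E) \<and> act rot E = E \<and> act scale E = E"
  proof (rule oliver_fixed_point[OF fX A p q])
    fix t assume t: "t \<in> set ?ts"
    then obtain i where i: "i < k" "t = act (trans i)" by auto
    show "poset_auto ?X t" unfolding i(2)
      by (rule act_poset_auto[OF P(1)], rule funpow_bij_betw[OF finite_verts, of _ p])
        (auto simp: maps_verts pos trans_order)
    fix E
    have "(act (trans i) ^^ p) E = act (trans i ^^ p) E" by (rule act_funpow, rule maps_verts(1))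
    also have "\<dots> = E" by (rule act_id, rule trans_order)
    finally show "(t ^^ p) E = E" unfolding i(2) .
    show "t (act rot E) = act rot E" if inv: "\<And>u. u \<in> set ?ts \<Longrightarrow> u E = E"
    proof -
      obtain j s where js: "j < k" "\<And>v. v \<in> verts \<Longrightarrow> trans i (rot v) = rot ((trans j ^^ s) v)"
        using trans_rot[OF i(1)] by blast
      have "t (act rot E) = act (\<lambda>v. trans i (rot v)) E" unfolding i(2) by (rule act_act[OF maps_verts(5)])
      also have "\<dots> = act (\<lambda>v. rot ((trans j ^^ s) v)) E" using act_cong[of "\<lambda>v. trans i (rot v)"] js(2) by metis
      also have "\<dots> = act rot (act (trans j ^^ s) E)"
        by (rule act_act[symmetric], rule funpow_verts, rule maps_verts(1))
      also have "act (trans j ^^ s) E = E"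
        by (rule act_funpow_fixed[OF maps_verts(1)[where i = j]]) (use inv js(1) in auto)
      finally show ?thesis .
    qed
    show "t (act scale E) = act scale E" if inv: "\<And>u. u \<in> set ?ts \<Longrightarrow> u E = E"
    proof -
      have "t (act scale E) = act (\<lambda>v. trans i (scale v)) E"
        unfolding i(2) by (rule act_act[OF maps_verts(4)])
      also have "\<dots> = act (\<lambda>v. scale (trans i v)) E" by (simp only: trans_scale)
      also have "\<dots> = act scale (t E)" unfolding i(2) by (rule act_act[OF maps_verts(1)[where i = i], symmetric])
      finally show ?thesis using inv[OF t] by simp
    qed
  next
    fix t u E assume "t \<in> set ?ts" "u \<in> set ?ts"
    then obtain i j where tu: "t = act (trans i)" "u = act (trans j)" by auto
    have *: "act (trans i) (act (trans j) E) = act (\<lambda>v. trans i (trans j v)) E" for i j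
      by (rule act_act, rule maps_verts(1))
    show "t (u E) = u (t E)" unfolding tu * trans_commute[of i j] ..
  next
    show "poset_auto ?X (act rot)"
    proof (rule act_poset_auto[OF P(1)], rule funpow_bij_betw[OF finite_verts, of _ "k * (p - 1) * r"])
      show "k * (p - 1) * r > 0" using k pos by simp
      fix v assume v: "v \<in> verts"
      show "rot v \<in> verts" by (rule maps_verts(5)[OF v])
      have B: "(rotB ^^ (k * (p - 1) * r)) v = v"
        using funpow_multiple[OF rotB_order[OF v], of "k * (p - 1)"] by (simp add: mult.commute)
      show "(rot ^^ (k * (p - 1) * r)) v = v"
        unfolding rot_funpow B by (rule funpow_multiple[OF rotA_order[OF v]])
    qed
    show "poset_auto ?X (act scale)"
      by (rule act_poset_auto[OF P(1)], rule funpow_bij_betw[OF finite_verts, of _ q])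
        (auto simp: maps_verts pos scale_order)
    fix E
    have "(act scale ^^ q) E = act (scale ^^ q) E" by (rule act_funpow, rule maps_verts(4))
    also have "\<dots> = E" by (rule act_id, rule scale_order)
    finally show "(act scale ^^ q) E = E" .
    \<comment> \<open>Pulled through \<open>scale\<close>, \<open>rot\<close> becomes
      \<open>rotA\<close> composed with a power of \<open>rotB\<close>. Both fix \<open>E\<close>
      separately, since they are powers of \<open>rot\<close>.\<close>
    show "act rot (act scale E) = act scale E" if E: "act rot E = E"
    proof -
      obtain s where s: "\<And>v. v \<in> verts \<Longrightarrow> rotB (scale v) = scale ((rotB ^^ s) v)" using rotB_scale by blast
      have "act rot (act scale E) = act (\<lambda>v. rot (scale v)) E" by (rule act_act[OF maps_verts(4)])
      also have "\<dots> = act (\<lambda>v. scale (rotA ((rotB ^^ s) v))) E"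
        using act_cong[of "\<lambda>v. rot (scale v)" "\<lambda>v. scale (rotA ((rotB ^^ s) v))"] s
        by (simp add: rot_def rotA_scale)
      also have "\<dots> = act scale (act (\<lambda>v. rotA ((rotB ^^ s) v)) E)"
        by (rule act_act[symmetric], rule maps_verts(2), rule funpow_verts, rule maps_verts(3))
      also have "act (\<lambda>v. rotA ((rotB ^^ s) v)) E = act rotA (act (rotB ^^ s) E)"
        by (rule act_act[symmetric], rule funpow_verts, rule maps_verts(3))
      also have "act (rotB ^^ s) E = E"
        by (rule act_funpow_fixed, rule maps_verts(3)) (use rotAB[OF E] in simp_all)
      also have "act rotA E = E" using rotAB[OF E] by simp
      finally show ?thesis .
    qed
  qed
  then obtain E where E: "E \<in> ?X" "\<forall>t\<in>set ?ts. t E = E" "act rot E = E" "act scale E = E" by (elim bexE conjE)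
  have "\<forall>i<k. act (trans i) E = E"
  proof (intro allI impI)
    fix i assume "i < k"
    then have "act (trans i) \<in> set ?ts" by simp
    then show "act (trans i) E = E" using E(2) by (rule bspec[rotated])
  qed
  then show ?thesis using rotAB[OF E(3)] E(1,4) by (intro bexI[of _ E] conjI) simp_all
qed

text \<open>One edge forces many. Its position (inside a block, between blocks, between a block and
  the prime block, inside the prime block) bounds the degrees of all vertices of one kind from
  below.\<close>

lemma invariant_graph_many_edges:
  assumes E: "E \<subseteq> vertex_pairs n" "E \<noteq> {}"
    and tr: "\<And>i. i < k \<Longrightarrow> act (trans i) E = E" and rA: "act rotA E = E" and rB: "act rotB E = E"
    and sc: "act scale E = E"
  shows "min (k * p * (p - 1)) (min (k * p * r) (r * q)) \<le> 2 * card E"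
proof -
  have fV: "finite (vertex_pairs n)" by (simp add: vertex_pairs_def finite_imp_finite_nsets)
  have fE: "finite E" using E fV finite_subset by blast
  have e2: "card e = 2" if "e \<in> E" for e using that E by (auto simp: vertex_pairs_def nsets_def)
  have inj: "inj_on \<phi> verts" using \<phi> by (simp add: bij_betw_def)
  define adj where "adj u v \<longleftrightarrow> {\<phi> u, \<phi> v} \<in> E" for u v
  have sym: "adj u v \<Longrightarrow> adj v u" for u v by (simp add: adj_def insert_commute)
  have inv: "adj ((\<sigma> ^^ s) u) ((\<sigma> ^^ s) v)"
    if \<sigma>: "\<And>v. v \<in> verts \<Longrightarrow> \<sigma> v \<in> verts" "act \<sigma> E = E" and uv: "u \<in> verts" "v \<in> verts" "adj u v" for \<sigma> s u v
  proof -
    have "conj_perm (\<sigma> ^^ s) ` {\<phi> u, \<phi> v} \<in> act (\<sigma> ^^ s) E"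
      using uv(3) unfolding adj_def act_def relabel_def by (rule imageI)
    then show ?thesis using uv act_funpow_fixed[OF \<sigma>] by (simp add: conj_perm_phi adj_def)
  qed
  have trA: "adj ((trans i ^^ s) u) ((trans i ^^ s) v)" if "i < k" "u \<in> verts" "v \<in> verts" "adj u v" for i s u v
    by (rule inv[OF maps_verts(1)[where i = i] tr[OF that(1)] that(2-4)])
  have rAA: "adj ((rotA ^^ s) u) ((rotA ^^ s) v)" if "u \<in> verts" "v \<in> verts" "adj u v" for s u v
    by (rule inv[OF maps_verts(2) rA that])
  have rBB: "adj ((rotB ^^ s) u) ((rotB ^^ s) v)" if "u \<in> verts" "v \<in> verts" "adj u v" for s u v
    by (rule inv[OF maps_verts(3) rB that])
  have scS: "adj ((scale ^^ s) u) ((scale ^^ s) v)" if "u \<in> verts" "v \<in> verts" "adj u v" for s u v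
    by (rule inv[OF maps_verts(4) sc that])
  have move: "\<exists>s. (x + s) mod m = y" if "x < m" "y < m" for x y m :: nat
    using that by (intro exI[of _ "y + m - x"]) auto
  let ?A = "Inl ` ({..<k} \<times> {..<p}) :: block_vertex set"
  let ?B = "Inr ` {..<r} :: block_vertex set"
  have cA: "card ?A = k * p" and cB: "card ?B = r" by (simp_all add: card_image)
  have AV: "?A \<subseteq> verts" "finite ?A" and BV: "?B \<subseteq> verts" "finite ?B" by (auto simp: verts_def)
  have hsA: "D * (k * p) \<le> 2 * card E"
    if "\<And>j z. j < k \<Longrightarrow> z < p \<Longrightarrow> \<exists>N\<subseteq>verts. D \<le> card N \<and> (\<forall>w\<in>N. adj (Inl (j, z)) w)" for D
  proof -
    have "\<forall>v\<in>?A. \<exists>N\<subseteq>verts. D \<le> card N \<and> (\<forall>w\<in>N. adj v w)" using that by auto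
    then obtain N where N: "\<And>v. v \<in> ?A \<Longrightarrow> N v \<subseteq> verts \<and> D \<le> card (N v) \<and> (\<forall>w\<in>N v. adj v w)"
      by metis
    have "D * card ?A \<le> 2 * card E"
      by (rule handshake_bound[OF fE e2 inj AV, of N])
        (use N finite_subset[OF _ finite_verts] in \<open>auto simp: adj_def\<close>)
    then show ?thesis by (simp add: cA)
  qed
  have hsB: "D * r \<le> 2 * card E"
    if "\<And>b. b < r \<Longrightarrow> \<exists>N\<subseteq>verts. D \<le> card N \<and> (\<forall>w\<in>N. adj (Inr b) w)" for D
  proof -
    have "\<forall>v\<in>?B. \<exists>N\<subseteq>verts. D \<le> card N \<and> (\<forall>w\<in>N. adj v w)" using that by auto
    then obtain N where N: "\<And>v. v \<in> ?B \<Longrightarrow> N v \<subseteq> verts \<and> D \<le> card (N v) \<and> (\<forall>w\<in>N v. adj v w)"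
      by metis
    have "D * card ?B \<le> 2 * card E"
      by (rule handshake_bound[OF fE e2 inj BV, of N])
        (use N finite_subset[OF _ finite_verts] in \<open>auto simp: adj_def\<close>)
    then show ?thesis by (simp add: cB)
  qed
  \<comment> \<open>Powers of the primitive root \<open>a\<close> turn one nonzero difference into
    all \<open>p - 1\<close> of them, and translations and \<open>rotA\<close> place them at every
    vertex of every block.\<close>
  have case_block: "(p - 1) * (k * p) \<le> 2 * card E"
    if i: "i < k" and xy: "x < p" "y < p" "x \<noteq> y" and ad: "adj (Inl (i, x)) (Inl (i, y))" for i x y
  proof (rule hsA)
    fix j z assume jz: "j < k" "z < p"
    define d where "d = y + p - x"
    have d: "\<not> p dvd d" "[y = x + d] (mod p)"
    proof -
      show "\<not> p dvd d"
      proof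
        assume "p dvd d"
        then have "[x + d = x] (mod p)" by (simp add: cong_add_lcancel_0_nat cong_0_iff)
        moreover have "[x + d = y] (mod p)" using xy by (simp add: d_def unique_euclidean_semiring_class.cong_def)
        ultimately have "[x = y] (mod p)" by (metis cong_sym cong_trans)
        then show False using xy by (simp add: unique_euclidean_semiring_class.cong_def)
      qed
      show "[y = x + d] (mod p)" using xy by (simp add: d_def unique_euclidean_semiring_class.cong_def)
    qed
    have tz: "adj (Inl (i, w)) (Inl (i, (w + a ^ s * d) mod p))" if w: "w < p" for w s
    proof -
      \<comment> \<open>\<open>rotA\<close> iterated \<open>k\<close> times multiplies every block by \<open>a\<close>.\<close>
      have "adj ((rotA ^^ (k * s)) (Inl (i, x))) ((rotA ^^ (k * s)) (Inl (i, y)))"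
        by (rule rAA) (use i xy ad in auto)
      then have "adj (Inl (i, a ^ s * x mod p)) (Inl (i, a ^ s * y mod p))"
        using i xy k by (simp add: rotA_funpow)
      moreover obtain t where t: "(a ^ s * x mod p + t) mod p = w" using move[of "a ^ s * x mod p" p w] w pos by auto
      ultimately have "adj (Inl (i, (a ^ s * x mod p + t) mod p)) (Inl (i, (a ^ s * y mod p + t) mod p))"
        using trA[OF i, of "Inl (i, a ^ s * x mod p)" "Inl (i, a ^ s * y mod p)" t] i pos
        by (simp add: trans_funpow)
      moreover have "(a ^ s * y mod p + t) mod p = (w + a ^ s * d) mod p"
      proof -
        have "[a ^ s * y = a ^ s * (x + d)] (mod p)" by (rule cong_scalar_left[OF d(2)])
        then have 1: "[a ^ s * y + t = a ^ s * x + a ^ s * d + t] (mod p)"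
          by (intro cong_add) (simp_all add: distrib_left)
        have "[a ^ s * x + t = w] (mod p)" using t w by (simp add: unique_euclidean_semiring_class.cong_def mod_add_left_eq)
        then have "[(a ^ s * x + t) + a ^ s * d = w + a ^ s * d] (mod p)" by (intro cong_add) auto
        then have "[a ^ s * y + t = w + a ^ s * d] (mod p)"
          using cong_trans[OF 1] by (simp add: ac_simps)
        then show ?thesis by (simp add: unique_euclidean_semiring_class.cong_def mod_add_left_eq)
      qed
      ultimately show ?thesis using t by simp
    qed
    let ?N = "(\<lambda>s. Inl (j, (z + a ^ s * d) mod p)) ` {..<p - 1} :: block_vertex set"
    have "inj_on (\<lambda>s. (z + a ^ s * d) mod p) {..<p - 1}"
      using scaled_translates_inj[OF p a(1) d(1), of z] a(2) by simp
    then have "card ?N = p - 1" by (subst card_image) (auto simp: inj_on_def)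
    moreover have "?N \<subseteq> verts" using jz pos by auto
    moreover have "adj (Inl (j, z)) (Inl (j, (z + a ^ s * d) mod p))" for s
    proof -
      have w: "(z + a ^ s * d) mod p < p" using pos by simp
      show ?thesis
        using rAA[OF _ _ tz[OF jz(2), of s], of "j + k * (p - 1) - i"] i jz w
        unfolding rotA_shift[OF i jz(2) jz(1)] rotA_shift[OF i w jz(1)] by simp
    qed
    ultimately show "\<exists>N\<subseteq>verts. p - 1 \<le> card N \<and> (\<forall>w\<in>N. adj (Inl (j, z)) w)"
      by (intro exI[of _ ?N]) auto
  qed
  \<comment> \<open>Blocks are translated independently, so one edge between two blocks joins all
    their vertices.\<close>
  have case_blocks: "p * (k * p) \<le> 2 * card E"
    if ij: "i < k" "i' < k" "i \<noteq> i'" and xy: "x < p" "y < p" and ad: "adj (Inl (i, x)) (Inl (i', y))" for i i' x y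
  proof (rule hsA)
    fix j z assume jz: "j < k" "z < p"
    obtain t where t: "(x + t) mod p = z" using move[of x p z] xy jz by auto
    have 1: "adj (Inl (i, z)) (Inl (i', y))"
      using trA[OF ij(1) _ _ ad, of t] ij xy t by (simp add: trans_funpow trans_funpow_other)
    define s where "s = j + k * (p - 1) - i"
    define j' where "j' = (i' + s) mod k"
    define y' where "y' = (a ^ ((i' + s) div k) * y) mod p"
    have y': "y' < p" "j' < k" using pos k by (auto simp: y'_def j'_def)
    have s1: "(rotA ^^ s) (Inl (i, z)) = Inl (j, z)" unfolding s_def by (rule rotA_shift) (use ij jz in auto)
    have s2: "(rotA ^^ s) (Inl (i', y)) = Inl (j', y')" unfolding j'_def y'_def by (rule rotA_funpow) (use ij xy in auto)
    have 2: "adj (Inl (j, z)) (Inl (j', y'))" using rAA[OF _ _ 1, of s] ij jz xy s1 s2 by simp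
    have jj: "j \<noteq> j'"
    proof
      assume "j = j'"
      then have "(i + s) mod k = (i' + s) mod k"
        using s1 rotA_funpow[OF ij(1) jz(2), of s] by (simp add: j'_def)
      then have "[i + s = i' + s] (mod k)" by (simp add: unique_euclidean_semiring_class.cong_def)
      then have "[i = i'] (mod k)" by (simp add: cong_add_rcancel_nat)
      then show False using ij by (simp add: unique_euclidean_semiring_class.cong_def)
    qed
    have 3: "adj (Inl (j, z)) (Inl (j', w))" if w: "w < p" for w
    proof -
      obtain u where u: "(y' + u) mod p = w" using move[of y' p w] y' w by auto
      show ?thesis using trA[OF y'(2) _ _ 2, of u] jz y' jj u by (simp add: trans_funpow trans_funpow_other)
    qed
    let ?N = "(\<lambda>w. Inl (j', w)) ` {..<p} :: block_vertex set"
    have "card ?N = p" by (subst card_image) (auto simp: inj_on_def)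
    then show "\<exists>N\<subseteq>verts. p \<le> card N \<and> (\<forall>w\<in>N. adj (Inl (j, z)) w)"
      using 3 y' by (intro exI[of _ ?N]) auto
  qed
  \<comment> \<open>\<open>rotB\<close> moves the prime block while the other blocks stay, so each
    of their vertices is joined to all of the prime block.\<close>
  have case_AB: "r * (k * p) \<le> 2 * card E"
    if i: "i < k" "x < p" "b < r" and ad: "adj (Inl (i, x)) (Inr b)" for i x b
  proof (rule hsA)
    fix j z assume jz: "j < k" "z < p"
    obtain t where t: "(x + t) mod p = z" using move[of x p z] i jz by auto
    have 1: "adj (Inl (i, z)) (Inr b)"
      using trA[OF i(1) _ _ ad, of t] i t by (simp add: trans_funpow trans_funpow_Inr)
    have 2: "adj (Inl (j, z)) (Inr b)"
      using rAA[OF _ _ 1, of "j + k * (p - 1) - i"] i jz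
      unfolding rotA_shift[OF i(1) jz(2) jz(1)] rotA_funpow_Inr by simp
    have 3: "adj (Inl (j, z)) (Inr w)" if w: "w < r" for w
    proof -
      obtain u where u: "(b + u) mod r = w" using move[of b r w] i w by auto
      show ?thesis using rBB[OF _ _ 2, of u] jz i u by (simp add: rotB_funpow rotB_funpow_Inl)
    qed
    have "card ?B = r" by (rule cB)
    then show "\<exists>N\<subseteq>verts. r \<le> card N \<and> (\<forall>w\<in>N. adj (Inl (j, z)) w)"
      using 3 BV by (intro exI[of _ ?B]) auto
  qed
  \<comment> \<open>Only the powers of \<open>c\<close> act by multiplication here, so one
    difference yields \<open>q\<close> of them. This is where the size of the prime factor of
    \<open>r - 1\<close> enters.\<close>
  have case_BB: "q * r \<le> 2 * card E"
    if xy: "x < r" "y < r" "x \<noteq> y" and ad: "adj (Inr x) (Inr y)" for x y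
  proof (rule hsB)
    fix w assume w: "w < r"
    define d where "d = y + r - x"
    have d: "\<not> r dvd d" "[y = x + d] (mod r)"
    proof -
      show "\<not> r dvd d"
      proof
        assume "r dvd d"
        then have "[x + d = x] (mod r)" by (simp add: cong_add_lcancel_0_nat cong_0_iff)
        moreover have "[x + d = y] (mod r)" using xy by (simp add: d_def unique_euclidean_semiring_class.cong_def)
        ultimately have "[x = y] (mod r)" by (metis cong_sym cong_trans)
        then show False using xy by (simp add: unique_euclidean_semiring_class.cong_def)
      qed
      show "[y = x + d] (mod r)" using xy by (simp add: d_def unique_euclidean_semiring_class.cong_def)
    qed
    have tz: "adj (Inr w) (Inr ((w + c ^ s * d) mod r))" for s
    proof -
      have "adj ((scale ^^ s) (Inr x)) ((scale ^^ s) (Inr y))"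
        by (rule scS) (use xy ad in auto)
      then have "adj (Inr (c ^ s * x mod r)) (Inr (c ^ s * y mod r))"
        using xy by (simp add: scale_funpow)
      moreover obtain t where t: "(c ^ s * x mod r + t) mod r = w" using move[of "c ^ s * x mod r" r w] w pos by auto
      ultimately have "adj (Inr ((c ^ s * x mod r + t) mod r)) (Inr ((c ^ s * y mod r + t) mod r))"
        using rBB[of "Inr (c ^ s * x mod r)" "Inr (c ^ s * y mod r)" t] pos
        by (simp add: rotB_funpow)
      moreover have "(c ^ s * y mod r + t) mod r = (w + c ^ s * d) mod r"
      proof -
        have "[c ^ s * y = c ^ s * (x + d)] (mod r)" by (rule cong_scalar_left[OF d(2)])
        then have 1: "[c ^ s * y + t = c ^ s * x + c ^ s * d + t] (mod r)"
          by (intro cong_add) (simp_all add: distrib_left)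
        have "[c ^ s * x + t = w] (mod r)" using t w by (simp add: unique_euclidean_semiring_class.cong_def mod_add_left_eq)
        then have "[(c ^ s * x + t) + c ^ s * d = w + c ^ s * d] (mod r)" by (intro cong_add) auto
        then have "[c ^ s * y + t = w + c ^ s * d] (mod r)"
          using cong_trans[OF 1] by (simp add: ac_simps)
        then show ?thesis by (simp add: unique_euclidean_semiring_class.cong_def mod_add_left_eq)
      qed
      ultimately show ?thesis using t by simp
    qed
    let ?N = "(\<lambda>s. Inr ((w + c ^ s * d) mod r)) ` {..<q} :: block_vertex set"
    have "inj_on (\<lambda>s. (w + c ^ s * d) mod r) {..<q}"
      using scaled_translates_inj[OF r c(1) d(1), of w] c(2) by simp
    then have "card ?N = q" by (subst card_image) (auto simp: inj_on_def)
    moreover have "?N \<subseteq> verts" using pos by auto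
    ultimately show "\<exists>N\<subseteq>verts. q \<le> card N \<and> (\<forall>u\<in>N. adj (Inr w) u)"
      using tz by (intro exI[of _ ?N]) auto
  qed
  obtain e where e: "e \<in> E" using E by blast
  then have "e \<subseteq> {1..n}" "card e = 2" using E by (auto simp: vertex_pairs_def nsets_def)
  then obtain x y where xy: "e = {x, y}" "x \<noteq> y" "x \<in> {1..n}" "y \<in> {1..n}" by (auto simp: card_2_iff)
  then obtain u v where uv: "u \<in> verts" "v \<in> verts" "x = \<phi> u" "y = \<phi> v" using \<phi> by (metis bij_betw_def imageE)
  have ad: "adj u v" and ne: "u \<noteq> v" using e xy uv by (auto simp: adj_def)
  have pp: "k * p * (p - 1) \<le> p * (k * p)" by simp
  from uv(1) show ?thesis
  proof (cases rule: verts_cases)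
    case A: (A i x)
    from uv(2) show ?thesis
    proof (cases rule: verts_cases)
      case A': (A j y)
      show ?thesis
      proof (cases "i = j")
        case True
        then have "(p - 1) * (k * p) \<le> 2 * card E" using case_block[of i x y] A A' ad ne by auto
        then show ?thesis by (simp add: mult.commute min_le_iff_disj)
      next
        case False
        then have "p * (k * p) \<le> 2 * card E" using case_blocks[of i j x y] A A' ad by auto
        then have "k * p * (p - 1) \<le> 2 * card E" using pp by linarith
        then show ?thesis by (simp add: min_le_iff_disj)
      qed
    next
      case B: (B b)
      then have "r * (k * p) \<le> 2 * card E" using case_AB[of i x b] A ad by auto
      then show ?thesis by (simp add: mult.commute min_le_iff_disj)
    qed
  next
    case B: (B b)
    from uv(2) show ?thesis
    proof (cases rule: verts_cases)
      case A: (A i x)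
      then have "r * (k * p) \<le> 2 * card E" using case_AB[of i x b] B sym[OF ad] by auto
      then show ?thesis by (simp add: mult.commute min_le_iff_disj)
    next
      case B': (B b')
      then have "q * r \<le> 2 * card E" using case_BB[of b b'] B ad ne by auto
      then show ?thesis by (simp add: mult.commute min_le_iff_disj)
    qed
  qed
qed

end

end

section \<open>From arithmetic data to the edge bound\<close>

theorem nonevasive_many_edges:
  fixes n k p q r :: nat
  assumes pr: "prime p" "prime q" "prime r" and k: "k > 0" and n: "n = k * p + r"
    and q: "q dvd r - 1" and cop: "coprime r (k * (p - 1))"
    and P: "graph_property n P" "monotone_property P" "P \<noteq> {}" and ne: "\<not> evasive_property n P"
  shows "\<exists>E\<in>P. min (k * p * (p - 1)) (min (k * p * r) (r * q)) \<le> 2 * card E"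
proof -
  obtain a where a: "residue_primroot p a" using prime_primitive_root_exists[of p] pr prime_gt_1_nat by blast
  obtain g where g: "residue_primroot r g" using prime_primitive_root_exists[of r] pr prime_gt_1_nat by blast
  obtain m where m: "r - 1 = q * m" using q by (elim dvdE)
  have r1: "r - 1 > 0" using prime_gt_1_nat[OF pr(3)] by simp
  have g': "coprime r g" "ord r g = r - 1" using g pr(3) by (auto simp: residue_primroot_def totient_prime)
  \<comment> \<open>The divisibility \<open>q dvd r - 1\<close> makes this power of a primitive root
    an element of order exactly \<open>q\<close>, which serves as the multiplier of the prime
    block.\<close>
  have "ord r (g ^ m) = (r - 1) div gcd m (r - 1)" using ord_power[OF g'(1), of m] g'(2) by simp
  also have "gcd m (r - 1) = m" using m by simp
  also have "(r - 1) div m = q" using m r1 by (cases "m = 0") auto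
  finally have oc: "ord r (g ^ m) = q" .
  interpret block_group k p q r a "g ^ m"
    by unfold_locales (use pr k cop a g' oc in \<open>auto simp: residue_primroot_def totient_prime\<close>)
  have "card verts = card {1..n}" using card_verts n by simp
  then obtain \<phi> where \<phi>: "bij_betw \<phi> verts {1..n}"
    using finite_same_card_bij[OF finite_verts, of "{1..n}"] by auto
  obtain E where E: "E \<in> P - {{}}" "\<And>i. i < k \<Longrightarrow> act n \<phi> (trans i) E = E" "act n \<phi> rotA E = E"
    "act n \<phi> rotB E = E" "act n \<phi> scale E = E"
    using exists_invariant_graph[OF \<phi> P ne] by blast
  have "E \<subseteq> vertex_pairs n" using P(1) E(1) by (auto simp: graph_property_def graphs_on_def)
  then have "min (k * p * (p - 1)) (min (k * p * r) (r * q)) \<le> 2 * card E"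
    using invariant_graph_many_edges[OF \<phi> _ _ E(2-5)] E(1) by blast
  then show ?thesis using E(1) by blast
qed

text \<open>The product of \<open>n / ln n ^ 2\<close> and \<open>smooth_bound n\<close> has four
  logarithms in the denominator. The fifth one absorbs the factor 2 of the handshake count and the
  loss from \<open>p - 1\<close>.\<close>

lemma eventually_orbit_sizes:
  "\<forall>\<^sub>F n::nat in sequentially.
     2 * (real n powr (5/4) / ln (real n) ^ 5) < real n / ln (real n) ^ 2 * (smooth_bound (real n) - 1) \<and>
     2 * (real n powr (5/4) / ln (real n) ^ 5) < real n / ln (real n) ^ 2 * (real n / ln (real n) ^ 2) \<and>
     smooth_bound (real n) > 1 \<and> ln (real n) > 0 \<and> n \<ge> 3"
proof -
  have e: "\<forall>\<^sub>F x::real in at_top.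
     2 * (x powr (5/4) / ln x ^ 5) < x / ln x ^ 2 * (smooth_bound x - 1) \<and>
     2 * (x powr (5/4) / ln x ^ 5) < x / ln x ^ 2 * (x / ln x ^ 2) \<and>
     smooth_bound x > 1 \<and> ln x > 0"
    unfolding eventually_conj_iff smooth_bound_def by (intro conjI; real_asymp)
  show ?thesis
    using eventually_compose_filterlim[OF e filterlim_real_sequentially] eventually_ge_at_top[of "3::nat"]
    by eventually_elim auto
qed

theorem theorem1:
  "\<exists>f :: nat \<Rightarrow> real.
     (\<forall>n. f n > 0) \<and>
     (\<exists>\<epsilon> :: nat \<Rightarrow> real. \<epsilon> \<in> o(\<lambda>_. 1) \<and>
        (\<forall>\<^sub>F n in sequentially. f n = real n powr (5 / 4 + \<epsilon> n))) \<and>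
     (\<forall>\<^sub>F n in sequentially. \<forall>P.
        graph_property n P \<and> monotone_property P \<and> nontrivial_property n P \<and>
        (\<forall>E\<in>P. real (card E) \<le> f n) \<longrightarrow> evasive_property n P)"
proof -
  \<comment> \<open>The default 1 keeps \<open>f\<close> positive at 0 and 1, where the formula
    would give 0.\<close>
  define f :: "nat \<Rightarrow> real" where
    "f n = (if n \<ge> 3 then real n powr (5/4) / ln (real n) ^ 5 else 1)" for n
  \<comment> \<open>Chosen so that \<open>n powr \<epsilon> n\<close> is the inverse fifth power of
    \<open>ln n\<close>.\<close>
  define \<epsilon> :: "nat \<Rightarrow> real" where "\<epsilon> n = - 5 * ln (ln (real n)) / ln (real n)" for n
  have f_pos: "f n > 0" for n by (simp add: f_def)
  have \<epsilon>_o: "\<epsilon> \<in> o(\<lambda>_. 1)" unfolding \<epsilon>_def by real_asymp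
  have f_powr: "\<forall>\<^sub>F n in sequentially. f n = real n powr (5 / 4 + \<epsilon> n)"
    using eventually_orbit_sizes
  proof eventually_elim
    case (elim n)
    then have l0: "ln (real n) > 0" and n3: "n \<ge> 3" by auto
    have "real n powr \<epsilon> n = exp (- (5 * ln (ln (real n))))"
      using l0 n3 by (simp add: powr_def \<epsilon>_def)
    also have "\<dots> = 1 / ln (real n) ^ 5"
      using l0 by (simp add: exp_minus exp_of_nat_mult[of 5, simplified] inverse_eq_divide)
    finally show ?case using n3 by (simp add: powr_add f_def)
  qed
  have main: "\<forall>\<^sub>F n in sequentially. \<forall>P.
        graph_property n P \<and> monotone_property P \<and> nontrivial_property n P \<and>
        (\<forall>E\<in>P. real (card E) \<le> f n) \<longrightarrow> evasive_property n P"
    using eventually_good_prime eventually_orbit_sizes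
  proof eventually_elim
    case (elim n)
    define t where "t = real n / ln (real n) ^ 2"
    define y where "y = smooth_bound (real n)"
    from elim(1) obtain p q r k :: nat where
      pr: "prime p" "prime q" "prime r" and n: "n = k * p + r" and k: "k > 0"
      and q: "q dvd r - 1" and cop: "coprime r (k * (p - 1))"
      and big: "real p > y" "real q > y" "real r \<ge> t" "real (k * p) \<ge> t"
      unfolding t_def y_def by blast
    have fn: "2 * f n < t * (y - 1)" "2 * f n < t * t" and y1: "y > 1" and t0: "t \<ge> 0"
      using elim(2) by (auto simp: f_def t_def y_def)
    show ?case
    proof (intro allI impI, elim conjE, rule ccontr)
      fix P assume P: "graph_property n P" "monotone_property P" "nontrivial_property n P"
        and card: "\<forall>E\<in>P. real (card E) \<le> f n" and ne: "\<not> evasive_property n P"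
      have "P \<noteq> {}" using P(3) by (simp add: nontrivial_property_def)
      then obtain E where E: "E \<in> P" "min (k * p * (p - 1)) (min (k * p * r) (r * q)) \<le> 2 * card E"
        using nonevasive_many_edges[OF pr k n q cop P(1,2) _ ne] by blast
      have cE: "real (card E) \<le> f n" using card E(1) by blast
      have "2 * real (card E) < real (k * p * (p - 1))"
      proof -
        have "real (p - 1) = real p - 1" using prime_gt_0_nat[OF pr(1)] by (simp add: of_nat_diff)
        then have "t * (y - 1) \<le> real (k * p) * real (p - 1)"
          using big y1 t0 by (intro mult_mono) auto
        then have "t * (y - 1) \<le> real (k * p * (p - 1))" by (simp only: of_nat_mult)
        then show ?thesis using fn(1) cE by linarith
      qed
      moreover have "2 * real (card E) < real (k * p * r)"
      proof -
        have "t * t \<le> real (k * p) * real r" using big t0 by (intro mult_mono) auto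
        then have "t * t \<le> real (k * p * r)" by (simp only: of_nat_mult)
        then show ?thesis using fn(2) cE by linarith
      qed
      moreover have "2 * real (card E) < real (r * q)"
      proof -
        have "t * (y - 1) \<le> real r * real q" using big y1 t0 by (intro mult_mono) auto
        then have "t * (y - 1) \<le> real (r * q)" by (simp only: of_nat_mult)
        then show ?thesis using fn(1) cE by linarith
      qed
      ultimately have "2 * card E < min (k * p * (p - 1)) (min (k * p * r) (r * q))"
        by (simp only: min_less_iff_conj) linarith
      with E(2) show False by linarith
    qed
  qed
  show ?thesis using f_pos \<epsilon>_o f_powr main by blast
qed

end
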